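(* Let $K$ be a saturated real closed field with standard valuation $v$, let $E: y^2=x(x+1)(x+\varepsilon)$ with $0<\varepsilon<1$ and $v(\varepsilon)>0$, $G=E(K)^0$, $H=([\varepsilon,1/\varepsilon),*\bmod\varepsilon^2)$, and $f_*:G\to H$ defined by $f_*(P)=1$ if $P=O$ or $x_P\ge1$; $f_*(P)=1/x_P$ if $y_P\ge0$ and $\varepsilon<x_P<1$; $f_*(P)=x_P$ if $y_P<0$ and $\varepsilon<x_P<1$; $f_*(P)=\varepsilon$ if $x_P\le\varepsilon$. Then $f_*$ induces a well-defined map $f:G/G^{00}\to H/H^{00}$, $P\oplus G^{00}\mapsto f_*(P)*H^{00}$; that is, whenever $P,Q\in G$ with $P\ominus Q\in G^{00}$, we have $f_*(P)*f_*(Q)^{-1}\in H^{00}$.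
   Context: The standard valuation $v$ on $K$ has valuation ring the convex hull of $\mathbb{Q}$ in $K$. $E(K)$ is a group under the chord–tangent law with identity the point at infinity $O$; $E(K)^0=\{O\}\cup\{(x,y)\in E(K):x\ge0\}$; $P=(x_P,y_P)$. $H$ is the multiplicative truncation with underlying set $\{x\in K:\varepsilon\le x<1/\varepsilon\}$ and $x*y=xy$ if $\varepsilon\le xy<1/\varepsilon$, $xy\varepsilon^2$ if $xy\ge1/\varepsilon$, $xy/\varepsilon^2$ if $xy<\varepsilon$. $X^{00}$ denotes the smallest type-definable subgroup of bounded index of a definable group $X$. *)

theory Defs
  imports "HOL-Algebra.Coset" "HOL-Library.Equipollence" Complex_Main
begin

section \<open>Real closed fields and their definable sets\<close>

class real_closed_field = linordered_field +
  assumes nonneg_imp_square: "0 \<le> a \<Longrightarrow> \<exists>b. b * b = a"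
    and odd_degree_imp_root: "odd n \<Longrightarrow> f n \<noteq> 0 \<Longrightarrow> \<exists>x. (\<Sum>k\<le>n. f k * x ^ k) = 0"

text \<open>
  First-order formulas of the language of ordered rings, with parameters from the structure
  (constructor \<open>TParam\<close>) and with de Bruijn indices for the variables.
\<close>

datatype 'a rterm =
    TVar nat
  | TParam 'a
  | TZero
  | TOne
  | TNeg "'a rterm"
  | TAdd "'a rterm" "'a rterm"
  | TMul "'a rterm" "'a rterm"

datatype 'a rform =
    FEq "'a rterm" "'a rterm"
  | FLess "'a rterm" "'a rterm"
  | FNot "'a rform"
  | FAnd "'a rform" "'a rform"
  | FEx "'a rform"

primrec teval :: "(nat \<Rightarrow> 'a::linordered_field) \<Rightarrow> 'a rterm \<Rightarrow> 'a" where
  "teval e (TVar i) = e i"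
| "teval e (TParam a) = a"
| "teval e TZero = 0"
| "teval e TOne = 1"
| "teval e (TNeg s) = - teval e s"
| "teval e (TAdd s t) = teval e s + teval e t"
| "teval e (TMul s t) = teval e s * teval e t"

primrec feval :: "(nat \<Rightarrow> 'a::linordered_field) \<Rightarrow> 'a rform \<Rightarrow> bool" where
  "feval e (FEq s t) \<longleftrightarrow> teval e s = teval e t"
| "feval e (FLess s t) \<longleftrightarrow> teval e s < teval e t"
| "feval e (FNot \<phi>) \<longleftrightarrow> \<not> feval e \<phi>"
| "feval e (FAnd \<phi> \<psi>) \<longleftrightarrow> feval e \<phi> \<and> feval e \<psi>"
| "feval e (FEx \<phi>) \<longleftrightarrow> (\<exists>x. feval (case_nat x e) \<phi>)"

text \<open>
  The set function \<open>set_rform\<close> generated by the datatype package collects exactly the parameters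
  of a formula. Free variables beyond the length of the tuple are read as 0; as 0 is a constant of
  the language, this does not enlarge the class of definable sets.
\<close>

definition tuple_env :: "'a::zero list \<Rightarrow> nat \<Rightarrow> 'a" where
  "tuple_env xs i = (if i < length xs then xs ! i else 0)"

definition definable :: "'a::linordered_field set \<Rightarrow> nat \<Rightarrow> 'a list set \<Rightarrow> bool" where
  "definable A n X \<longleftrightarrow>
     (\<exists>\<phi>. set_rform \<phi> \<subseteq> A \<and> X = {xs. length xs = n \<and> feval (tuple_env xs) \<phi>})"

definition definable_line :: "'a::linordered_field set \<Rightarrow> 'a set \<Rightarrow> bool" where
  "definable_line A X \<longleftrightarrow> definable A 1 {[x] |x. x \<in> X}"

text \<open>
  Saturation in the cardinality of the field itself: every 1-type over a parameter set of
  cardinality less than that of the field is realised.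
\<close>

definition saturated_field :: "'a::linordered_field itself \<Rightarrow> bool" where
  "saturated_field _ \<longleftrightarrow>
     (\<forall>(A :: 'a set) \<F>. A \<prec> (UNIV :: 'a set) \<longrightarrow> (\<forall>X\<in>\<F>. definable_line A X) \<longrightarrow>
        (\<forall>\<F>\<^sub>0. \<F>\<^sub>0 \<subseteq> \<F> \<longrightarrow> finite \<F>\<^sub>0 \<longrightarrow> \<Inter>\<F>\<^sub>0 \<noteq> {}) \<longrightarrow> \<Inter>\<F> \<noteq> {})"


section \<open>The standard valuation\<close>

definition std_val_ring :: "'a::linordered_field set" where
  "std_val_ring = {x. \<exists>p q :: rat. of_rat p \<le> x \<and> x \<le> of_rat q}"

definition std_val_units :: "'a::linordered_field set" where
  "std_val_units = {u. u \<in> std_val_ring \<and> (\<exists>w\<in>std_val_ring. u * w = 1)}"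

text \<open>
  The value of \<open>x\<close> is its class modulo the units of the valuation ring. The value group is written
  additively, so its zero is \<open>std_val 1\<close>; the value of 0 is the singleton \<open>{0}\<close>, which is the
  largest element.
\<close>

definition std_val :: "'a::linordered_field \<Rightarrow> 'a set" where
  "std_val x = (\<lambda>u. x * u) ` std_val_units"

definition val_le :: "'a::linordered_field set \<Rightarrow> 'a set \<Rightarrow> bool" where
  "val_le V W \<longleftrightarrow> (\<exists>x\<in>V. \<exists>y\<in>W. \<exists>a\<in>std_val_ring. y = a * x)"

definition val_less :: "'a::linordered_field set \<Rightarrow> 'a set \<Rightarrow> bool" where
  "val_less V W \<longleftrightarrow> val_le V W \<and> \<not> val_le W V"


section \<open>The smallest type-definable subgroup of bounded index\<close>

text \<open>
  The argument \<open>D\<close> gives the definable sets: \<open>D A X\<close> says that \<open>X\<close> is definable over the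
  parameter set \<open>A\<close>. Both ``small'' (for parameter sets) and ``bounded'' (for the index) mean
  of cardinality less than that of the field.
\<close>

definition type_definable ::
    "('a::linordered_field set \<Rightarrow> 'b set \<Rightarrow> bool) \<Rightarrow> 'b set \<Rightarrow> bool" where
  "type_definable D X \<longleftrightarrow>
     (\<exists>A \<F>. A \<prec> (UNIV :: 'a set) \<and> (\<forall>Y\<in>\<F>. D A Y) \<and> X = \<Inter>\<F>)"

definition tdef_bounded_subgroup ::
    "('a::linordered_field set \<Rightarrow> 'b set \<Rightarrow> bool) \<Rightarrow> ('b, 'c) monoid_scheme \<Rightarrow> 'b set \<Rightarrow> bool" where
  "tdef_bounded_subgroup D G S \<longleftrightarrow>
     subgroup S G \<and> type_definable D S \<and> (rcosets\<^bsub>G\<^esub> S) \<prec> (UNIV :: 'a set)"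

text \<open>
  The smallest member of a family of sets, when there is one, is its intersection
  (see \<open>conn00_eq_smallest\<close>); taking the intersection makes the definition total.
\<close>

definition conn00 ::
    "('a::linordered_field set \<Rightarrow> 'b set \<Rightarrow> bool) \<Rightarrow> ('b, 'c) monoid_scheme \<Rightarrow> 'b set" where
  "conn00 D G = \<Inter>{S. tdef_bounded_subgroup D G S}"

lemma conn00_eq_smallest:
  assumes "tdef_bounded_subgroup D G S"
    and "\<And>T. tdef_bounded_subgroup D G T \<Longrightarrow> S \<subseteq> T"
  shows "conn00 D G = S"
  using assms unfolding conn00_def by blast


section \<open>The elliptic curve\<close>

text \<open>\<open>None\<close> is the point at infinity.\<close>

type_synonym 'a point = "('a \<times> 'a) option"

definition definable_points :: "'a::linordered_field set \<Rightarrow> 'a point set \<Rightarrow> bool" where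
  "definable_points A X \<longleftrightarrow> definable A 2 {[x, y] |x y. Some (x, y) \<in> X}"

text \<open>
  Chord-tangent law for $y^2 = x(x+1)(x+\varepsilon) = x^3 + (1+\varepsilon)x^2 + \varepsilon x$;
  \<open>m\<close> is the slope of the chord, respectively of the tangent.
\<close>

fun ell_add :: "'a::linordered_field \<Rightarrow> 'a point \<Rightarrow> 'a point \<Rightarrow> 'a point" where
  "ell_add \<epsilon> None Q = Q"
| "ell_add \<epsilon> P None = P"
| "ell_add \<epsilon> (Some (x1, y1)) (Some (x2, y2)) =
     (if x1 = x2 \<and> y1 = - y2 then None
      else let m = (if x1 = x2 then (3 * x1\<^sup>2 + 2 * (1 + \<epsilon>) * x1 + \<epsilon>) / (2 * y1)
                    else (y2 - y1) / (x2 - x1));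
               x3 = m\<^sup>2 - (1 + \<epsilon>) - x1 - x2
           in Some (x3, m * (x1 - x3) - y1))"

definition ell_group :: "'a::linordered_field \<Rightarrow> 'a point monoid" where
  "ell_group \<epsilon> =
     \<lparr>carrier = {None} \<union> {Some (x, y) |x y. y\<^sup>2 = x * (x + 1) * (x + \<epsilon>)},
      monoid.mult = ell_add \<epsilon>, one = None\<rparr>"

definition ell_group0 :: "'a::linordered_field \<Rightarrow> 'a point monoid" where
  "ell_group0 \<epsilon> = (ell_group \<epsilon>)
     \<lparr>carrier := {None} \<union> {Some (x, y) |x y. Some (x, y) \<in> carrier (ell_group \<epsilon>) \<and> 0 \<le> x}\<rparr>"


section \<open>The multiplicative truncation and the map between the two groups\<close>

definition trunc_mult :: "'a::linordered_field \<Rightarrow> 'a \<Rightarrow> 'a \<Rightarrow> 'a" where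
  "trunc_mult \<epsilon> x y =
     (if x * y \<ge> 1 / \<epsilon> then x * y * \<epsilon>\<^sup>2
      else if x * y < \<epsilon> then x * y / \<epsilon>\<^sup>2
      else x * y)"

definition trunc_group :: "'a::linordered_field \<Rightarrow> 'a monoid" where
  "trunc_group \<epsilon> = \<lparr>carrier = {\<epsilon>..<1 / \<epsilon>}, monoid.mult = trunc_mult \<epsilon>, one = 1\<rparr>"

fun f_star :: "'a::linordered_field \<Rightarrow> 'a point \<Rightarrow> 'a" where
  "f_star \<epsilon> None = 1"
| "f_star \<epsilon> (Some (x, y)) =
     (if x \<ge> 1 then 1
      else if \<epsilon> < x \<and> y \<ge> 0 then 1 / x
      else if \<epsilon> < x \<and> y < 0 then x
      else \<epsilon>)"

abbreviation ell00 :: "'a::linordered_field \<Rightarrow> 'a point set" where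
  "ell00 \<epsilon> \<equiv> conn00 definable_points (ell_group0 \<epsilon>)"

abbreviation trunc00 :: "'a::linordered_field \<Rightarrow> 'a set" where
  "trunc00 \<epsilon> \<equiv> conn00 definable_line (trunc_group \<epsilon>)"

end

theory Submission
  imports Defs "HOL-Algebra.Algebraic_Closure_Type"
begin

text \<open>
  Let $S$ be a type-definable subgroup of bounded index of the truncation $H$. By quantifier
  elimination for real closed fields, the infinite elements below a suitable infinite $y_0$ all have the
  same type over the parameters of $S$. If one of them lies in $S$, then so do all, and the quotients
  $y_0/(y_0/u)$ show that $S$ contains every $u$ between two positive rationals. If none does, choose
  representatives $w$ for the cosets that they meet; saturation yields an infinite $y$ with $y^2 < w$
  for all of them, so $w/y$ is infinite and not in $S$ although some $w$ lies in the coset of $y$.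

  On the other hand $f_*$ is a homomorphism up to a finite factor and powers of $\varepsilon^2$: for
  collinear points with $y_1, y_2 > 0$ the third abscissa is comparable to an explicit rational
  function of $x_1$ and $x_2$. Hence the preimage of $S$ under $f_*$ is a type-definable subgroup of $G$
  whose cosets inject into those of $S$, so it contains $G^{00}$.
\<close>

section \<open>Polynomials over a real closed field\<close>

text \<open>The difficulty is that \<open>f_star\<close> is not a homomorphism: it respects the two
  laws only up to factors between two positive rationals, so every admissible \<open>S\<close> has
  to contain all such factors. An \<open>S\<close> is known only as an intersection of definable
  sets whose formulas may have quantifiers, and comparing two infinite elements means controlling
  all these formulas at once. Hence the real algebra: the axioms of a real closed field give only
  square roots and roots in odd degree. Laplace's argument extracts the intermediate value theorem
  from them, sign charts of polynomials are transported between two ordered subfields, and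
  saturation turns this into back and forth. The groups \<open>conn00\<close> are plain
  intersections, so the argument runs for one \<open>S\<close> at a time. On the curve the law is
  handled through collinearity of three points, a relation symmetric in them; sizes are estimated
  for two points with nonnegative ordinate, and negation and permutation reduce every other case to
  this one.\<close>

text \<open>Logarithmic derivative: each factor contributes \<open>- x i / (1 - x i X)\<close>, a
  geometric series, so the power sums appear as coefficients. The factors have constant term 1 in
  order to be invertible as power series.\<close>

lemma fps_deriv_linear_prod:
  fixes x :: "'i \<Rightarrow> 'a::field"
  assumes "finite I"
  shows "fps_deriv (fps_of_poly (\<Prod>i\<in>I. [:1, - x i:]))
       = - (fps_of_poly (\<Prod>i\<in>I. [:1, - x i:]) * Abs_fps (\<lambda>k. \<Sum>i\<in>I. x i ^ Suc k))"
  using assms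
proof (induction I)
  case empty
  show ?case by (simp add: fps_eq_iff fps_mult_nth)
next
  case (insert j I)
  let ?q = "fps_of_poly (\<Prod>i\<in>I. [:1, - x i:])"
  let ?l = "fps_of_poly [:1, - x j:]"
  let ?G = "Abs_fps (\<lambda>k. x j ^ Suc k)"
  let ?S = "Abs_fps (\<lambda>k. \<Sum>i\<in>I. x i ^ Suc k)"
  have l: "?l = 1 - fps_const (x j) * fps_X"
    by (simp add: fps_of_poly_pCons fps_const_neg[symmetric] del: fps_const_neg)
  have G: "?l * ?G = fps_const (x j)"
  proof (rule fps_ext)
    fix n show "fps_nth (?l * ?G) n = fps_nth (fps_const (x j)) n"
      unfolding l by (cases n) (simp_all add: algebra_simps mult.assoc)
  qed
  have dl: "fps_deriv ?l = - fps_const (x j)"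
    unfolding l by simp
  have S: "Abs_fps (\<lambda>k. \<Sum>i\<in>insert j I. x i ^ Suc k) = ?G + ?S"
    using insert.hyps by (simp add: fps_eq_iff)
  have P: "fps_of_poly (\<Prod>i\<in>insert j I. [:1, - x i:]) = ?l * ?q"
    using insert.hyps by (simp add: fps_of_poly_mult del: mult_pCons_left mult_pCons_right)
  have "fps_deriv (?l * ?q) = - (?l * ?q * (?G + ?S))"
  proof -
    have "fps_deriv (?l * ?q) = ?l * (- (?q * ?S)) + (- fps_const (x j)) * ?q"
      using insert.IH dl by simp
    also have "\<dots> = - (?l * ?q * ?S) - (?l * ?G) * ?q"
      by (simp only: G) (simp add: algebra_simps)
    also have "\<dots> = - (?l * ?q * (?G + ?S))"
      by (simp add: algebra_simps)
    finally show ?thesis .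
  qed
  thus ?case by (simp only: P S)
qed

text \<open>Comparing coefficients in the logarithmic derivative gives Newton's identities; the
  coefficients of the product are the elementary symmetric functions up to sign.\<close>

lemma newton_identity:
  fixes x :: "'i \<Rightarrow> 'a::field"
  assumes "finite I"
  shows "of_nat (Suc n) * coeff (\<Prod>i\<in>I. [:1, - x i:]) (Suc n)
       = - (\<Sum>k\<le>n. coeff (\<Prod>i\<in>I. [:1, - x i:]) k * (\<Sum>i\<in>I. x i ^ Suc (n - k)))"
  using arg_cong[OF fps_deriv_linear_prod[OF assms, of x], of "\<lambda>f. fps_nth f n"]
  by (simp add: fps_mult_nth atLeast0AtMost)

text \<open>A predicate on sets, meant for the copy of the ground field inside its algebraic
  closure. Closure under \<open>inverse\<close> includes the element 0 since
  \<open>inverse 0 = 0\<close>.\<close>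

definition is_subfield :: "'a::field set \<Rightarrow> bool" where
  "is_subfield F \<longleftrightarrow> 0 \<in> F \<and> 1 \<in> F \<and> (\<forall>a\<in>F. \<forall>b\<in>F. a + b \<in> F \<and> a * b \<in> F) \<and>
     (\<forall>a\<in>F. - a \<in> F \<and> inverse a \<in> F)"

lemma is_subfieldD:
  assumes "is_subfield F"
  shows "0 \<in> F" "1 \<in> F" "a \<in> F \<Longrightarrow> b \<in> F \<Longrightarrow> a + b \<in> F" "a \<in> F \<Longrightarrow> b \<in> F \<Longrightarrow> a * b \<in> F"
    "a \<in> F \<Longrightarrow> - a \<in> F" "a \<in> F \<Longrightarrow> inverse a \<in> F"
  using assms unfolding is_subfield_def by auto

lemma is_subfield_diff: "is_subfield F \<Longrightarrow> a \<in> F \<Longrightarrow> b \<in> F \<Longrightarrow> a - b \<in> F"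
  using is_subfieldD(3,5)[of F] by (metis diff_conv_add_uminus)

lemma is_subfield_sum: "is_subfield F \<Longrightarrow> (\<And>i. i \<in> I \<Longrightarrow> g i \<in> F) \<Longrightarrow> sum g I \<in> F"
  by (induction I rule: infinite_finite_induct) (auto simp: is_subfieldD)

lemma is_subfield_of_nat: "is_subfield F \<Longrightarrow> of_nat n \<in> F"
  by (induction n) (auto simp: is_subfieldD)

text \<open>In Newton's identity the newest power sum is multiplied by the constant coefficient 1,
  so it can be solved for without division.\<close>

lemma power_sums_in_subfield:
  fixes x :: "'i \<Rightarrow> 'a::field"
  assumes F: "is_subfield F" and I: "finite I"
    and c: "\<And>n. coeff (\<Prod>i\<in>I. [:1, - x i:]) n \<in> F"
  shows "(\<Sum>i\<in>I. x i ^ n) \<in> F"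
proof -
  let ?q = "\<Prod>i\<in>I. [:1, - x i:]"
  have q0: "coeff ?q 0 = 1"
    by (simp add: coeff_0_prod_list poly_0_coeff_0[symmetric] poly_prod)
  have "(\<Sum>i\<in>I. x i ^ Suc n) \<in> F" for n
  proof (induction n rule: less_induct)
    case (less n)
    have "{..n} = insert 0 {1..n}" by auto
    hence "of_nat (Suc n) * coeff ?q (Suc n) = - ((\<Sum>i\<in>I. x i ^ Suc n)
        + (\<Sum>k\<in>{1..n}. coeff ?q k * (\<Sum>i\<in>I. x i ^ Suc (n - k))))"
      using newton_identity[OF I, of n x] q0 by simp
    hence "(\<Sum>i\<in>I. x i ^ Suc n) = - (of_nat (Suc n) * coeff ?q (Suc n))
        - (\<Sum>k\<in>{1..n}. coeff ?q k * (\<Sum>i\<in>I. x i ^ Suc (n - k)))"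
      by (simp only: minus_add_distrib minus_diff_eq) simp
    also have "\<dots> \<in> F"
      using c
      by (intro is_subfield_diff[OF F] is_subfieldD(5)[OF F] is_subfieldD(4)[OF F]
          is_subfield_sum[OF F, of "{1..n}"] is_subfield_of_nat[OF F] less) auto
    finally show ?case .
  qed
  thus ?thesis
    by (cases n) (auto intro: is_subfield_of_nat[OF F])
qed

text \<open>The same identities solved for the newest coefficient; this divides by
  \<open>Suc m\<close>, whence characteristic 0.\<close>

lemma coeffs_in_subfield:
  fixes x :: "'i \<Rightarrow> 'a::field_char_0"
  assumes F: "is_subfield F" and I: "finite I"
    and s: "\<And>n. (\<Sum>i\<in>I. x i ^ n) \<in> F"
  shows "coeff (\<Prod>i\<in>I. [:1, - x i:]) n \<in> F"
proof (induction n rule: less_induct)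
  case (less n)
  let ?q = "\<Prod>i\<in>I. [:1, - x i:]"
  show ?case
  proof (cases n)
    case 0
    have "coeff ?q 0 = 1"
      by (simp add: poly_0_coeff_0[symmetric] poly_prod)
    thus ?thesis using 0 is_subfieldD(2)[OF F] by simp
  next
    case (Suc m)
    have "coeff ?q n = inverse (of_nat (Suc m)) *
        - (\<Sum>k\<le>m. coeff ?q k * (\<Sum>i\<in>I. x i ^ Suc (m - k)))"
      unfolding newton_identity[OF I, of m x, symmetric] Suc by (simp del: of_nat_Suc)
    also have "\<dots> \<in> F"
      using less Suc
      by (intro is_subfieldD(4-6)[OF F] is_subfield_of_nat[OF F] is_subfield_sum[OF F] s) auto
    finally show ?thesis .
  qed
qed

lemma reflect_linear_prod:
  fixes x :: "'i \<Rightarrow> 'a::field"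
  shows "reflect_poly (\<Prod>i\<in>I. [:- x i, 1:]) = (\<Prod>i\<in>I. [:1, - x i:])"
  by (simp add: reflect_poly_prod) (simp add: reflect_poly_def)

lemma degree_linear_prod:
  fixes x :: "'i \<Rightarrow> 'a::field"
  assumes "finite I"
  shows "degree (\<Prod>i\<in>I. [:- x i, 1:]) = card I"
  by (subst degree_prod_eq_sum_degree) auto

text \<open>Stands in for the fundamental theorem on symmetric functions: whether a monic polynomial
  is rational over \<open>F\<close> is tested on the power sums of its roots. Reversal of the
  polynomial merely permutes coefficients.\<close>

lemma coeff_linear_prod_in_subfield_iff:
  fixes x :: "'i \<Rightarrow> 'a::field_char_0"
  assumes F: "is_subfield F" and I: "finite I"
  shows "(\<forall>n. coeff (\<Prod>i\<in>I. [:- x i, 1:]) n \<in> F) \<longleftrightarrow> (\<forall>n. (\<Sum>i\<in>I. x i ^ n) \<in> F)"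
proof -
  let ?p = "\<Prod>i\<in>I. [:- x i, 1:]" and ?q = "\<Prod>i\<in>I. [:1, - x i:]"
  have q: "coeff ?q n = (if n > card I then 0 else coeff ?p (card I - n))" for n
    unfolding reflect_linear_prod[symmetric] coeff_reflect_poly degree_linear_prod[OF I] by simp
  have p: "coeff ?p n = (if n > card I then 0 else coeff ?q (card I - n))" for n
    using q[of "card I - n"] degree_linear_prod[OF I, of x] coeff_eq_0[of ?p n] by auto
  have "(\<forall>n. coeff ?p n \<in> F) \<longleftrightarrow> (\<forall>n. coeff ?q n \<in> F)"
    using p q is_subfieldD(1)[OF F] by metis
  thus ?thesis
    using power_sums_in_subfield[OF F I] coeffs_in_subfield[OF F I] by blast
qed

lemma double_sum_symmetric:
  fixes g :: "nat \<Rightarrow> nat \<Rightarrow> 'a::comm_ring_1"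
  assumes "\<And>i j. g i j = g j i"
  shows "(\<Sum>j<n. \<Sum>i<n. g j i) = 2 * (\<Sum>(j,i)\<in>(SIGMA j:{..<n}. {..<j}). g j i) + (\<Sum>i<n. g i i)"
proof -
  have "(\<Sum>(j,i)\<in>(SIGMA j:{..<n}. {..<j}). g j i) = (\<Sum>j<n. \<Sum>i<j. g j i)"
    by (subst sum.Sigma) auto
  moreover have "(\<Sum>j<n. \<Sum>i<n. g j i) = 2 * (\<Sum>j<n. \<Sum>i<j. g j i) + (\<Sum>i<n. g i i)"
  proof (induction n)
    case (Suc n)
    have "(\<Sum>j<n. g j n) = (\<Sum>i<n. g n i)"
      by (intro sum.cong assms refl)
    thus ?case using Suc by (simp add: sum.distrib algebra_simps)
  qed simp
  ultimately show ?thesis by simp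
qed

text \<open>Summed over all pairs, the expression expands into products of power sums of
  \<open>x\<close>; by symmetry the pairs with \<open>i < j\<close> are half of what remains after
  removing the diagonal. The inductions carry the weights \<open>x j ^ a * x i ^ b\<close> so that
  expanding one factor stays within the claim.\<close>

lemma pair_power_sums_in_subfield:
  fixes x :: "nat \<Rightarrow> 'a::field_char_0"
  assumes F: "is_subfield F" and s: "\<And>k. (\<Sum>i<n. x i ^ k) \<in> F" and h: "h \<in> F"
  shows "(\<Sum>(j,i)\<in>(SIGMA j:{..<n}. {..<j}). (x j + x i + h * (x j * x i)) ^ k) \<in> F"
proof -
  have 1: "(\<Sum>j<n. \<Sum>i<n. x j ^ a * x i ^ b * (x j + x i + h * (x j * x i)) ^ k) \<in> F" for a b
  proof (induction k arbitrary: a b)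
    case 0
    have "(\<Sum>j<n. \<Sum>i<n. x j ^ a * x i ^ b) = (\<Sum>i<n. x i ^ a) * (\<Sum>i<n. x i ^ b)"
      by (simp add: sum_product)
    thus ?case using is_subfieldD(4)[OF F s s] by simp
  next
    case (Suc k)
    let ?f = "\<lambda>j i. (x j + x i + h * (x j * x i)) ^ k"
    have "(\<Sum>j<n. \<Sum>i<n. x j ^ a * x i ^ b * (x j + x i + h * (x j * x i)) ^ Suc k)
       = (\<Sum>j<n. \<Sum>i<n. x j ^ Suc a * x i ^ b * ?f j i) + (\<Sum>j<n. \<Sum>i<n. x j ^ a * x i ^ Suc b * ?f j i)
         + h * (\<Sum>j<n. \<Sum>i<n. x j ^ Suc a * x i ^ Suc b * ?f j i)"
      unfolding sum_distrib_left sum.distrib[symmetric]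
      by (intro sum.cong refl) (simp add: algebra_simps)
    also have "\<dots> \<in> F"
      by (intro is_subfieldD(3,4)[OF F] Suc h)
    finally show ?case .
  qed
  have 2: "(\<Sum>i<n. x i ^ a * (x i + x i + h * (x i * x i)) ^ k) \<in> F" for a
  proof (induction k arbitrary: a)
    case 0
    show ?case using s by simp
  next
    case (Suc k)
    let ?f = "\<lambda>i. (x i + x i + h * (x i * x i)) ^ k"
    have "(\<Sum>i<n. x i ^ a * (x i + x i + h * (x i * x i)) ^ Suc k)
       = (\<Sum>i<n. x i ^ Suc a * ?f i) + (\<Sum>i<n. x i ^ Suc a * ?f i)
         + h * (\<Sum>i<n. x i ^ Suc (Suc a) * ?f i)"
      unfolding sum_distrib_left sum.distrib[symmetric]
      by (intro sum.cong refl) (simp add: algebra_simps)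
    also have "\<dots> \<in> F"
      by (intro is_subfieldD(3,4)[OF F] Suc h)
    finally show ?case .
  qed
  let ?g = "\<lambda>j i. (x j + x i + h * (x j * x i)) ^ k"
  have "(\<Sum>(j,i)\<in>(SIGMA j:{..<n}. {..<j}). ?g j i)
      = inverse (of_nat 2) * ((\<Sum>j<n. \<Sum>i<n. ?g j i) - (\<Sum>i<n. ?g i i))"
    by (subst double_sum_symmetric) (auto simp: algebra_simps)
  also have "\<dots> \<in> F"
    using 1[of 0 0] 2[of 0]
    by (intro is_subfieldD(4,6)[OF F] is_subfield_diff[OF F] is_subfield_of_nat[OF F]) auto
  finally show ?thesis .
qed

section \<open>The quadratic extension K(i) inside the algebraic closure, and Laplace's
  argument\<close>

lemma map_poly_to_ac_add: "map_poly to_ac (p + q) = map_poly to_ac p + map_poly to_ac q"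
  by (intro poly_eqI) (simp add: coeff_map_poly)

lemma map_poly_to_ac_mult: "map_poly to_ac (p * q) = map_poly to_ac p * map_poly to_ac q"
proof (induction p)
  case (pCons a p)
  have "map_poly to_ac (smult a q) = smult (to_ac a) (map_poly to_ac q)"
    by (intro poly_eqI) (simp add: coeff_map_poly)
  thus ?case using pCons by (simp add: map_poly_pCons map_poly_to_ac_add)
qed simp

lemma poly_map_poly_to_ac: "poly (map_poly to_ac p) (to_ac x) = to_ac (poly p x)"
  by (induction p) (simp_all add: map_poly_pCons)

lemma is_subfield_range_to_ac: "is_subfield (range (to_ac :: 'a::field \<Rightarrow> _))"
  unfolding is_subfield_def
  by (auto simp flip: to_ac_add to_ac_mult to_ac_minus to_ac_inverse to_ac_0 to_ac_1)

definition imag :: "'a::field alg_closure" where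
  "imag = (SOME i. i * i = - 1)"

lemma imag_square: "imag * imag = (- 1 :: 'a::field alg_closure)"
proof -
  obtain i :: "'a alg_closure" where "i ^ 2 = - 1"
    using nth_root_exists[of 2 "- 1 :: 'a alg_closure"] zero_less_numeral by metis
  hence "i * i = - 1" by (simp only: power2_eq_square)
  thus ?thesis unfolding imag_def by (rule someI)
qed

definition cplx :: "'a::field \<Rightarrow> 'a \<Rightarrow> 'a alg_closure" where
  "cplx a b = to_ac a + imag * to_ac b"

lemma cplx_add: "cplx a b + cplx c d = cplx (a + c) (b + d)"
  by (simp add: cplx_def algebra_simps)

lemma cplx_mult: "cplx a b * cplx c d = cplx (a * c - b * d) (a * d + b * c)"
proof -
  have "cplx a b * cplx c d = to_ac a * to_ac c + (imag * imag) * (to_ac b * to_ac d)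
      + imag * (to_ac a * to_ac d + to_ac b * to_ac c)"
    by (simp only: cplx_def) (simp add: algebra_simps)
  thus ?thesis by (simp add: cplx_def imag_square)
qed

lemma cplx_uminus: "- cplx a b = cplx (- a) (- b)"
  by (simp add: cplx_def)

text \<open>Multiplication by the conjugate gives \<open>a * a + b * b = 0\<close>, which an
  ordering allows only for zeros.\<close>

lemma cplx_eq_0:
  fixes a b :: "'a::linordered_field"
  assumes "cplx a b = 0"
  shows "a = 0 \<and> b = 0"
proof -
  have "cplx a b * cplx a (- b) = 0" using assms by simp
  hence "to_ac (a * a + b * b) = 0" unfolding cplx_mult by (simp add: cplx_def)
  hence "a * a + b * b = 0" by (simp only: to_ac_eq_0_iff)
  thus ?thesis by simp
qed

abbreviation cplxs :: "'a::field alg_closure set" where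
  "cplxs \<equiv> {cplx a b |a b. True}"

lemma cplxs_add: "z \<in> cplxs \<Longrightarrow> w \<in> cplxs \<Longrightarrow> z + w \<in> cplxs"
  using cplx_add by blast

lemma cplxs_mult: "z \<in> cplxs \<Longrightarrow> w \<in> cplxs \<Longrightarrow> z * w \<in> cplxs"
  using cplx_mult by blast

lemma cplxs_uminus: "z \<in> cplxs \<Longrightarrow> - z \<in> cplxs"
  using cplx_uminus by blast

lemma cplxs_diff: "z \<in> cplxs \<Longrightarrow> w \<in> cplxs \<Longrightarrow> z - w \<in> cplxs"
  using cplxs_add[OF _ cplxs_uminus, of z w] by simp

lemma cplxs_to_ac: "to_ac a \<in> cplxs"
proof -
  have "to_ac a = cplx a 0" by (simp add: cplx_def)
  thus ?thesis by blast
qed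

text \<open>Half-angle formulas: if r is the modulus of a + ib, the real and imaginary parts of a
  square root have squares (r + a)/2 and (r - a)/2. This root has the same square as
  \<open>z\<close>, hence is \<open>z\<close> or \<open>- z\<close>.\<close>

lemma cplxs_sqrt:
  fixes z :: "'a::real_closed_field alg_closure"
  assumes "z * z \<in> cplxs"
  shows "z \<in> cplxs"
proof -
  obtain a b where ab: "z * z = cplx a b" using assms by blast
  obtain r0 where r0: "r0 * r0 = a * a + b * b"
    using nonneg_imp_square[of "a * a + b * b"] by auto
  define r where "r = \<bar>r0\<bar>"
  have r: "r * r = a * a + b * b" "r \<ge> 0" using r0 by (auto simp: r_def)
  have "\<bar>a\<bar> \<le> r"
    by (rule power2_le_imp_le) (use r in \<open>simp_all add: power2_eq_square\<close>)
  hence "0 \<le> (r + a) / 2" "0 \<le> (r - a) / 2" by auto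
  then obtain s t where s: "s * s = (r + a) / 2" and t: "t * t = (r - a) / 2"
    using nonneg_imp_square by metis
  have "(2 * (s * t)) * (2 * (s * t)) = 4 * ((s * s) * (t * t))" by (simp add: algebra_simps)
  also have "\<dots> = b * b" using r unfolding s t by (simp add: field_simps)
  \<comment> \<open>The squares determine the two parts only up to sign; replacing \<open>t\<close>
    by \<open>- t\<close> makes the imaginary part of the square equal to \<open>b\<close>.\<close>
  finally have "2 * (s * t) = b \<or> 2 * (s * t) = - b" by (simp only: square_eq_iff)
  then obtain t' where t': "t' * t' = (r - a) / 2" "2 * (s * t') = b"
    using t that[of t] that[of "- t"] by force
  have "s * s - t' * t' = a" unfolding s t'(1) by (simp add: field_simps)
  hence "cplx s t' * cplx s t' = z * z"
    unfolding cplx_mult ab using t'(2) by (simp add: algebra_simps)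
  hence "cplx s t' = z \<or> cplx s t' = - z" by (simp only: square_eq_iff)
  hence "z = cplx s t' \<or> z = - cplx s t'" by auto
  thus ?thesis using cplxs_uminus by blast
qed

text \<open>Laplace's argument: induction on the power of 2 in the degree.\<close>

lemma poly_has_cplx_root_aux:
  fixes p :: "'a::real_closed_field poly"
  assumes "degree p = 2 ^ k * m" "odd m"
  shows "\<exists>z\<in>cplxs. poly (map_poly to_ac p) z = 0"
  using assms
proof (induction k arbitrary: p m)
  case 0
  have "\<exists>x. (\<Sum>k\<le>degree p. coeff p k * x ^ k) = 0"
    using 0 by (intro odd_degree_imp_root) auto
  then obtain x where "poly p x = 0" by (auto simp: poly_altdef)
  thus ?case using poly_map_poly_to_ac[of p x] cplxs_to_ac by (metis to_ac_0)
next
  case (Suc k)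
  let ?F = "range (to_ac :: 'a \<Rightarrow> _)"
  note F = is_subfield_range_to_ac[where ?'a = 'a]
  define P where "P = map_poly to_ac p"
  define n where "n = degree p"
  have n: "n = 2 * (2 ^ k * m)" using Suc.prems by (simp add: n_def)
  have "m > 0" using Suc.prems(2) by (auto elim: oddE)
  hence n0: "n > 0" using n by simp
  have degP: "degree P = n"
    unfolding P_def n_def by (rule degree_map_poly) auto
  have P0: "P \<noteq> 0" using degP n0 by auto
  obtain A where A: "size A = n" "P = smult (lead_coeff P) (\<Prod>x\<in>#A. [:-x, 1:])"
    using alg_closed_imp_factorization[OF P0] degP by auto
  obtain xs where xs: "mset xs = A" using ex_mset by blast
  define x where "x = (\<lambda>i. xs ! i)"
  have lxs: "length xs = n" using A(1) xs by auto
  have "(\<Prod>x\<in>#A. [:-x, 1:]) = prod_list (map (\<lambda>x. [:-x, 1:]) xs)"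
    unfolding xs[symmetric] by (metis mset_map prod_mset_prod_list)
  also have "\<dots> = (\<Prod>i<n. [:- x i, 1:])"
    by (simp add: prod.list_conv_set_nth x_def lxs atLeast0LessThan)
  finally have P: "P = smult (lead_coeff P) (\<Prod>i<n. [:- x i, 1:])" using A(2) by metis
  have cP: "coeff P i \<in> ?F" for i by (simp add: P_def coeff_map_poly)
  have "coeff (\<Prod>i<n. [:- x i, 1:]) i \<in> ?F" for i
  proof -
    have "coeff (\<Prod>i<n. [:- x i, 1:]) i = inverse (lead_coeff P) * coeff P i"
      by (subst (2) P) (use P0 in simp)
    thus ?thesis using cP is_subfieldD(4,6)[OF F] by metis
  qed
  hence s: "(\<Sum>i<n. x i ^ l) \<in> ?F" for l
    using coeff_linear_prod_in_subfield_iff[OF F, of "{..<n}" x] by blast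
  let ?I = "SIGMA j:{..<n}. {..<j}"
  have finI: "finite ?I" by auto
  \<comment> \<open>The number of pairs is n(n - 1)/2. One factor 2 is lost and n - 1 is odd, so the
    induction on the exponent \<open>k\<close> applies to the polynomial indexed by pairs.\<close>
  have cardI: "card ?I = 2 ^ k * (m * (n - 1))"
  proof -
    have "card ?I = (\<Sum>j<n. j)" by simp
    moreover have "2 * (\<Sum>j<l. j) = l * (l - 1)" for l :: nat
      by (induction l) (auto simp: algebra_simps split: nat_diff_split)
    ultimately have "2 * card ?I = n * (n - 1)" by metis
    thus ?thesis unfolding n by simp
  qed
  have odd': "odd (m * (n - 1))" using Suc.prems(2) n n0 by simp
  \<comment> \<open>The polynomial with roots x_j + x_i + h x_j x_i has coefficients in the ground
    field, so one of these values lies in K(i). The pair may depend on \<open>h\<close>.\<close>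
  have *: "\<exists>ji\<in>?I. x (fst ji) + x (snd ji) + of_nat h * (x (fst ji) * x (snd ji)) \<in> cplxs" for h :: nat
  proof -
    define y where "y = (\<lambda>(j,i). x j + x i + of_nat h * (x j * x i))"
    have "(\<Sum>ji\<in>?I. y ji ^ l) \<in> ?F" for l
      using pair_power_sums_in_subfield[OF F s is_subfield_of_nat[OF F, of h], of l]
      by (simp add: y_def case_prod_unfold)
    hence c: "coeff (\<Prod>ji\<in>?I. [:- y ji, 1:]) l \<in> ?F" for l
      using coeff_linear_prod_in_subfield_iff[OF F finI, of y] by blast
    define q where "q = map_poly of_ac (\<Prod>ji\<in>?I. [:- y ji, 1:])"
    have q: "map_poly to_ac q = (\<Prod>ji\<in>?I. [:- y ji, 1:])"
      unfolding q_def using c by (intro poly_eqI) (simp add: coeff_map_poly to_ac_of_ac)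
    have "degree q = degree (map_poly to_ac q)"
      by (rule degree_map_poly[symmetric]) auto
    also have "\<dots> = 2 ^ k * (m * (n - 1))"
      unfolding q degree_linear_prod[OF finI] cardI ..
    finally obtain z where z: "z \<in> cplxs" "poly (map_poly to_ac q) z = 0"
      using Suc.IH odd' by blast
    have "\<exists>ji\<in>?I. z - y ji = 0"
      using z(2) finI by (simp add: q poly_prod prod_zero_iff)
    thus ?thesis using z(1) by (auto simp: y_def case_prod_unfold)
  qed
  then obtain c where c: "\<And>h. c h \<in> ?I"
      "\<And>h. x (fst (c h)) + x (snd (c h)) + of_nat h * (x (fst (c h)) * x (snd (c h))) \<in> cplxs"
    by metis
  \<comment> \<open>Infinitely many \<open>h\<close> share finitely many pairs. A pair that serves
    two values of \<open>h\<close> yields two independent linear equations for the sum and the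
    product of its roots.\<close>
  have "\<not> inj c"
    using finite_subset[of "range c" ?I] c(1) finI finite_imageD[of c UNIV] by auto
  then obtain h h' where hh: "h \<noteq> h'" "c h = c h'" by (auto simp: inj_on_def)
  obtain j i where ji: "c h = (j, i)" by (cases "c h")
  have jn: "j < n" using c(1)[of h] ji by auto
  have 1: "x j + x i + of_nat h * (x j * x i) \<in> cplxs" using c(2)[of h] ji by simp
  have 2: "x j + x i + of_nat h' * (x j * x i) \<in> cplxs" using c(2)[of h'] ji hh by simp
  have N: "of_nat l \<in> (cplxs :: 'a alg_closure set)" for l
    using cplxs_to_ac[of "of_nat l :: 'a"] by simp
  have "x j * x i \<in> cplxs"
  proof -
    have "(of_nat h - of_nat h' :: 'a) \<noteq> 0" using hh by simp
    hence "(of_nat h - of_nat h' :: 'a alg_closure) \<noteq> 0" using hh by simp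
    hence "x j * x i = to_ac (inverse (of_nat h - of_nat h')) *
      ((x j + x i + of_nat h * (x j * x i)) - (x j + x i + of_nat h' * (x j * x i)))"
      by (simp add: field_simps)
    thus ?thesis using cplxs_mult[OF cplxs_to_ac cplxs_diff[OF 1 2]] by metis
  qed
  moreover from this have "x j + x i \<in> cplxs"
    using cplxs_diff[OF 1 cplxs_mult[OF N[of h], of "x j * x i"]] by (simp only: add_diff_cancel_right')
  \<comment> \<open>The discriminant of the quadratic with roots x_j and x_i; its square root lies
    in K(i) and separates the two roots.\<close>
  ultimately have "(x j + x i) * (x j + x i) - of_nat 4 * (x j * x i) \<in> cplxs"
    using cplxs_diff[OF cplxs_mult cplxs_mult[OF N[of 4]]] by blast
  also have "(x j + x i) * (x j + x i) - of_nat 4 * (x j * x i) = (x j - x i) * (x j - x i)"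
    by (simp add: algebra_simps)
  finally have "x j - x i \<in> cplxs" by (rule cplxs_sqrt)
  hence "to_ac (inverse 2) * ((x j + x i) + (x j - x i)) \<in> cplxs"
    using cplxs_mult[OF cplxs_to_ac cplxs_add[OF \<open>x j + x i \<in> cplxs\<close>]] by blast
  hence "x j \<in> cplxs" by simp
  moreover have "poly P (x j) = 0"
    by (subst P) (use jn in \<open>auto simp: poly_prod prod_zero_iff\<close>)
  ultimately show ?case unfolding P_def by blast
qed

lemma poly_has_cplx_root:
  fixes p :: "'a::real_closed_field poly"
  assumes "degree p > 0"
  shows "\<exists>u v. poly (map_poly to_ac p) (cplx u v) = 0"
proof -
  obtain k m where "degree p = 2 ^ k * m" "odd m"
    using multiplicity_decompose'[of "degree p" 2] assms
    by (metis nat_dvd_1_iff_1 not_gr_zero numeral_One numeral_eq_iff semiring_norm(85))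
  thus ?thesis using poly_has_cplx_root_aux by blast
qed

text \<open>The quadratic has roots u + iv and u - iv. The remainder of \<open>p\<close> by it is
  linear with coefficients in the field and vanishes at the nonreal point u + iv, so it is
  0.\<close>

lemma poly_has_real_root_or_quadratic_factor:
  fixes p :: "'a::real_closed_field poly"
  assumes "degree p > 0"
  shows "(\<exists>u. poly p u = 0) \<or> (\<exists>u v. v \<noteq> 0 \<and> [:u * u + v * v, - 2 * u, 1:] dvd p)"
proof -
  obtain u v where uv: "poly (map_poly to_ac p) (cplx u v) = 0"
    using poly_has_cplx_root[OF assms] by blast
  show ?thesis
  proof (cases "v = 0")
    case True
    hence "to_ac (poly p u) = 0"
      using uv by (simp add: cplx_def poly_map_poly_to_ac)
    thus ?thesis by auto
  next
    case False
    let ?q = "[:u * u + v * v, - 2 * u, 1:]"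
    have "degree (p mod ?q) < 2"
      using degree_mod_less[of ?q p] by (cases "p mod ?q = 0") auto
    then obtain a b where r: "p mod ?q = [:a, b:]"
      by (metis degree1_coeffs less_2_cases One_nat_def degree_eq_zeroE pCons_0_0 pCons_eq_iff)
    have q: "poly (map_poly to_ac ?q) (cplx u v) = 0"
    proof -
      have "poly (map_poly to_ac ?q) (cplx u v)
          = cplx (u * u + v * v) 0 + cplx u v * (cplx (- 2 * u) 0 + cplx u v)"
        by (simp add: map_poly_pCons cplx_def)
      also have "\<dots> = cplx 0 0"
        unfolding cplx_add cplx_mult by (simp add: algebra_simps)
      finally show ?thesis by (simp add: cplx_def)
    qed
    have "p = ?q * (p div ?q) + [:a, b:]"
      using r by (metis mult_div_mod_eq)
    hence "map_poly to_ac p = map_poly to_ac ?q * map_poly to_ac (p div ?q) + map_poly to_ac [:a, b:]"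
      by (metis map_poly_to_ac_add map_poly_to_ac_mult)
    hence "poly (map_poly to_ac [:a, b:]) (cplx u v) = 0"
      using uv q by simp
    moreover have "poly (map_poly to_ac [:a, b:]) (cplx u v) = cplx a 0 + cplx u v * cplx b 0"
      by (simp add: map_poly_pCons cplx_def)
    ultimately have "cplx (a + u * b) (v * b) = 0" by (simp add: cplx_add cplx_mult)
    hence "a = 0" "b = 0" using cplx_eq_0 False by fastforce+
    hence "?q dvd p" using r by (simp add: dvd_eq_mod_eq_0)
    thus ?thesis using False by blast
  qed
qed

section \<open>Intermediate value, Rolle and mean value theorems for polynomials\<close>

text \<open>Induction on the degree: a factor with equal nonzero signs at \<open>a\<close> and
  \<open>b\<close> can be split off, leaving the sign change to the quotient. Such a factor is a
  quadratic without real root or a linear one whose root is outside the interval.\<close>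

lemma poly_IVT_rcf:
  fixes p :: "'a::real_closed_field poly"
  assumes "a < b" "poly p a * poly p b < 0"
  shows "\<exists>x. a < x \<and> x < b \<and> poly p x = 0"
  using assms
proof (induction "degree p" arbitrary: p rule: less_induct)
  case less
  have deg: "degree p > 0"
  proof (rule ccontr)
    assume "\<not> degree p > 0"
    then obtain c where "p = [:c:]" by (auto elim: degree_eq_zeroE)
    thus False using less.prems(2) by (simp add: mult_less_0_iff)
  qed
  have step: "\<exists>x. a < x \<and> x < b \<and> poly p x = 0"
    if "p = g * q" "degree g > 0" "poly g a * poly g b > 0" for g q
  proof -
    have "q \<noteq> 0" using that(1) deg by auto
    hence "degree q < degree p"
      using that degree_mult_eq[of g q] by fastforce
    moreover have "(poly g a * poly g b) * (poly q a * poly q b) < 0"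
      using less.prems(2) that(1) by (simp add: algebra_simps)
    hence "poly q a * poly q b < 0"
      using that(3) by (metis mult_less_0_iff order_less_asym)
    ultimately show ?thesis using less.hyps[of q] less.prems(1) that(1) by auto
  qed
  from poly_has_real_root_or_quadratic_factor[OF deg] show ?case
  proof (elim disjE exE conjE)
    fix u assume u: "poly p u = 0"
    show ?thesis
    proof (cases "a < u \<and> u < b")
      case True
      thus ?thesis using u by blast
    next
      case False
      have "u \<noteq> a" "u \<noteq> b" using u less.prems(2) by auto
      hence "(a - u) * (b - u) > 0"
        using False less.prems(1) by (auto simp: zero_less_mult_iff)
      moreover obtain q where "p = [:- u, 1:] * q"
        using u by (auto simp: poly_eq_0_iff_dvd)
      ultimately show ?thesis by (intro step[of "[:- u, 1:]" q]) auto
    qed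
  next
    fix u v :: 'a assume v: "v \<noteq> 0" and d: "[:u * u + v * v, - 2 * u, 1:] dvd p"
    then obtain q where q: "p = [:u * u + v * v, - 2 * u, 1:] * q" by blast
    have "poly [:u * u + v * v, - 2 * u, 1:] x > 0" for x
    proof -
      have "poly [:u * u + v * v, - 2 * u, 1:] x = (x - u) * (x - u) + v * v"
        by (simp add: algebra_simps)
      moreover have "v * v > 0" using v by (auto simp: zero_less_mult_iff)
      ultimately show ?thesis using zero_le_square[of "x - u"] by linarith
    qed
    thus ?thesis by (intro step[OF q]) auto
  qed
qed

lemma poly_no_root_imp_sgn_eq:
  fixes p :: "'a::real_closed_field poly"
  assumes "a \<le> b" "\<And>x. a \<le> x \<Longrightarrow> x \<le> b \<Longrightarrow> poly p x \<noteq> 0"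
  shows "sgn (poly p a) = sgn (poly p b)"
proof (rule ccontr)
  assume neq: "sgn (poly p a) \<noteq> sgn (poly p b)"
  have "poly p a \<noteq> 0" "poly p b \<noteq> 0" using assms by auto
  with neq have "poly p a * poly p b < 0"
    by (auto simp: sgn_if mult_less_0_iff split: if_splits)
  moreover have "a < b" using neq assms(1) by (cases "a = b") auto
  ultimately show False using poly_IVT_rcf[of a b p] assms(2) by force
qed

text \<open>Write p = (X - a)^(m+1) (X - b)^(k+1) q. Then p' = (X - a)^m (X - b)^k r, where r(a)
  r(b) is a negative multiple of q(a) q(b). As q has no root on the closed interval, r changes
  sign.\<close>

lemma poly_Rolle_no_inner_root:
  fixes p :: "'a::real_closed_field poly"
  assumes "p \<noteq> 0" "a < b" "poly p a = 0" "poly p b = 0"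
    and nr: "\<And>x. a < x \<Longrightarrow> x < b \<Longrightarrow> poly p x \<noteq> 0"
  shows "\<exists>x. a < x \<and> x < b \<and> poly (pderiv p) x = 0"
proof -
  obtain q1 where q1: "p = [:- a, 1:] ^ order a p * q1" "\<not> [:- a, 1:] dvd q1"
    using order_decomp[OF assms(1)] by blast
  have "q1 \<noteq> 0" using q1(2) by auto
  then obtain q where q: "q1 = [:- b, 1:] ^ order b q1 * q" "\<not> [:- b, 1:] dvd q"
    using order_decomp by blast
  have q1b: "poly q1 b = 0" 
    using arg_cong[OF q1(1), of "\<lambda>p. poly p b"] assms(2,4) by (simp add: poly_power)
  obtain m where m: "order a p = Suc m"
    using assms(1,3) order_root[of p a] by (cases "order a p") auto
  obtain k where k: "order b q1 = Suc k"
    using \<open>q1 \<noteq> 0\<close> q1b order_root[of q1 b] by (cases "order b q1") auto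
  define r where "r = smult (of_nat (Suc m)) ([:- b, 1:] * q) + smult (of_nat (Suc k)) ([:- a, 1:] * q)
      + [:- a, 1:] * [:- b, 1:] * pderiv q"
  have pq: "p = [:- a, 1:] ^ Suc m * ([:- b, 1:] ^ Suc k * q)"
    using q1(1) q(1) m k by metis
  have d: "pderiv p = [:- a, 1:] ^ m * [:- b, 1:] ^ k * r"
  proof -
    have d1: "pderiv [:- a, 1:] = 1" "pderiv [:- b, 1:] = 1" by (auto simp: pderiv_pCons)
    have "pderiv p = ([:- a, 1:] * [:- a, 1:] ^ m) * (([:- b, 1:] * [:- b, 1:] ^ k) * pderiv q
        + smult (of_nat (Suc k)) ([:- b, 1:] ^ k) * q)
        + smult (of_nat (Suc m)) ([:- a, 1:] ^ m) * (([:- b, 1:] * [:- b, 1:] ^ k) * q)"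
      unfolding pq pderiv_mult pderiv_power_Suc d1 by (simp add: algebra_simps)
    thus ?thesis unfolding r_def
      by (simp only: mult_smult_left mult_smult_right distrib_left distrib_right mult.assoc mult.commute mult.left_commute add_ac)
  qed
  have qa: "poly q a \<noteq> 0" using q1(2) q(1) dvd_mult poly_eq_0_iff_dvd by metis
  have qb: "poly q b \<noteq> 0" using q(2) by (metis poly_eq_0_iff_dvd)
  have "poly q x \<noteq> 0" if "a \<le> x" "x \<le> b" for x
    using that qa qb nr[of x] pq by (cases "x = a \<or> x = b") auto
  hence "sgn (poly q a) = sgn (poly q b)"
    using assms(2) by (intro poly_no_root_imp_sgn_eq) auto
  hence qq: "poly q a * poly q b > 0"
    using qa qb by (auto simp: sgn_if zero_less_mult_iff split: if_splits)
  have "poly r a * poly r b = - (of_nat (Suc m) * of_nat (Suc k) * (b - a) * (b - a) * (poly q a * poly q b))"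
    unfolding r_def by (simp add: algebra_simps)
  also have "\<dots> < 0"
    using qq assms(2) by (simp del: of_nat_Suc add: zero_less_mult_iff)
  finally obtain x where "a < x" "x < b" "poly r x = 0"
    using poly_IVT_rcf assms(2) by blast
  thus ?thesis using d by auto
qed

lemma poly_Rolle:
  fixes p :: "'a::real_closed_field poly"
  assumes "p \<noteq> 0" "a < b" "poly p a = 0" "poly p b = 0"
  shows "\<exists>x. a < x \<and> x < b \<and> poly (pderiv p) x = 0"
proof -
  \<comment> \<open>The last root before \<open>b\<close> bounds, together with \<open>b\<close>, an
    interval without inner root.\<close>
  define Z where "Z = {x. poly p x = 0 \<and> a \<le> x \<and> x < b}"
  have "finite Z"
    using poly_roots_finite[OF assms(1)] by (rule rev_finite_subset) (auto simp: Z_def)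
  moreover have "a \<in> Z" using assms by (auto simp: Z_def)
  ultimately have c: "Max Z \<in> Z" "\<And>x. x \<in> Z \<Longrightarrow> x \<le> Max Z" using Max_in by auto
  have "\<exists>x. Max Z < x \<and> x < b \<and> poly (pderiv p) x = 0"
    using c assms by (intro poly_Rolle_no_inner_root) (force simp: Z_def)+
  thus ?thesis using c(2)[OF \<open>a \<in> Z\<close>] by force
qed

lemma poly_MVT_rcf:
  fixes p :: "'a::real_closed_field poly"
  assumes "a < b"
  shows "\<exists>x. a < x \<and> x < b \<and> poly p b - poly p a = (b - a) * poly (pderiv p) x"
proof -
  define c where "c = (poly p b - poly p a) / (b - a)"
  define g where "g = p - [:poly p a - c * a, c:]"
  have cb: "c * (b - a) = poly p b - poly p a" using assms by (simp add: c_def)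
  hence g: "poly g a = 0" "poly g b = 0" by (auto simp: g_def algebra_simps)
  have dg: "pderiv g = pderiv p - [:c:]"
    by (simp add: g_def pderiv_diff pderiv_pCons)
  have "\<exists>x. a < x \<and> x < b \<and> poly (pderiv g) x = 0"
  proof (cases "g = 0")
    case True
    thus ?thesis using dense[OF assms] by auto
  next
    case False
    show ?thesis using poly_Rolle[OF False assms g] .
  qed
  thus ?thesis using cb dg by (auto simp: mult.commute)
qed

lemma poly_diff_sgn_rcf:
  fixes p :: "'a::real_closed_field poly"
  assumes "a < b" "\<And>x. a < x \<Longrightarrow> x < b \<Longrightarrow> sgn (poly (pderiv p) x) = s"
  shows "sgn (poly p b - poly p a) = s"
proof -
  obtain x where "a < x" "x < b" "poly p b - poly p a = (b - a) * poly (pderiv p) x"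
    using poly_MVT_rcf[OF assms(1)] by blast
  thus ?thesis using assms by (simp add: sgn_mult)
qed

section \<open>Signs of a polynomial near plus and minus infinity\<close>

text \<open>The lower bound \<open>d\<close> strengthens the induction: mere positivity of
  \<open>q\<close> would not let \<open>x * poly q x\<close> outgrow the constant
  coefficient.\<close>

lemma poly_eventually_pos:
  fixes p :: "'a::linordered_field poly"
  assumes "lead_coeff p > 0"
  shows "\<exists>M d. d > 0 \<and> (\<forall>x\<ge>M. poly p x \<ge> d)"
  using assms
proof (induction p)
  case (pCons c q)
  show ?case
  proof (cases "q = 0")
    case True
    thus ?thesis using pCons.prems by (intro exI[of _ 0] exI[of _ c]) auto
  next
    case False
    then obtain M d where d: "d > 0" "\<forall>x\<ge>M. poly q x \<ge> d" using pCons by auto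
    define M' where "M' = max M ((\<bar>c\<bar> + 1) / d)"
    have "poly (pCons c q) x \<ge> 1" if "x \<ge> M'" for x
    proof -
      have "x \<ge> (\<bar>c\<bar> + 1) / d" "x \<ge> M" using that by (auto simp: M'_def)
      hence "\<bar>c\<bar> + 1 \<le> x * d" using d(1) by (simp add: pos_divide_le_eq)
      moreover have "x \<ge> 0"
        using \<open>x \<ge> (\<bar>c\<bar> + 1) / d\<close> d(1) by (meson abs_ge_zero add_nonneg_nonneg divide_nonneg_pos order_trans zero_le_one)
      hence "x * d \<le> x * poly q x" using d(2) \<open>x \<ge> M\<close> by (intro mult_left_mono) auto
      ultimately show ?thesis by (simp add: abs_if split: if_splits)
    qed
    thus ?thesis by (intro exI[of _ M'] exI[of _ 1]) auto
  qed
qed simp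

lemma poly_sgn_at_top:
  fixes p :: "'a::linordered_field poly"
  shows "\<exists>M. \<forall>x\<ge>M. sgn (poly p x) = sgn (lead_coeff p)"
proof -
  consider "p = 0" | "lead_coeff p > 0" | "lead_coeff (- p) > 0"
    by (metis leading_coeff_0_iff lead_coeff_minus neg_0_less_iff_less linorder_neqE)
  thus ?thesis
  proof cases
    case 2
    then obtain M d where "d > 0" "\<forall>x\<ge>M. poly p x \<ge> d" using poly_eventually_pos by blast
    thus ?thesis using 2 by (intro exI[of _ M]) force
  next
    case 3
    then obtain M d where "d > 0" "\<forall>x\<ge>M. poly (- p) x \<ge> d" using poly_eventually_pos by blast
    thus ?thesis using 3 by (intro exI[of _ M]) force
  qed auto
qed

lemma poly_sgn_at_bot:
  fixes p :: "'a::linordered_field poly"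
  shows "\<exists>M. \<forall>x\<le>M. sgn (poly p x) = sgn ((- 1) ^ degree p * lead_coeff p)"
proof -
  let ?p = "pcompose p [:0, - 1:]"
  obtain M where M: "\<forall>x\<ge>M. sgn (poly ?p x) = sgn (lead_coeff ?p)"
    using poly_sgn_at_top by blast
  have lc: "lead_coeff ?p = (- 1) ^ degree p * lead_coeff p"
    by (subst lead_coeff_comp) auto
  have "sgn (poly p x) = sgn ((- 1) ^ degree p * lead_coeff p)" if "x \<le> - M" for x
    using M[rule_format, of "- x"] that unfolding lc by (simp add: poly_pcompose)
  thus ?thesis by blast
qed

section \<open>Sign patterns of finitely many polynomials\<close>

text \<open>An automorphism of the line as an ordered set only. Such a map can carry the roots of
  one polynomial to those of another and leave the order of all points intact.\<close>

definition order_iso :: "('a::linorder \<Rightarrow> 'a) \<Rightarrow> bool" where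
  "order_iso h \<longleftrightarrow> strict_mono h \<and> surj h"

lemma order_iso_less_iff: "order_iso h \<Longrightarrow> h x < h y \<longleftrightarrow> x < y"
  unfolding order_iso_def by (simp add: strict_mono_less)

lemma order_iso_le_iff: "order_iso h \<Longrightarrow> h x \<le> h y \<longleftrightarrow> x \<le> y"
  unfolding order_iso_def by (simp add: strict_mono_less_eq)

lemma order_iso_compose: "order_iso g \<Longrightarrow> order_iso h \<Longrightarrow> order_iso (\<lambda>x. g (h x))"
  unfolding order_iso_def strict_mono_def surj_def by metis

lemma order_iso_obtain:
  assumes "order_iso h"
  obtains x where "y = h x"
  using assms unfolding order_iso_def surj_def by auto

lemma order_iso_min:
  assumes f: "order_iso f" and g: "order_iso g"
  shows "order_iso (\<lambda>x. min (f x) (g x))"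
  unfolding order_iso_def
proof
  show "strict_mono (\<lambda>x. min (f x) (g x))"
    using assms by (auto simp: order_iso_def strict_mono_def min_less_iff_disj)
  show "surj (\<lambda>x. min (f x) (g x))"
    unfolding surj_def
  proof
    fix y
    obtain a where a: "y = f a" by (rule order_iso_obtain[OF f])
    obtain b where b: "y = g b" by (rule order_iso_obtain[OF g])
    have "y = min (f (max a b)) (g (max a b))"
    proof (cases "a \<le> b")
      case True
      thus ?thesis using a b order_iso_le_iff[OF f, of a b] by (simp add: max_def min_def)
    next
      case False
      thus ?thesis using a b order_iso_le_iff[OF g, of b a] by (auto simp: max_def min_def)
    qed
    thus "\<exists>x. y = min (f x) (g x)" by blast
  qed
qed

lemma order_iso_max:
  assumes f: "order_iso f" and g: "order_iso g"
  shows "order_iso (\<lambda>x. max (f x) (g x))"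
  unfolding order_iso_def
proof
  show "strict_mono (\<lambda>x. max (f x) (g x))"
    using assms by (auto simp: order_iso_def strict_mono_def less_max_iff_disj)
      (metis less_trans not_less_iff_gr_or_eq)
  show "surj (\<lambda>x. max (f x) (g x))"
    unfolding surj_def
  proof
    fix y
    obtain a where a: "y = f a" by (rule order_iso_obtain[OF f])
    obtain b where b: "y = g b" by (rule order_iso_obtain[OF g])
    have "y = max (f (min a b)) (g (min a b))"
    proof (cases "a \<le> b")
      case True
      thus ?thesis using a b order_iso_le_iff[OF g, of a b] by (simp add: max_def min_def)
    next
      case False
      thus ?thesis using a b order_iso_le_iff[OF f, of b a] by (auto simp: max_def min_def)
    qed
    thus "\<exists>x. y = max (f x) (g x)" by blast
  qed
qed

lemma order_iso_id: "order_iso (\<lambda>x. x)"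
  unfolding order_iso_def by (auto intro: strict_monoI)

lemma order_iso_affine:
  fixes c :: "'a::linordered_field"
  assumes "c > 0"
  shows "order_iso (\<lambda>x. u + (x - u) * c)"
  unfolding order_iso_def
proof
  show "strict_mono (\<lambda>x. u + (x - u) * c)"
    using assms by (auto intro!: strict_monoI)
  show "surj (\<lambda>x. u + (x - u) * c)"
    unfolding surj_def
  proof
    fix y
    show "\<exists>x. y = u + (x - u) * c"
      using assms by (intro exI[of _ "u + (y - u) / c"]) simp
  qed
qed

text \<open>Piecewise linear: one line through (u, u) and (v, w), one through (v, w) and (t, t). For
  \<open>w \<le> v\<close> their maximum is convex and lies below the diagonal exactly between u and
  t, so the minimum with the identity is the desired map; for \<open>w > v\<close> minimum and
  maximum swap.\<close>

lemma order_iso_bump: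
  fixes u v w t :: "'a::linordered_field"
  assumes "u < v" "v < t" "u < w" "w < t"
  shows "\<exists>k. order_iso k \<and> k v = w \<and> (\<forall>x. x \<le> u \<or> t \<le> x \<longrightarrow> k x = x)"
proof -
  define \<alpha> where "\<alpha> = (w - u) / (v - u)"
  define \<beta> where "\<beta> = (t - w) / (t - v)"
  have pos: "\<alpha> > 0" "\<beta> > 0" using assms by (auto simp: \<alpha>_def \<beta>_def)
  have v: "u + (v - u) * \<alpha> = w" "t + (v - t) * \<beta> = w"
    using assms by (auto simp: \<alpha>_def \<beta>_def field_simps)
  note iso = order_iso_affine[OF pos(1), of u] order_iso_affine[OF pos(2), of t] order_iso_id
  have mul: "(a::'a) * c \<le> a" if "a \<ge> 0" "c \<le> 1" for a c
    using mult_left_mono[of c 1 a] that by simp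
  have mul': "(a::'a) * c \<ge> a" if "a \<ge> 0" "c \<ge> 1" for a c
    using mult_left_mono[of 1 c a] that by simp
  show ?thesis
  proof (cases "w \<le> v")
    case True
    let ?k = "\<lambda>x. min x (max (u + (x - u) * \<alpha>) (t + (x - t) * \<beta>))"
    have ab: "\<alpha> \<le> 1" "\<beta> \<ge> 1" using assms True by (auto simp: \<alpha>_def \<beta>_def)
    have "?k x = x" if "x \<le> u" for x
      using mul[of "u - x" \<alpha>] that ab by (simp add: min_def max_def algebra_simps)
    moreover have "?k x = x" if "t \<le> x" for x
      using mul'[of "x - t" \<beta>] that ab by (simp add: min_def max_def algebra_simps)
    moreover have "?k v = w" using v True by simp
    ultimately show ?thesis
      by (intro exI[of _ ?k]) (use order_iso_min[OF iso(3) order_iso_max[OF iso(1,2)]] in auto)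
  next
    case False
    let ?k = "\<lambda>x. max x (min (u + (x - u) * \<alpha>) (t + (x - t) * \<beta>))"
    have ab: "\<alpha> \<ge> 1" "\<beta> \<le> 1" using assms False by (auto simp: \<alpha>_def \<beta>_def)
    have "?k x = x" if "x \<le> u" for x
      using mul'[of "u - x" \<alpha>] that ab by (simp add: min_def max_def algebra_simps)
    moreover have "?k x = x" if "t \<le> x" for x
      using mul[of "x - t" \<beta>] that ab by (simp add: min_def max_def algebra_simps)
    moreover have "?k v = w" using v False by simp
    ultimately show ?thesis
      by (intro exI[of _ ?k]) (use order_iso_max[OF iso(3) order_iso_min[OF iso(1,2)]] in auto)
  qed
qed

text \<open>\<open>R\<close> is the graph of an isomorphism between two ordered subfields.\<close>

locale ordered_field_rel =
  fixes R :: "'a::real_closed_field \<Rightarrow> 'a \<Rightarrow> bool"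
  assumes R_0: "R 0 0" and R_1: "R 1 1"
    and R_add: "R a a' \<Longrightarrow> R b b' \<Longrightarrow> R (a + b) (a' + b')"
    and R_mult: "R a a' \<Longrightarrow> R b b' \<Longrightarrow> R (a * b) (a' * b')"
    and R_minus: "R a a' \<Longrightarrow> R (- a) (- a')"
    and R_inverse: "R a a' \<Longrightarrow> R (inverse a) (inverse a')"
    and R_sgn: "R a a' \<Longrightarrow> sgn a = sgn a'"
begin

lemma R_eq_0_iff: "R a a' \<Longrightarrow> a = 0 \<longleftrightarrow> a' = 0"
  using R_sgn by (metis sgn_0 sgn_eq_0_iff)

lemma R_of_nat: "R (of_nat n) (of_nat n)"
  by (induction n) (auto intro: R_0 R_1 R_add)

lemma R_diff: "R a a' \<Longrightarrow> R b b' \<Longrightarrow> R (a - b) (a' - b')"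
  using R_add[OF _ R_minus] by (metis diff_conv_add_uminus)

lemma R_sum: "(\<And>i. i \<in> I \<Longrightarrow> R (f i) (g i)) \<Longrightarrow> R (sum f I) (sum g I)"
  by (induction I rule: infinite_finite_induct) (auto intro: R_0 R_add)

definition prel :: "'a poly \<Rightarrow> 'a poly \<Rightarrow> bool" where
  "prel p q \<longleftrightarrow> (\<forall>k. R (coeff p k) (coeff q k))"

lemma prel_add: "prel p p' \<Longrightarrow> prel q q' \<Longrightarrow> prel (p + q) (p' + q')"
  by (simp add: prel_def R_add)

lemma prel_diff: "prel p p' \<Longrightarrow> prel q q' \<Longrightarrow> prel (p - q) (p' - q')"
  by (simp add: prel_def R_diff)

lemma prel_minus: "prel p p' \<Longrightarrow> prel (- p) (- p')"
  by (simp add: prel_def R_minus)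

lemma prel_mult: "prel p p' \<Longrightarrow> prel q q' \<Longrightarrow> prel (p * q) (p' * q')"
  by (simp add: prel_def coeff_mult R_mult R_sum)

lemma prel_monom: "R a a' \<Longrightarrow> prel (monom a n) (monom a' n)"
  by (simp add: prel_def R_0)

lemma prel_pCons: "R a a' \<Longrightarrow> prel p p' \<Longrightarrow> prel (pCons a p) (pCons a' p')"
  by (simp add: prel_def coeff_pCons split: nat.split)

lemma prel_0: "prel 0 0"
  by (simp add: prel_def R_0)

lemma prel_pderiv: "prel p p' \<Longrightarrow> prel (pderiv p) (pderiv p')"
  unfolding prel_def coeff_pderiv by (intro allI R_mult R_of_nat) auto

lemma prel_degree: "prel p p' \<Longrightarrow> degree p = degree p'"
  unfolding prel_def degree_def using R_eq_0_iff by metis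

lemma prel_lead_coeff: "prel p p' \<Longrightarrow> R (lead_coeff p) (lead_coeff p')"
  using prel_degree[of p p'] unfolding prel_def by metis

text \<open>One run of long division serves both sides, since \<open>R\<close> respects inverses and
  related polynomials have equal degrees. Positive degree of \<open>q\<close> gives strict descent
  even when the difference becomes 0, whose degree is 0.\<close>

lemma prel_divmod:
  assumes "prel q q'" "q \<noteq> 0" "degree q > 0" "prel p p'"
  shows "\<exists>d d' r r'. p = q * d + r \<and> p' = q' * d' + r' \<and> prel r r' \<and> degree r < degree q"
  using assms(4)
proof (induction "degree p" arbitrary: p p' rule: less_induct)
  case less
  show ?case
  proof (cases "degree p < degree q")
    case True
    show ?thesis
      by (rule exI[of _ 0], rule exI[of _ 0], rule exI[of _ p], rule exI[of _ p']) (use True less.prems in auto)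
  next
    case False
    define c where "c = lead_coeff p * inverse (lead_coeff q)"
    define c' where "c' = lead_coeff p' * inverse (lead_coeff q')"
    define m where "m = monom c (degree p - degree q)"
    define m' where "m' = monom c' (degree p - degree q)"
    have mm: "prel m m'"
      unfolding m_def m'_def c_def c'_def
      by (intro prel_monom R_mult R_inverse prel_lead_coeff less.prems assms)
    have p0: "p \<noteq> 0" using False assms(3) by auto
    have c0: "c \<noteq> 0" using p0 assms(2) by (simp add: c_def)
    hence m0: "m \<noteq> 0" by (simp add: m_def monom_eq_0_iff)
    have deg: "degree (q * m) = degree p"
      using False assms(2) m0 c0 by (simp add: degree_mult_eq m_def degree_monom_eq)
    have lc: "lead_coeff (q * m) = lead_coeff p"
      using assms(2) by (simp add: lead_coeff_mult m_def c_def degree_monom_eq[OF c0[unfolded c_def]])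
    have "degree (p - q * m) < degree p"
    proof (cases "p - q * m = 0")
      case True
      thus ?thesis using False assms(3) by simp
    next
      case nz: False
      have "degree (p - q * m) \<le> degree p" using degree_diff_le[of p "degree p" "q * m"] deg by simp
      moreover have "coeff (p - q * m) (degree p) = 0" using lc deg by simp
      ultimately show ?thesis using nz by (metis leading_coeff_0_iff order_le_less)
    qed
    moreover have "prel (p - q * m) (p' - q' * m')"
      by (intro prel_diff prel_mult less.prems assms mm)
    ultimately obtain d d' r r' where *: "p - q * m = q * d + r" "p' - q' * m' = q' * d' + r'"
        "prel r r'" "degree r < degree q"
      using less.hyps by blast
    have "p = q * (m + d) + r" "p' = q' * (m' + d') + r'"
      using *(1,2) by (simp_all add: algebra_simps)
    thus ?thesis using *(3,4) by blast
  qed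
qed

section \<open>Transport of sign charts by order automorphisms\<close>

text \<open>Equality of two sign tables, stored as an order automorphism rather than as lists of
  roots and intervals.\<close>

definition matches :: "('a \<Rightarrow> 'a) \<Rightarrow> ('a poly \<times> 'a poly) set \<Rightarrow> bool" where
  "matches h V \<longleftrightarrow> order_iso h \<and> (\<forall>(q, q')\<in>V. \<forall>x. sgn (poly q x) = sgn (poly q' (h x)))"

lemma matchesD:
  assumes "matches h V" "(q, q') \<in> V"
  shows "sgn (poly q x) = sgn (poly q' (h x))"
  using assms unfolding matches_def by auto

context
  fixes V :: "('a poly \<times> 'a poly) set" and p p' :: "'a poly"
  assumes V: "finite V"
    and pp: "prel p p'" and dp: "(pderiv p, pderiv p') \<in> V" "pderiv p \<noteq> 0"
begin

private definition Z :: "'a set" where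
  "Z = {x. \<exists>q q'. (q, q') \<in> V \<and> q \<noteq> 0 \<and> poly q x = 0}"

private lemma finite_Z: "finite Z"
proof -
  have "Z \<subseteq> (\<Union>qq\<in>{qq\<in>V. fst qq \<noteq> 0}. {x. poly (fst qq) x = 0})"
    by (force simp: Z_def)
  moreover have "finite \<dots>"
    using V by (intro finite_UN_I) (auto intro: poly_roots_finite)
  ultimately show ?thesis by (rule finite_subset)
qed

text \<open>The intermediate stage when \<open>p\<close> joins: all old signs agree, and
  \<open>p\<close> agrees with \<open>p'\<close> at the old roots. What is left is to move the new
  roots of \<open>p\<close>, which lie in gaps of \<open>Z\<close>.\<close>

private definition good :: "('a \<Rightarrow> 'a) \<Rightarrow> bool" where
  "good h \<longleftrightarrow> matches h V \<and> (\<forall>x\<in>Z. sgn (poly p x) = sgn (poly p' (h x)))"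

private lemma goodD:
  assumes "good h"
  shows "matches h V" "order_iso h" "x \<in> Z \<Longrightarrow> sgn (poly p x) = sgn (poly p' (h x))"
  using assms by (auto simp: good_def matches_def)

text \<open>A point outside \<open>Z\<close> lies in a gap in which \<open>pderiv p\<close> has no
  root, so \<open>p\<close> and \<open>p'\<close> are strictly monotone there, both in the direction
  \<open>s\<close>. An unbounded gap is cut off at a far point, where the leading coefficients and
  the common degree determine equal signs.\<close>

private lemma bracket:
  assumes h: "good h" and x: "x \<notin> Z"
  shows "\<exists>a b s. a < x \<and> x < b \<and> (\<forall>z. a < z \<longrightarrow> z < b \<longrightarrow> z \<notin> Z) \<and> (s = 1 \<or> s = - 1) \<and>
    sgn (poly p a) = sgn (poly p' (h a)) \<and> sgn (poly p b) = sgn (poly p' (h b)) \<and>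
    (\<forall>y z. a \<le> y \<longrightarrow> y < z \<longrightarrow> z \<le> b \<longrightarrow> sgn (poly p z - poly p y) = s) \<and>
    (\<forall>y z. h a \<le> y \<longrightarrow> y < z \<longrightarrow> z \<le> h b \<longrightarrow> sgn (poly p' z - poly p' y) = s)"
proof -
  have iso: "order_iso h" by (rule goodD(2)[OF h])
  have lc: "sgn (lead_coeff p) = sgn (lead_coeff p')" using R_sgn[OF prel_lead_coeff[OF pp]] .
  have "\<exists>b>x. (\<forall>z. x \<le> z \<longrightarrow> z < b \<longrightarrow> z \<notin> Z) \<and> sgn (poly p b) = sgn (poly p' (h b))"
  proof (cases "\<exists>z\<in>Z. z > x")
    case True
    define Y where "Y = {z\<in>Z. z > x}"
    have Y: "finite Y" "Y \<noteq> {}" using True finite_Z by (auto simp: Y_def)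
    hence m: "Min Y \<in> Y" "\<And>z. z \<in> Y \<Longrightarrow> Min Y \<le> z" by auto
    have "z \<notin> Z" if "x \<le> z" "z < Min Y" for z
      using that m(2)[of z] x by (cases "x = z") (auto simp: Y_def)
    thus ?thesis using m(1) goodD(3)[OF h, of "Min Y"] by (intro exI[of _ "Min Y"]) (auto simp: Y_def)
  next
    case False
    obtain M where M: "\<forall>x\<ge>M. sgn (poly p x) = sgn (lead_coeff p)" using poly_sgn_at_top by blast
    obtain M' where M': "\<forall>x\<ge>M'. sgn (poly p' x) = sgn (lead_coeff p')" using poly_sgn_at_top by blast
    obtain m where m: "M' = h m" by (rule order_iso_obtain[OF iso])
    define b where "b = max (x + 1) (max M m)"
    have "h b \<ge> M'" unfolding m order_iso_le_iff[OF iso] by (simp add: b_def)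
    moreover have "b \<ge> M" "b > x" by (auto simp: b_def less_max_iff_disj)
    ultimately show ?thesis using M M' lc False x
      by (intro exI[of _ b]) (metis order_le_less)
  qed
  then obtain b where b: "b > x" "\<And>z. x \<le> z \<Longrightarrow> z < b \<Longrightarrow> z \<notin> Z" "sgn (poly p b) = sgn (poly p' (h b))"
    by blast
  have "\<exists>a<x. (\<forall>z. a < z \<longrightarrow> z \<le> x \<longrightarrow> z \<notin> Z) \<and> sgn (poly p a) = sgn (poly p' (h a))"
  proof (cases "\<exists>z\<in>Z. z < x")
    case True
    define Y where "Y = {z\<in>Z. z < x}"
    have Y: "finite Y" "Y \<noteq> {}" using True finite_Z by (auto simp: Y_def)
    hence m: "Max Y \<in> Y" "\<And>z. z \<in> Y \<Longrightarrow> z \<le> Max Y" by auto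
    have "z \<notin> Z" if "z \<le> x" "Max Y < z" for z
      using that m(2)[of z] x by (cases "x = z") (auto simp: Y_def)
    thus ?thesis using m(1) goodD(3)[OF h, of "Max Y"] by (intro exI[of _ "Max Y"]) (auto simp: Y_def)
  next
    case False
    obtain M where M: "\<forall>x\<le>M. sgn (poly p x) = sgn ((- 1) ^ degree p * lead_coeff p)"
      using poly_sgn_at_bot by blast
    obtain M' where M': "\<forall>x\<le>M'. sgn (poly p' x) = sgn ((- 1) ^ degree p' * lead_coeff p')"
      using poly_sgn_at_bot by blast
    obtain m where m: "M' = h m" by (rule order_iso_obtain[OF iso])
    define a where "a = min (x - 1) (min M m)"
    have "h a \<le> M'" unfolding m order_iso_le_iff[OF iso] by (simp add: a_def)
    moreover have "a \<le> M" "a < x" by (auto simp: a_def min_less_iff_disj)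
    moreover have "sgn ((- 1) ^ degree p * lead_coeff p) = sgn ((- 1) ^ degree p' * lead_coeff p')"
      using lc prel_degree[OF pp] by (simp add: sgn_mult)
    ultimately show ?thesis using M M' False x
      by (intro exI[of _ a]) (metis order_le_less)
  qed
  then obtain a where a: "a < x" "\<And>z. a < z \<Longrightarrow> z \<le> x \<Longrightarrow> z \<notin> Z" "sgn (poly p a) = sgn (poly p' (h a))"
    by blast
  have nz: "z \<notin> Z" if "a < z" "z < b" for z
    using a(2)[of z] b(2)[of z] that by (cases "z \<le> x") auto
  define s where "s = sgn (poly (pderiv p) x)"
  have s: "sgn (poly (pderiv p) z) = s" if "a < z" "z < b" for z
  proof -
    have "poly (pderiv p) y \<noteq> 0" if "a < y" "y < b" for y
      using nz[OF that] dp by (auto simp: Z_def)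
    hence "sgn (poly (pderiv p) (min z x)) = sgn (poly (pderiv p) (max z x))"
      using that a(1) b(1) by (intro poly_no_root_imp_sgn_eq) (auto simp: min_le_iff_disj le_max_iff_disj)
    thus ?thesis by (auto simp: s_def min_def max_def split: if_splits)
  qed
  have s': "sgn (poly (pderiv p') z) = s" if "h a < z" "z < h b" for z
  proof -
    obtain y where y: "z = h y" by (rule order_iso_obtain[OF iso])
    hence "a < y" "y < b" using that order_iso_less_iff[OF iso] by auto
    thus ?thesis using s[of y] matchesD[OF goodD(1)[OF h] dp(1), of y] y by simp
  qed
  have "poly (pderiv p) x \<noteq> 0" using x dp by (auto simp: Z_def)
  hence "s = 1 \<or> s = - 1" by (auto simp: s_def sgn_if)
  moreover have "sgn (poly p z - poly p y) = s" if "a \<le> y" "y < z" "z \<le> b" for y z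
    by (rule poly_diff_sgn_rcf) (use that s in auto)
  moreover have "sgn (poly p' z - poly p' y) = s" if "h a \<le> y" "y < z" "z \<le> h b" for y z
    by (rule poly_diff_sgn_rcf) (use that s' in auto)
  ultimately show ?thesis using a b nz by blast
qed

text \<open>In the gap around \<open>c\<close> the polynomial \<open>p\<close> changes sign, so
  \<open>p'\<close> has a root \<open>c'\<close> in the image of the gap, and a bump supported there
  takes \<open>h c\<close> to \<open>c'\<close>. Old polynomials have no root in the gap and keep
  their signs; by monotonicity \<open>c\<close> is the only root of \<open>p\<close> there, so
  images of other roots stay put.\<close>

private lemma move_root:
  assumes h: "good h" and c: "poly p c = 0" "c \<notin> Z"
  shows "\<exists>h'. good h' \<and> poly p' (h' c) = 0 \<and> (\<forall>y. poly p y = 0 \<longrightarrow> y \<noteq> c \<longrightarrow> h' y = h y)"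
proof -
  have iso: "order_iso h" by (rule goodD(2)[OF h])
  obtain a b s where ab: "a < c" "c < b" and nz: "\<And>z. a < z \<Longrightarrow> z < b \<Longrightarrow> z \<notin> Z"
    and s: "s = 1 \<or> s = - 1"
    and ends: "sgn (poly p a) = sgn (poly p' (h a))" "sgn (poly p b) = sgn (poly p' (h b))"
    and mono: "\<And>y z. a \<le> y \<Longrightarrow> y < z \<Longrightarrow> z \<le> b \<Longrightarrow> sgn (poly p z - poly p y) = s"
    using bracket[OF h c(2)] by metis
  have "sgn (poly p b) = s" "sgn (- poly p a) = s"
    using mono[of c b] mono[of a c] ab c(1) by auto
  hence "sgn (poly p' (h a) * poly p' (h b)) = - 1"
    using s ends by (auto simp: sgn_mult sgn_minus)
  hence "poly p' (h a) * poly p' (h b) < 0" by (metis sgn_less neg_less_0_iff_less zero_less_one)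
  moreover have hab: "h a < h c" "h c < h b" "h a < h b" using ab order_iso_less_iff[OF iso] by auto
  ultimately obtain c' where c': "h a < c'" "c' < h b" "poly p' c' = 0"
    using poly_IVT_rcf by blast
  obtain k where k: "order_iso k" "k (h c) = c'" "\<And>x. x \<le> h a \<or> h b \<le> x \<Longrightarrow> k x = x"
    using order_iso_bump[OF hab(1,2) c'(1,2)] by blast
  have out: "k (h y) = h y" if "\<not> (a < y \<and> y < b)" for y
    using that k(3)[of "h y"] order_iso_le_iff[OF iso] by (metis not_le)
  have "sgn (poly q x) = sgn (poly q' (k (h x)))" if q: "(q, q') \<in> V" for q q' x
  proof (cases "a < x \<and> x < b \<and> q \<noteq> 0")
    case False
    thus ?thesis
    proof (cases "q = 0")
      case True
      have "poly q' y = 0" for y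
      proof -
        obtain z where "y = h z" by (rule order_iso_obtain[OF iso])
        thus ?thesis using matchesD[OF goodD(1)[OF h] q, of z] True by (simp add: sgn_0_0)
      qed
      thus ?thesis using True by simp
    next
      case nz: False
      thus ?thesis using False out[of x] matchesD[OF goodD(1)[OF h] q, of x] by auto
    qed
  next
    case True
    obtain z where z: "k (h x) = h z" by (rule order_iso_obtain[OF iso])
    have "k (h a) < k (h x)" "k (h x) < k (h b)"
      using True order_iso_less_iff[OF iso] order_iso_less_iff[OF k(1)] by auto
    hence zab: "a < z" "z < b"
      using out[of a] out[of b] z order_iso_less_iff[OF iso] by auto
    have "poly q y \<noteq> 0" if "a < y" "y < b" for y
      using nz[OF that] q True by (auto simp: Z_def)
    hence "sgn (poly q (min z x)) = sgn (poly q (max z x))"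
      using zab True by (intro poly_no_root_imp_sgn_eq) (auto simp: min_le_iff_disj le_max_iff_disj)
    hence "sgn (poly q x) = sgn (poly q z)" by (auto simp: min_def max_def split: if_splits)
    thus ?thesis using matchesD[OF goodD(1)[OF h] q, of z] z by simp
  qed
  hence "matches (\<lambda>x. k (h x)) V"
    unfolding matches_def using order_iso_compose[OF k(1) iso] by auto
  moreover have "sgn (poly p x) = sgn (poly p' (k (h x)))" if "x \<in> Z" for x
    using out[of x] nz[of x] that goodD(3)[OF h that] by metis
  ultimately have "good (\<lambda>x. k (h x))" by (simp add: good_def)
  moreover have "k (h y) = h y" if "poly p y = 0" "y \<noteq> c" for y
  proof (rule out)
    show "\<not> (a < y \<and> y < b)"
      using mono[of y c] mono[of c y] that c ab s by (cases "y < c") auto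
  qed
  moreover have "poly p' (k (h c)) = 0" using k(2) c'(3) by simp
  ultimately show ?thesis by (intro exI[of _ "\<lambda>x. k (h x)"]) blast
qed

private lemma move_roots:
  assumes h: "good h" and C: "finite C" "\<And>c. c \<in> C \<Longrightarrow> poly p c = 0"
  shows "\<exists>h'. good h' \<and> (\<forall>c\<in>C. poly p' (h' c) = 0)"
  using C
proof (induction C rule: finite_induct)
  case empty
  thus ?case using h by blast
next
  case (insert c C)
  then obtain h1 where h1: "good h1" "\<forall>c\<in>C. poly p' (h1 c) = 0" by auto
  have pc: "poly p c = 0" using insert.prems by auto
  show ?case
  proof (cases "c \<in> Z")
    case True
    hence "poly p' (h1 c) = 0" using goodD(3)[OF h1(1) True] pc by (simp add: sgn_0_0)
    thus ?thesis using h1 by blast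
  next
    case False
    then obtain h2 where h2: "good h2" "poly p' (h2 c) = 0"
        "\<forall>y. poly p y = 0 \<longrightarrow> y \<noteq> c \<longrightarrow> h2 y = h1 y"
      using move_root[OF h1(1) pc False] by blast
    have "poly p' (h2 d) = 0" if "d \<in> C" for d
      using h2(3) h1(2) that insert.prems insert.hyps(2) by (metis insertCI)
    thus ?thesis using h2(1,2) by blast
  qed
qed

text \<open>Once every root of \<open>p\<close> goes to a root of \<open>p'\<close>, the sign at any
  other point of a gap is forced: by the side of the root on which it lies and the direction
  \<open>s\<close>, or by the end points if the gap has no root.\<close>

lemma matches_insert:
  assumes "matches h V"
    and "\<And>q q' x. (q, q') \<in> V \<Longrightarrow> q \<noteq> 0 \<Longrightarrow> poly q x = 0 \<Longrightarrow> sgn (poly p x) = sgn (poly p' (h x))"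
  shows "\<exists>h'. matches h' (insert (p, p') V)"
proof -
  have "p \<noteq> 0" using dp(2) by auto
  moreover have "good h" using assms by (auto simp: good_def Z_def)
  ultimately obtain h where h: "good h" and roots: "\<And>c. poly p c = 0 \<Longrightarrow> poly p' (h c) = 0"
    using move_roots[OF _ poly_roots_finite[of p]] by auto
  have iso: "order_iso h" by (rule goodD(2)[OF h])
  have "sgn (poly p x) = sgn (poly p' (h x))" for x
  proof (cases "x \<in> Z")
    case True
    thus ?thesis using goodD(3)[OF h] by blast
  next
    case False
    obtain a b s where ab: "a < x" "x < b" and s: "s = 1 \<or> s = - 1"
      and ends: "sgn (poly p a) = sgn (poly p' (h a))" "sgn (poly p b) = sgn (poly p' (h b))"
      and mono: "\<And>y z. a \<le> y \<Longrightarrow> y < z \<Longrightarrow> z \<le> b \<Longrightarrow> sgn (poly p z - poly p y) = s"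
      and mono': "\<And>y z. h a \<le> y \<Longrightarrow> y < z \<Longrightarrow> z \<le> h b \<Longrightarrow> sgn (poly p' z - poly p' y) = s"
      using bracket[OF h False] by metis
    have hx: "h a < h x" "h x < h b" using ab order_iso_less_iff[OF iso] by auto
    show ?thesis
    proof (cases "\<exists>c. a \<le> c \<and> c \<le> b \<and> poly p c = 0")
      case True
      then obtain c where c: "a \<le> c" "c \<le> b" "poly p c = 0" by blast
      have c': "poly p' (h c) = 0" "h a \<le> h c" "h c \<le> h b"
        using roots[OF c(3)] c order_iso_le_iff[OF iso] by auto
      consider "x = c" | "x < c" | "c < x" by force
      thus ?thesis
      proof cases
        case 2
        have "h x < h c" using 2 order_iso_less_iff[OF iso] by simp
        hence "sgn (poly p' (h c) - poly p' (h x)) = s"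
          by (intro mono') (use c' hx in simp_all)
        moreover have "sgn (poly p c - poly p x) = s"
          by (rule mono) (use 2 c ab in simp_all)
        ultimately have "sgn (- poly p x) = sgn (- poly p' (h x))" using c(3) c'(1) by simp
        thus ?thesis by (simp add: sgn_if split: if_splits)
      next
        case 3
        have "h c < h x" using 3 order_iso_less_iff[OF iso] by simp
        hence "sgn (poly p' (h x) - poly p' (h c)) = s"
          by (intro mono') (use c' hx in simp_all)
        moreover have "sgn (poly p x - poly p c) = s"
          by (rule mono) (use 3 c ab in simp_all)
        ultimately show ?thesis using c(3) c'(1) by simp
      qed (use c c' in simp)
    next
      case nr: False
      \<comment> \<open>Without a root, \<open>p\<close> has one nonzero sign at both ends, hence so
        has \<open>p'\<close> at the image points. A monotone \<open>p'\<close> lies in between and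
        has this sign as well.\<close>
      have pa: "sgn (poly p a) = sgn (poly p x)" "sgn (poly p x) = sgn (poly p b)"
        using nr ab by (auto intro!: poly_no_root_imp_sgn_eq)
      have "poly p x \<noteq> 0" using nr ab by auto
      moreover have "sgn (poly p' (h x) - poly p' (h a)) = s" "sgn (poly p' (h b) - poly p' (h x)) = s"
        using mono' hx by auto
      ultimately show ?thesis using s pa ends
        by (auto simp: sgn_if split: if_splits)
    qed
  qed
  hence "matches h (insert (p, p') V)" using goodD(1)[OF h] unfolding matches_def by auto
  thus ?thesis by blast
qed

end

text \<open>
  Cohen-Hoermander induction: polynomials are added in order of increasing degree. At a root of an
  earlier \<open>q\<close> the sign of \<open>p\<close> is that of the remainder of \<open>p\<close> by \<open>q\<close>, and between two such roots
  \<open>p\<close> is monotone because its derivative is among the earlier polynomials.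
\<close>

lemma matches_exists_aux:
  assumes "finite V" "\<And>q q'. (q, q') \<in> V \<Longrightarrow> prel q q' \<and> degree q \<le> n"
  shows "\<exists>h. matches h V"
  using assms
proof (induction n arbitrary: V)
  case 0
  have "sgn (poly q x) = sgn (poly q' x)" if "(q, q') \<in> V" for q q' x
  proof -
    have q: "prel q q'" "degree q = 0" using 0 that by auto
    then obtain a a' where "q = [:a:]" "q' = [:a':]"
      using prel_degree by (metis degree_eq_zeroE)
    thus ?thesis using R_sgn[OF prel_lead_coeff[OF q(1)]] by simp
  qed
  thus ?case unfolding matches_def using order_iso_id by (intro exI[of _ "\<lambda>x. x"]) auto
next
  case (Suc n)
  \<comment> \<open>Polynomials of top degree join one at a time. The set \<open>W\<close> of lower
    degree is arbitrary so that derivatives and remainders can be added to it during the inner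
    induction.\<close>
  have *: "\<exists>h. matches h (U \<union> W)"
    if "finite U" "\<And>q q'. (q, q') \<in> U \<Longrightarrow> prel q q' \<and> degree q = Suc n"
      "finite W" "\<And>q q'. (q, q') \<in> W \<Longrightarrow> prel q q' \<and> degree q \<le> n" for U W
    using that
  proof (induction U arbitrary: W rule: finite_induct)
    case empty
    thus ?case using Suc.IH[of W] by auto
  next
    case (insert pp U)
    obtain p p' where pp: "pp = (p, p')" by (cases pp)
    have p: "prel p p'" "degree p = Suc n" using insert.prems(1) pp by auto
    define V0 where "V0 = insert (pderiv p, pderiv p') (U \<union> W)"
    have V0: "prel q q' \<and> degree q \<le> Suc n" if "(q, q') \<in> V0" for q q'
      using that insert.prems p prel_pderiv[OF p(1)] degree_pderiv[of p]
      by (auto simp: V0_def le_Suc_eq)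
    have "\<exists>rr. \<exists>d d'. p = fst qq * d + fst rr \<and> p' = snd qq * d' + snd rr \<and>
        prel (fst rr) (snd rr) \<and> degree (fst rr) \<le> n" if "qq \<in> V0 \<and> degree (fst qq) > 0" for qq
    proof -
      obtain q q' where qq: "qq = (q, q')" by (cases qq)
      have q: "prel q q'" "degree q \<le> Suc n" "degree q > 0" using V0 that qq by auto
      then obtain d d' r r' where "p = q * d + r" "p' = q' * d' + r'" "prel r r'" "degree r < degree q"
        using prel_divmod[OF q(1) _ q(3) p(1)] by force
      thus ?thesis using qq q(2)
        by (intro exI[of _ "(r, r')"] exI[of _ d] exI[of _ d']) auto
    qed
    then obtain \<rho> where \<rho>: "\<And>qq. qq \<in> V0 \<Longrightarrow> degree (fst qq) > 0 \<Longrightarrow>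
        \<exists>d d'. p = fst qq * d + fst (\<rho> qq) \<and> p' = snd qq * d' + snd (\<rho> qq) \<and>
        prel (fst (\<rho> qq)) (snd (\<rho> qq)) \<and> degree (fst (\<rho> qq)) \<le> n"
      by metis
    \<comment> \<open>The derivative of \<open>p\<close> and its remainders by all of
      \<open>V0\<close> have degree at most \<open>n\<close>, so the inner hypothesis covers
      \<open>U\<close> together with them.\<close>
    define W' where "W' = W \<union> {(pderiv p, pderiv p')} \<union> \<rho> ` {qq \<in> V0. degree (fst qq) > 0}"
    have finW': "finite W'" using insert.hyps insert.prems by (simp add: W'_def V0_def)
    have W': "prel q q' \<and> degree q \<le> n" if qW: "(q, q') \<in> W'" for q q'
    proof -
      consider "(q, q') \<in> W" | "(q, q') = (pderiv p, pderiv p')"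
        | qq where "qq \<in> V0" "degree (fst qq) > 0" "(q, q') = \<rho> qq"
        using qW unfolding W'_def by blast
      thus ?thesis
      proof cases
        case 2
        thus ?thesis using prel_pderiv[OF p(1)] p(2) by (simp add: degree_pderiv)
      next
        case 3
        thus ?thesis using \<rho>[OF 3(1,2)] by (metis fst_conv snd_conv)
      qed (use insert.prems in auto)
    qed
    obtain h where h: "matches h (U \<union> W')"
      using insert.IH[of W'] insert.prems finW' W' by auto
    have "U \<union> W \<subseteq> V0" "V0 \<subseteq> U \<union> W'" by (auto simp: V0_def W'_def)
    hence h0: "matches h V0" using h unfolding matches_def by blast
    have "sgn (poly p x) = sgn (poly p' (h x))" if q: "(q, q') \<in> V0" "q \<noteq> 0" "poly q x = 0" for q q' x
    proof -
      have "degree q > 0"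
        using q(2,3) by (metis degree_eq_zeroE gr0I poly_const_conv pCons_0_0)
      then obtain d d' where r: "p = q * d + fst (\<rho> (q, q'))" "p' = q' * d' + snd (\<rho> (q, q'))"
        using \<rho>[OF q(1)] by auto
      have "\<rho> (q, q') \<in> U \<union> W'" using q(1) \<open>degree q > 0\<close> by (auto simp: W'_def)
      hence "sgn (poly (fst (\<rho> (q, q'))) x) = sgn (poly (snd (\<rho> (q, q'))) (h x))"
        using matchesD[OF h] by (metis prod.collapse)
      moreover have "poly q' (h x) = 0"
        using matchesD[OF h0 q(1), of x] q(3) by (simp add: sgn_0_0)
      hence "poly p' (h x) = poly (snd (\<rho> (q, q'))) (h x)" by (subst r(2)) simp
      moreover have "poly p x = poly (fst (\<rho> (q, q'))) x" by (subst r(1)) (simp add: q(3))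
      ultimately show ?thesis by simp
    qed
    moreover have "pderiv p \<noteq> 0" using p(2) by (simp add: pderiv_eq_0_iff)
    moreover have "finite V0" using insert.hyps insert.prems by (simp add: V0_def)
    ultimately obtain h' where "matches h' (insert (p, p') V0)"
      using matches_insert[OF _ p(1) _ _ h0] by (auto simp: V0_def)
    hence "matches h' (insert (p, p') (U \<union> W))"
      using \<open>U \<union> W \<subseteq> V0\<close> unfolding matches_def by blast
    hence "\<exists>h'. matches h' (insert (p, p') (U \<union> W))" by blast
    thus ?case by (simp add: pp)
  qed
  have "V = {qq\<in>V. degree (fst qq) = Suc n} \<union> {qq\<in>V. degree (fst qq) \<le> n}"
    using Suc.prems(2) by (force simp: le_Suc_eq)
  thus ?case using *[of "{qq\<in>V. degree (fst qq) = Suc n}" "{qq\<in>V. degree (fst qq) \<le> n}"] Suc.prems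
    by fastforce
qed

lemma matches_exists:
  assumes "finite V" "\<And>q q'. (q, q') \<in> V \<Longrightarrow> prel q q'"
  shows "\<exists>h. matches h V"
proof (rule matches_exists_aux[OF assms(1)])
  fix q q' assume "(q, q') \<in> V"
  moreover from this have "degree q \<le> Max ((\<lambda>qq. degree (fst qq)) ` V)"
    using assms(1) by (intro Max_ge) force+
  ultimately show "prel q q' \<and> degree q \<le> Max ((\<lambda>qq. degree (fst qq)) ` V)"
    using assms(2) by blast
qed

end

section \<open>Definability and saturation\<close>

definition dterm :: "'a::linordered_field set \<Rightarrow> ((nat \<Rightarrow> 'a) \<Rightarrow> 'a) \<Rightarrow> bool" where
  "dterm A g \<longleftrightarrow> (\<exists>t. set_rterm t \<subseteq> A \<and> g = (\<lambda>e. teval e t))"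

text \<open>Definability of a predicate on assignments. The closure rules below let it be proved by
  following the shape of the predicate, so that formulas need not be written out.\<close>

definition dform :: "'a::linordered_field set \<Rightarrow> ((nat \<Rightarrow> 'a) \<Rightarrow> bool) \<Rightarrow> bool" where
  "dform A P \<longleftrightarrow> (\<exists>\<phi>. set_rform \<phi> \<subseteq> A \<and> P = (\<lambda>e. feval e \<phi>))"

lemma dterm_var: "dterm A (\<lambda>e. e i)"
  unfolding dterm_def by (intro exI[of _ "TVar i"]) simp

lemma dterm_param: "a \<in> A \<Longrightarrow> dterm A (\<lambda>e. a)"
  unfolding dterm_def by (intro exI[of _ "TParam a"]) simp

lemma dterm_0: "dterm A (\<lambda>e. 0)"
  unfolding dterm_def by (intro exI[of _ "TZero"]) simp

lemma dterm_1: "dterm A (\<lambda>e. 1)"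
  unfolding dterm_def by (intro exI[of _ "TOne"]) simp

lemma dterm_minus: "dterm A f \<Longrightarrow> dterm A (\<lambda>e. - f e)"
  unfolding dterm_def
proof (elim exE conjE)
  fix s assume "set_rterm s \<subseteq> A" "f = (\<lambda>e. teval e s)"
  thus "\<exists>t. set_rterm t \<subseteq> A \<and> (\<lambda>e. - f e) = (\<lambda>e. teval e t)"
    by (intro exI[of _ "TNeg s"]) simp
qed

lemma dterm_add: "dterm A f \<Longrightarrow> dterm A g \<Longrightarrow> dterm A (\<lambda>e. f e + g e)"
  unfolding dterm_def
proof (elim exE conjE)
  fix s t assume "set_rterm s \<subseteq> A" "f = (\<lambda>e. teval e s)" "set_rterm t \<subseteq> A" "g = (\<lambda>e. teval e t)"
  thus "\<exists>t. set_rterm t \<subseteq> A \<and> (\<lambda>e. f e + g e) = (\<lambda>e. teval e t)"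
    by (intro exI[of _ "TAdd s t"]) simp
qed

lemma dterm_mult: "dterm A f \<Longrightarrow> dterm A g \<Longrightarrow> dterm A (\<lambda>e. f e * g e)"
  unfolding dterm_def
proof (elim exE conjE)
  fix s t assume "set_rterm s \<subseteq> A" "f = (\<lambda>e. teval e s)" "set_rterm t \<subseteq> A" "g = (\<lambda>e. teval e t)"
  thus "\<exists>t. set_rterm t \<subseteq> A \<and> (\<lambda>e. f e * g e) = (\<lambda>e. teval e t)"
    by (intro exI[of _ "TMul s t"]) simp
qed

lemma dterm_of_nat: "dterm A (\<lambda>e. of_nat n)"
  by (induction n) (auto intro: dterm_0 dterm_1 dterm_add)

lemma dform_eq: "dterm A f \<Longrightarrow> dterm A g \<Longrightarrow> dform A (\<lambda>e. f e = g e)"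
  unfolding dterm_def dform_def
proof (elim exE conjE)
  fix s t assume "set_rterm s \<subseteq> A" "f = (\<lambda>e. teval e s)" "set_rterm t \<subseteq> A" "g = (\<lambda>e. teval e t)"
  thus "\<exists>\<phi>. set_rform \<phi> \<subseteq> A \<and> (\<lambda>e. f e = g e) = (\<lambda>e. feval e \<phi>)"
    by (intro exI[of _ "FEq s t"]) simp
qed

lemma dform_less: "dterm A f \<Longrightarrow> dterm A g \<Longrightarrow> dform A (\<lambda>e. f e < g e)"
  unfolding dterm_def dform_def
proof (elim exE conjE)
  fix s t assume "set_rterm s \<subseteq> A" "f = (\<lambda>e. teval e s)" "set_rterm t \<subseteq> A" "g = (\<lambda>e. teval e t)"
  thus "\<exists>\<phi>. set_rform \<phi> \<subseteq> A \<and> (\<lambda>e. f e < g e) = (\<lambda>e. feval e \<phi>)"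
    by (intro exI[of _ "FLess s t"]) simp
qed

lemma dform_not: "dform A P \<Longrightarrow> dform A (\<lambda>e. \<not> P e)"
  unfolding dform_def
proof (elim exE conjE)
  fix \<phi> assume "set_rform \<phi> \<subseteq> A" "P = (\<lambda>e. feval e \<phi>)"
  thus "\<exists>\<phi>. set_rform \<phi> \<subseteq> A \<and> (\<lambda>e. \<not> P e) = (\<lambda>e. feval e \<phi>)"
    by (intro exI[of _ "FNot \<phi>"]) simp
qed

lemma dform_conj: "dform A P \<Longrightarrow> dform A Q \<Longrightarrow> dform A (\<lambda>e. P e \<and> Q e)"
  unfolding dform_def
proof (elim exE conjE)
  fix \<phi> \<psi> assume "set_rform \<phi> \<subseteq> A" "P = (\<lambda>e. feval e \<phi>)" "set_rform \<psi> \<subseteq> A" "Q = (\<lambda>e. feval e \<psi>)"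
  thus "\<exists>\<phi>. set_rform \<phi> \<subseteq> A \<and> (\<lambda>e. P e \<and> Q e) = (\<lambda>e. feval e \<phi>)"
    by (intro exI[of _ "FAnd \<phi> \<psi>"]) simp
qed

lemma dform_disj: "dform A P \<Longrightarrow> dform A Q \<Longrightarrow> dform A (\<lambda>e. P e \<or> Q e)"
  using dform_not[OF dform_conj[OF dform_not dform_not, of A P Q]] by simp

lemma dform_imp: "dform A P \<Longrightarrow> dform A Q \<Longrightarrow> dform A (\<lambda>e. P e \<longrightarrow> Q e)"
  unfolding imp_conv_disj by (intro dform_disj dform_not)

lemma dform_le: "dterm A f \<Longrightarrow> dterm A g \<Longrightarrow> dform A (\<lambda>e. f e \<le> g e)"
  unfolding not_less[symmetric] by (intro dform_not dform_less)

text \<open>The bound variable takes de Bruijn index 0 and pushes all others up by one, which is the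
  form of the assumption.\<close>

lemma dform_ex:
  assumes "dform A (\<lambda>e. P (\<lambda>i. e (Suc i)) (e 0))"
  shows "dform A (\<lambda>e. \<exists>x. P e x)"
proof -
  obtain \<phi> where \<phi>: "set_rform \<phi> \<subseteq> A" "(\<lambda>e. P (\<lambda>i. e (Suc i)) (e 0)) = (\<lambda>e. feval e \<phi>)"
    using assms unfolding dform_def by blast
  have "P e x = feval (case_nat x e) \<phi>" for e x
    using fun_cong[OF \<phi>(2), of "case_nat x e"] by simp
  hence "(\<lambda>e. \<exists>x. P e x) = (\<lambda>e. feval e (FEx \<phi>))" by (simp only: feval.simps)
  thus ?thesis unfolding dform_def using \<phi>(1) by (intro exI[of _ "FEx \<phi>"]) simp
qed

lemma dform_all:
  assumes "dform A (\<lambda>e. P (\<lambda>i. e (Suc i)) (e 0))"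
  shows "dform A (\<lambda>e. \<forall>x. P e x)"
  using dform_not[OF dform_ex[of A "\<lambda>e x. \<not> P e x"]] dform_not[OF assms] by simp

lemmas dform_intros = dform_eq dform_less dform_le dform_not dform_conj dform_disj dform_imp
  dform_ex dform_all dterm_var dterm_param dterm_0 dterm_1 dterm_minus dterm_add dterm_mult dterm_of_nat

lemma dterm_subst:
  assumes "\<And>i. dterm B (\<lambda>e. \<sigma> e i)" "set_rterm t \<subseteq> B"
  shows "dterm B (\<lambda>e. teval (\<sigma> e) t)"
  using assms(2) by (induction t) (auto intro: dform_intros assms(1))

lemma dterm_shift: "dterm A g \<Longrightarrow> dterm A (\<lambda>e. g (\<lambda>i. e (Suc i)))"
  unfolding dterm_def[of A g]
  by (elim exE conjE) (auto intro!: dterm_subst dterm_var)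

lemma dform_feval_subst:
  assumes "\<And>i. dterm B (\<lambda>e. \<sigma> e i)" "set_rform \<phi> \<subseteq> B"
  shows "dform B (\<lambda>e. feval (\<sigma> e) \<phi>)"
  using assms
proof (induction \<phi> arbitrary: \<sigma>)
  case (FEx \<phi>)
  \<comment> \<open>The substitution lifted below the quantifier: index 0 is kept, and the terms of
    \<sigma> are read in the shifted assignment.\<close>
  define \<tau> where "\<tau> = (\<lambda>e. case_nat (e 0) (\<sigma> (\<lambda>i. e (Suc i))))"
  have "dterm B (\<lambda>e. \<tau> e i)" for i
    unfolding \<tau>_def using dterm_shift[OF FEx.prems(1)] by (cases i) (auto intro: dterm_var)
  hence "dform B (\<lambda>e. feval (\<tau> e) \<phi>)"
    using FEx by auto
  thus ?case unfolding \<tau>_def by (auto intro!: dform_ex)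
qed (auto intro!: dform_intros dterm_subst)

lemma dform_subst:
  assumes "\<And>i. dterm B (\<lambda>e. \<sigma> e i)" "dform A P" "A \<subseteq> B"
  shows "dform B (\<lambda>e. P (\<sigma> e))"
  using assms dform_feval_subst[of B \<sigma>] unfolding dform_def[of A P] by auto

lemma dform_sgn:
  assumes "dterm A g"
  shows "dform A (\<lambda>e. sgn (g e) = c)"
proof -
  consider "c = 1" | "c = 0" | "c = - 1" | "c \<noteq> 1" "c \<noteq> 0" "c \<noteq> - 1" by blast
  thus ?thesis
  proof cases
    case 1
    hence "(\<lambda>e. sgn (g e) = c) = (\<lambda>e. 0 < g e)" by (auto simp: fun_eq_iff sgn_if)
    thus ?thesis using assms by (auto intro: dform_intros)
  next
    case 2
    hence "(\<lambda>e. sgn (g e) = c) = (\<lambda>e. g e = 0)" by (auto simp: fun_eq_iff sgn_if)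
    thus ?thesis using assms by (auto intro: dform_intros)
  next
    case 3
    hence "(\<lambda>e. sgn (g e) = c) = (\<lambda>e. g e < 0)" by (auto simp: fun_eq_iff sgn_if)
    thus ?thesis using assms by (auto intro: dform_intros)
  next
    case 4
    \<comment> \<open>No sign takes such a value, so a contradictory atom expresses the
      condition.\<close>
    hence "(\<lambda>e. sgn (g e) = c) = (\<lambda>e. g e < g e)" by (auto simp: fun_eq_iff sgn_if)
    thus ?thesis using dform_less[OF assms assms] by simp
  qed
qed

section \<open>Definable sets of the line and the plane, and saturation\<close>

lemma definable_line_iff:
  "definable_line A D \<longleftrightarrow> (\<exists>P. dform A P \<and> D = {x. P (tuple_env [x])})"
proof
  assume "definable_line A D"
  then obtain \<phi> where \<phi>: "set_rform \<phi> \<subseteq> A" "{[x] |x. x \<in> D} = {xs. length xs = 1 \<and> feval (tuple_env xs) \<phi>}"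
    unfolding definable_line_def definable_def by blast
  have "x \<in> D \<longleftrightarrow> feval (tuple_env [x]) \<phi>" for x
  proof -
    have "x \<in> D \<longleftrightarrow> [x] \<in> {[x] |x. x \<in> D}" by auto
    thus ?thesis unfolding \<phi>(2) by simp
  qed
  thus "\<exists>P. dform A P \<and> D = {x. P (tuple_env [x])}"
    using \<phi>(1) unfolding dform_def by blast
next
  assume "\<exists>P. dform A P \<and> D = {x. P (tuple_env [x])}"
  then obtain \<phi> where \<phi>: "set_rform \<phi> \<subseteq> A" "D = {x. feval (tuple_env [x]) \<phi>}"
    unfolding dform_def by blast
  have "{[x] |x. x \<in> D} = {xs. length xs = 1 \<and> feval (tuple_env xs) \<phi>}"
    unfolding \<phi>(2) by (auto simp: length_Suc_conv)
  thus "definable_line A D" unfolding definable_line_def definable_def using \<phi>(1) by blast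
qed

lemma definable_lineI: "dform A (\<lambda>e. Q (e 0)) \<Longrightarrow> definable_line A {x. Q x}"
  unfolding definable_line_iff by (intro exI[of _ "\<lambda>e. Q (e 0)"]) (simp add: tuple_env_def)

lemma definable_pointsI:
  assumes "dform A (\<lambda>e. Q (e 0) (e 1))" "\<And>x y. Some (x, y) \<in> D \<longleftrightarrow> Q x y"
  shows "definable_points A D"
proof -
  obtain \<phi> where \<phi>: "set_rform \<phi> \<subseteq> A" "(\<lambda>e. Q (e 0) (e 1)) = (\<lambda>e. feval e \<phi>)"
    using assms(1) unfolding dform_def by blast
  have Q: "Q x y \<longleftrightarrow> feval (tuple_env [x, y]) \<phi>" for x y
    using fun_cong[OF \<phi>(2), of "tuple_env [x, y]"] by (simp add: tuple_env_def)
  have "{[x, y] |x y. Some (x, y) \<in> D} = {xs. length xs = 2 \<and> feval (tuple_env xs) \<phi>}"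
    unfolding assms(2) Q by (auto simp: length_Suc_conv numeral_2_eq_2)
  thus ?thesis unfolding definable_points_def definable_def using \<phi>(1) by blast
qed

lemma lesspoll_Un_finite:
  fixes A B :: "'a::linordered_field set"
  assumes "A \<prec> (UNIV :: 'a set)" "finite B"
  shows "A \<union> B \<prec> (UNIV :: 'a set)"
proof (cases "finite A")
  case True
  have "infinite (UNIV :: 'a set)" by (rule infinite_UNIV_char_0)
  thus ?thesis using True assms(2) by (intro finite_lesspoll_infinite) auto
next
  case False
  have "A \<union> B \<approx> A"
    using assms(2)
  proof (induction B rule: finite_induct)
    case (insert b B)
    have "infinite (A \<union> B)" using False by simp
    hence "insert b (A \<union> B) \<approx> A \<union> B" by (rule infinite_insert_eqpoll)
    thus ?case using insert.IH eqpoll_trans by auto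
  qed simp
  thus ?thesis using assms(1) eq_lesspoll_trans by blast
qed

lemma saturated_realize:
  fixes A :: "'a::linordered_field set"
  assumes "saturated_field TYPE('a)" "A \<prec> (UNIV :: 'a set)"
    and def: "\<And>Q. Q \<in> \<Q> \<Longrightarrow> dform A (\<lambda>e. Q (e 0))"
    and fin: "\<And>\<Q>0. finite \<Q>0 \<Longrightarrow> \<Q>0 \<subseteq> \<Q> \<Longrightarrow> \<exists>x. \<forall>Q\<in>\<Q>0. Q x"
  shows "\<exists>x. \<forall>Q\<in>\<Q>. Q x"
proof -
  have "\<Inter>(Collect ` \<Q>) \<noteq> {}"
  proof (rule assms(1)[unfolded saturated_field_def, rule_format, OF assms(2)])
    fix D assume "D \<in> Collect ` \<Q>"
    then obtain Q where "Q \<in> \<Q>" "D = {x. Q x}" by auto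
    thus "definable_line A D" using definable_lineI def by metis
  next
    fix \<F> assume "\<F> \<subseteq> Collect ` \<Q>" "finite \<F>"
    then obtain \<Q>0 where "\<Q>0 \<subseteq> \<Q>" "finite \<Q>0" "\<F> = Collect ` \<Q>0"
      by (meson finite_subset_image)
    thus "\<Inter>\<F> \<noteq> {}" using fin[of \<Q>0] by auto
  qed
  thus ?thesis by auto
qed

section \<open>Back and forth\<close>

text \<open>Agreement of quantifier-free types over \<open>A\<close>: both kinds of atoms speak
  about the sign of a difference of terms.\<close>

definition same_signs :: "'a::linordered_field set \<Rightarrow> (nat \<Rightarrow> 'a) \<Rightarrow> (nat \<Rightarrow> 'a) \<Rightarrow> bool" where
  "same_signs A e e' \<longleftrightarrow> (\<forall>t. set_rterm t \<subseteq> A \<longrightarrow> sgn (teval e t) = sgn (teval e' t))"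

text \<open>A term read as a polynomial in variable 0; the assignment \<open>e\<close> supplies the
  variables from index 1 on.\<close>

primrec tpoly :: "(nat \<Rightarrow> 'a::linordered_field) \<Rightarrow> 'a rterm \<Rightarrow> 'a poly" where
  "tpoly e (TVar i) = (case i of 0 \<Rightarrow> [:0, 1:] | Suc j \<Rightarrow> [:e j:])"
| "tpoly e (TParam a) = [:a:]"
| "tpoly e TZero = 0"
| "tpoly e TOne = 1"
| "tpoly e (TNeg s) = - tpoly e s"
| "tpoly e (TAdd s t) = tpoly e s + tpoly e t"
| "tpoly e (TMul s t) = tpoly e s * tpoly e t"

lemma poly_tpoly: "poly (tpoly e t) x = teval (case_nat x e) t"
  by (induction t) (auto split: nat.split)

text \<open>Equal signs make \<open>teval e t\<close> to \<open>teval e' t\<close> an isomorphism of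
  ordered rings, extended by fractions to subfields. The matching order automorphism for the
  finitely many polynomials sends \<open>x\<close> to the required \<open>x'\<close>.\<close>

lemma same_signs_extend_finite:
  fixes e e' :: "nat \<Rightarrow> 'a::real_closed_field"
  assumes same: "same_signs A e e'" and T: "finite T" "\<And>t. t \<in> T \<Longrightarrow> set_rterm t \<subseteq> A"
  shows "\<exists>x'. \<forall>t\<in>T. sgn (teval (case_nat x' e') t) = sgn (teval (case_nat x e) t)"
proof -
  define R where "R = (\<lambda>c c'. \<exists>s t. set_rterm s \<subseteq> A \<and> set_rterm t \<subseteq> A \<and> teval e t \<noteq> 0 \<and>
    c = teval e s / teval e t \<and> c' = teval e' s / teval e' t)"
  have sg: "sgn (teval e t) = sgn (teval e' t)" if "set_rterm t \<subseteq> A" for t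
    using same that by (simp add: same_signs_def)
  have nz: "teval e t \<noteq> 0 \<longleftrightarrow> teval e' t \<noteq> 0" if "set_rterm t \<subseteq> A" for t
    using sg[OF that] by (metis sgn_0_0 sgn_0)
  have RI: "R (teval e s / teval e t) (teval e' s / teval e' t)"
    if "set_rterm s \<subseteq> A" "set_rterm t \<subseteq> A" "teval e t \<noteq> 0" for s t
    unfolding R_def using that by blast
  have R_teval: "R (teval e s) (teval e' s)" if "set_rterm s \<subseteq> A" for s
    using RI[of s TOne] that by simp
  interpret ordered_field_rel R
  proof
    show "R 0 0" using R_teval[of TZero] by simp
    show "R 1 1" using R_teval[of TOne] by simp
  next
    fix a a' b b' assume "R a a'" "R b b'"
    then obtain s t u v where *: "set_rterm s \<subseteq> A" "set_rterm t \<subseteq> A" "teval e t \<noteq> 0"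
      "a = teval e s / teval e t" "a' = teval e' s / teval e' t"
      "set_rterm u \<subseteq> A" "set_rterm v \<subseteq> A" "teval e v \<noteq> 0"
      "b = teval e u / teval e v" "b' = teval e' u / teval e' v"
      unfolding R_def by blast
    have nz': "teval e' t \<noteq> 0" "teval e' v \<noteq> 0" using * nz by auto
    show "R (a + b) (a' + b')"
      using RI[of "TAdd (TMul s v) (TMul u t)" "TMul t v"] * nz'
      by (simp add: add_divide_distrib)
    show "R (a * b) (a' * b')"
      using RI[of "TMul s u" "TMul t v"] * by simp
  next
    fix a a' assume "R a a'"
    then obtain s t where *: "set_rterm s \<subseteq> A" "set_rterm t \<subseteq> A" "teval e t \<noteq> 0"
      "a = teval e s / teval e t" "a' = teval e' s / teval e' t"
      unfolding R_def by blast
    show "R (- a) (- a')" using RI[of "TNeg s" t] * by simp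
    show "sgn a = sgn a'" using sg[OF *(1)] sg[OF *(2)] by (simp add: * sgn_divide)
    show "R (inverse a) (inverse a')"
    proof (cases "teval e s = 0")
      case True
      thus ?thesis using * nz[OF *(1)] \<open>R a a'\<close> by simp
    next
      case False
      thus ?thesis using RI[of t s] * by simp
    qed
  qed
  have prel_c: "prel [:a:] [:a':]" if "R a a'" for a a'
    using prel_pCons[OF that prel_0] .
  have rel: "prel (tpoly e t) (tpoly e' t)" if "set_rterm t \<subseteq> A" for t
    using that
  proof (induction t)
    case (TVar i)
    show ?case
      using prel_c[OF R_teval[of "TVar (i - 1)"]] prel_pCons[OF R_0 prel_c[OF R_1]]
      by (cases i) auto
  next
    case (TParam a)
    thus ?case using prel_c[OF R_teval[of "TParam a"]] by simp
  next
    case TOne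
    show ?case using prel_c[OF R_1] by (simp add: one_pCons)
  qed (auto intro: prel_0 prel_minus prel_add prel_mult)
  have "prel q q'" if "(q, q') \<in> (\<lambda>t. (tpoly e t, tpoly e' t)) ` T" for q q'
    using that T(2) rel by blast
  then obtain h where h: "matches h ((\<lambda>t. (tpoly e t, tpoly e' t)) ` T)"
    using matches_exists[of "(\<lambda>t. (tpoly e t, tpoly e' t)) ` T"] T(1) by blast
  have "sgn (teval (case_nat (h x) e') t) = sgn (teval (case_nat x e) t)" if "t \<in> T" for t
    using matchesD[OF h imageI[OF that], of x] by (simp add: poly_tpoly)
  thus ?thesis by blast
qed

text \<open>Saturation realises all sign conditions at once. They mention the values of
  \<open>e'\<close> as parameters, and a finite range keeps the parameter set small.\<close>

lemma same_signs_extend: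
  fixes e e' :: "nat \<Rightarrow> 'a::real_closed_field"
  assumes sat: "saturated_field TYPE('a)" and A: "A \<prec> (UNIV :: 'a set)"
    and same: "same_signs A e e'" and fin: "finite (range e')"
  shows "\<exists>x'. same_signs A (case_nat x e) (case_nat x' e')"
proof -
  define q where "q = (\<lambda>t y. sgn (teval (case_nat y e') t) = sgn (teval (case_nat x e) t))"
  have "\<exists>x'. \<forall>Q\<in>q ` {t. set_rterm t \<subseteq> A}. Q x'"
  proof (rule saturated_realize[OF sat lesspoll_Un_finite[OF A fin]])
    fix Q assume "Q \<in> q ` {t. set_rterm t \<subseteq> A}"
    then obtain t where t: "set_rterm t \<subseteq> A" "Q = q t" by blast
    have "dterm (A \<union> range e') (\<lambda>e0. case_nat (e0 0) e' i)" for i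
      by (cases i) (auto intro: dterm_var dterm_param)
    hence "dterm (A \<union> range e') (\<lambda>e0. teval (case_nat (e0 0) e') t)"
      using t(1) by (intro dterm_subst) auto
    thus "dform (A \<union> range e') (\<lambda>e. Q (e 0))"
      unfolding t(2) q_def by (rule dform_sgn)
  next
    fix \<Q>0 assume "finite \<Q>0" "\<Q>0 \<subseteq> q ` {t. set_rterm t \<subseteq> A}"
    then obtain T where T: "finite T" "T \<subseteq> {t. set_rterm t \<subseteq> A}" "\<Q>0 = q ` T"
      by (meson finite_subset_image)
    obtain x' where "\<forall>t\<in>T. sgn (teval (case_nat x' e') t) = sgn (teval (case_nat x e) t)"
      using same_signs_extend_finite[OF same T(1), of x] T(2) by blast
    thus "\<exists>x. \<forall>Q\<in>\<Q>0. Q x"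
      unfolding T(3) q_def by blast
  qed
  then obtain x' where x': "\<And>t. set_rterm t \<subseteq> A \<Longrightarrow> q t x'" by blast
  have "same_signs A (case_nat x e) (case_nat x' e')"
    unfolding same_signs_def using x'[unfolded q_def] by metis
  thus ?thesis by blast
qed

lemma same_signs_sym: "same_signs A e e' \<Longrightarrow> same_signs A e' e"
  by (simp add: same_signs_def)

lemma finite_range_case_nat: "finite (range e) \<Longrightarrow> finite (range (case_nat x e))"
  by (rule finite_subset[of _ "insert x (range e)"]) (auto split: nat.split)

text \<open>Back and forth in place of an explicit elimination: a witness on one side is answered by
  one with the same signs on the other. The claim is symmetric, so one direction of the existential
  case suffices.\<close>

lemma same_signs_imp_feval_eq:
  fixes e e' :: "nat \<Rightarrow> 'a::real_closed_field"
  assumes sat: "saturated_field TYPE('a)" and A: "A \<prec> (UNIV :: 'a set)"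
    and "same_signs A e e'" "finite (range e)" "finite (range e')" "set_rform \<phi> \<subseteq> A"
  shows "feval e \<phi> \<longleftrightarrow> feval e' \<phi>"
  using assms(3-6)
proof (induction \<phi> arbitrary: e e')
  case (FEq s t)
  have "sgn (teval e (TAdd s (TNeg t))) = sgn (teval e' (TAdd s (TNeg t)))"
    using FEq.prems(1,4) unfolding same_signs_def by (metis Un_iff rform.set(1) rterm.set(5,6) subset_iff)
  thus ?case by (simp add: sgn_if split: if_splits)
next
  case (FLess s t)
  have "sgn (teval e (TAdd s (TNeg t))) = sgn (teval e' (TAdd s (TNeg t)))"
    using FLess.prems(1,4) unfolding same_signs_def by (metis Un_iff rform.set(2) rterm.set(5,6) subset_iff)
  thus ?case by (simp add: sgn_if split: if_splits)
next
  case (FNot \<phi>)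
  thus ?case by simp
next
  case (FAnd \<phi> \<psi>)
  have "feval e \<phi> \<longleftrightarrow> feval e' \<phi>" "feval e \<psi> \<longleftrightarrow> feval e' \<psi>"
    using FAnd.prems by (simp_all add: FAnd.IH[of e e'])
  thus ?case by simp
next
  case (FEx \<phi>)
  have *: "feval e' (FEx \<phi>)" if ee: "feval e (FEx \<phi>)" "same_signs A e e'" "finite (range e)" "finite (range e')" for e e'
  proof -
    obtain x where x: "feval (case_nat x e) \<phi>" using ee(1) by auto
    obtain x' where "same_signs A (case_nat x e) (case_nat x' e')"
      using same_signs_extend[OF sat A ee(2,4)] by blast
    hence "feval (case_nat x' e') \<phi>"
      using x FEx.IH[OF _ finite_range_case_nat[OF ee(3)] finite_range_case_nat[OF ee(4)]] FEx.prems(4)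
      by (metis rform.set(5))
    thus ?thesis by auto
  qed
  show ?case using *[of e e'] *[of e' e] FEx.prems same_signs_sym by blast
qed

lemma dform_same_signs:
  fixes e e' :: "nat \<Rightarrow> 'a::real_closed_field"
  assumes "saturated_field TYPE('a)" "A \<prec> (UNIV :: 'a set)"
    and "same_signs A e e'" "finite (range e)" "finite (range e')" "dform A P"
  shows "P e \<longleftrightarrow> P e'"
  using assms same_signs_imp_feval_eq unfolding dform_def by blast

section \<open>Infinite elements\<close>

definition infinitely_large :: "'a::linordered_field \<Rightarrow> bool" where
  "infinitely_large y \<longleftrightarrow> (\<forall>n. of_nat n < y)"

text \<open>An overspill principle: conditions that hold at all large natural numbers are satisfied,
  any finitely many of them, by one natural number, and hence all together by an infinite
  element.\<close>

lemma saturated_realize_above_nat: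
  fixes A :: "'a::linordered_field set"
  assumes "saturated_field TYPE('a)" "A \<prec> (UNIV :: 'a set)"
    and Q: "\<And>Q. Q \<in> \<Q> \<Longrightarrow> dform A (\<lambda>e. Q (e 0))" "\<And>Q. Q \<in> \<Q> \<Longrightarrow> \<exists>m. \<forall>n\<ge>m. Q (of_nat n)"
  shows "\<exists>y. infinitely_large y \<and> (\<forall>Q\<in>\<Q>. Q y)"
proof -
  let ?\<Q> = "\<Q> \<union> range (\<lambda>n y. of_nat n < y)"
  have "\<exists>y. \<forall>Q\<in>?\<Q>. Q y"
  proof (rule saturated_realize[OF assms(1,2)])
    fix Q assume "Q \<in> ?\<Q>"
    thus "dform A (\<lambda>e. Q (e 0))" using Q(1) by (auto intro: dform_intros)
  next
    fix \<Q>0 assume fin: "finite \<Q>0" and sub: "\<Q>0 \<subseteq> ?\<Q>"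
    have "\<exists>m. \<forall>n\<ge>m. of_nat k < (of_nat n :: 'a)" for k
      by (intro exI[of _ "Suc k"]) simp
    hence "\<exists>m. \<forall>n\<ge>m. Q (of_nat n)" if "Q \<in> ?\<Q>" for Q
      using that Q(2) by blast
    hence "\<forall>Q\<in>?\<Q>. \<exists>m. \<forall>n\<ge>m. Q (of_nat n)" by blast
    from bchoice[OF this] obtain m where m: "\<forall>Q\<in>?\<Q>. \<forall>n\<ge>m Q. Q (of_nat n)" by blast
    have "\<forall>Q\<in>\<Q>0. Q (of_nat (Max (m ` \<Q>0)))"
    proof
      fix Q assume Q: "Q \<in> \<Q>0"
      hence "m Q \<le> Max (m ` \<Q>0)" using fin by (intro Max_ge) auto
      thus "Q (of_nat (Max (m ` \<Q>0)))" using m Q sub by blast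
    qed
    thus "\<exists>y. \<forall>Q\<in>\<Q>0. Q y" by blast
  qed
  thus ?thesis by (auto simp: infinitely_large_def)
qed

text \<open>
  The infinite elements up to a suitable \<open>y\<close> all realise the same type over \<open>A\<close>: they avoid the
  roots of all polynomials over \<open>A\<close>.
\<close>

lemma exists_homogeneous_initial_segment:
  fixes A :: "'a::real_closed_field set"
  assumes sat: "saturated_field TYPE('a)" and A: "A \<prec> (UNIV :: 'a set)" and b: "infinitely_large b"
  shows "\<exists>y. infinitely_large y \<and> y < b \<and>
    (\<forall>D z w. definable_line A D \<longrightarrow> infinitely_large z \<longrightarrow> z \<le> y \<longrightarrow> infinitely_large w \<longrightarrow> w \<le> y \<longrightarrow>
      (z \<in> D \<longleftrightarrow> w \<in> D))"
proof -
  define p :: "'a rterm \<Rightarrow> 'a poly" where "p = tpoly (\<lambda>_. 0)"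
  have env: "tuple_env [x] = case_nat x (\<lambda>_. 0)" for x :: 'a
    by (auto simp: tuple_env_def fun_eq_iff split: nat.split)
  have "\<exists>n. \<forall>z. poly (p t) z = 0 \<longrightarrow> of_nat n < z \<longrightarrow> infinitely_large z" if "p t \<noteq> 0" for t
  proof -
    let ?Z = "{z. poly (p t) z = 0 \<and> \<not> infinitely_large z}"
    have "finite ?Z" using poly_roots_finite[OF that] by (rule rev_finite_subset) auto
    moreover have "\<forall>z\<in>?Z. \<exists>n. z \<le> of_nat n" by (auto simp: infinitely_large_def not_less)
    then obtain m where m: "\<And>z. z \<in> ?Z \<Longrightarrow> z \<le> of_nat (m z)" by metis
    ultimately have "z \<le> of_nat (Max (m ` ?Z))" if "z \<in> ?Z" for z
      using m[OF that] that by (meson Max_ge finite_imageI imageI of_nat_mono order_trans)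
    thus ?thesis by (intro exI[of _ "Max (m ` ?Z)"]) force
  qed
  then obtain n where n: "\<And>t z. p t \<noteq> 0 \<Longrightarrow> poly (p t) z = 0 \<Longrightarrow> of_nat (n t) < z \<Longrightarrow> infinitely_large z"
    by metis
  \<comment> \<open>By the choice of \<open>n\<close>, a root above \<open>n t\<close> is infinite,
    so \<open>q t\<close> holds at every natural number and can be overspilled. The infinite
    elements up to the resulting \<open>y\<close> then contain no root of
    \<open>p t\<close>.\<close>
  define q where "q = (\<lambda>t y. \<forall>z. of_nat (n t) < z \<and> z \<le> y \<longrightarrow> \<not> poly (p t) z = 0)"
  let ?Q = "insert (\<lambda>y. y < b) (q ` {t. set_rterm t \<subseteq> A \<and> p t \<noteq> 0})"
  obtain y where y: "infinitely_large y" "\<forall>Q\<in>?Q. Q y"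
  proof (atomize_elim, rule saturated_realize_above_nat[OF sat lesspoll_Un_finite[OF A, of "{b}"]])
    fix Q assume Q: "Q \<in> ?Q"
    show "dform (A \<union> {b}) (\<lambda>e. Q (e 0))"
    proof (cases "Q = (\<lambda>y. y < b)")
      case True
      thus ?thesis by (auto intro: dform_intros)
    next
      case False
      then obtain t where t: "set_rterm t \<subseteq> A" "Q = q t" using Q by blast
      have "dterm (A \<union> {b}) (\<lambda>e::nat \<Rightarrow> 'a. case_nat (e 0) (\<lambda>_. 0) i)" for i
        by (cases i) (auto intro: dterm_var dterm_0)
      hence "dterm (A \<union> {b}) (\<lambda>e. teval (case_nat (e 0) (\<lambda>_. 0)) t)"
        using t(1) by (intro dterm_subst) auto
      hence "dterm (A \<union> {b}) (\<lambda>e. poly (p t) (e 0))"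
        by (simp add: p_def poly_tpoly)
      thus ?thesis unfolding t(2) q_def by (auto intro!: dform_intros)
    qed
    show "\<exists>m. \<forall>n\<ge>m. Q (of_nat n)"
    proof (cases "Q = (\<lambda>y. y < b)")
      case True
      thus ?thesis using b by (auto simp: infinitely_large_def)
    next
      case False
      then obtain t where t: "p t \<noteq> 0" "Q = q t" using Q by blast
      have "q t (of_nat k)" for k
        unfolding q_def using n[OF t(1)] by (metis infinitely_large_def not_le)
      thus ?thesis using t(2) by blast
    qed
  qed simp
  have "z \<in> D \<longleftrightarrow> w \<in> D" if D: "definable_line A D" and z: "infinitely_large z" "z \<le> y"
    and w: "infinitely_large w" "w \<le> y" for D z w
  proof -
    have "sgn (teval (tuple_env [z]) t) = sgn (teval (tuple_env [w]) t)" if t: "set_rterm t \<subseteq> A" for t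
    proof (cases "p t = 0")
      case True
      thus ?thesis unfolding env poly_tpoly[symmetric] p_def by simp
    next
      case False
      hence "q t y" using y(2) t by blast
      moreover have "of_nat (n t) < z" "of_nat (n t) < w" using z w by (auto simp: infinitely_large_def)
      ultimately have "sgn (poly (p t) (min z w)) = sgn (poly (p t) (max z w))"
        using z w unfolding q_def
        by (intro poly_no_root_imp_sgn_eq) (auto simp: min_le_iff_disj le_max_iff_disj)
      hence "sgn (poly (p t) z) = sgn (poly (p t) w)" by (auto simp: min_def max_def split: if_splits)
      thus ?thesis unfolding env poly_tpoly[symmetric] p_def by simp
    qed
    hence "same_signs A (tuple_env [z]) (tuple_env [w])" by (simp add: same_signs_def)
    moreover have "finite (range (tuple_env [v]))" for v :: 'a
      unfolding env by (intro finite_range_case_nat) simp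
    moreover obtain P where "dform A P" "D = {x. P (tuple_env [x])}"
      using D unfolding definable_line_iff by blast
    ultimately show ?thesis using dform_same_signs[OF sat A] by blast
  qed
  thus ?thesis using y by blast
qed

section \<open>The multiplicative truncation\<close>

text \<open>The positive units of the standard valuation ring; one natural number bounds both
  \<open>u\<close> and its inverse.\<close>

definition finite_units :: "'a::linordered_field set" where
  "finite_units = {u. 0 < u \<and> (\<exists>n. u \<le> of_nat n \<and> 1 \<le> of_nat n * u)}"

lemma finite_units_mult: "u \<in> finite_units \<Longrightarrow> v \<in> finite_units \<Longrightarrow> u * v \<in> finite_units"
proof -
  assume "u \<in> finite_units" "v \<in> finite_units"
  then obtain m n where *: "0 < u" "u \<le> of_nat m" "1 \<le> of_nat m * u" "0 < v" "v \<le> of_nat n" "1 \<le> of_nat n * v"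
    by (auto simp: finite_units_def)
  have "u * v \<le> of_nat (m * n)" using * by (simp add: mult_mono)
  moreover have "1 * 1 \<le> (of_nat m * u) * (of_nat n * v)" using * by (intro mult_mono) auto
  hence "1 \<le> of_nat (m * n) * (u * v)" by (simp add: algebra_simps)
  ultimately show ?thesis using * by (auto simp: finite_units_def intro!: exI[of _ "m * n"])
qed

lemma finite_units_inverse: "u \<in> finite_units \<Longrightarrow> inverse u \<in> finite_units"
proof -
  assume "u \<in> finite_units"
  then obtain n where "0 < u" "u \<le> of_nat n" "1 \<le> of_nat n * u" by (auto simp: finite_units_def)
  thus ?thesis by (auto simp: finite_units_def field_simps intro!: exI[of _ n])
qed

lemma finite_unitsI: "0 < u \<Longrightarrow> u \<le> of_nat n \<Longrightarrow> 1 \<le> of_nat n * u \<Longrightarrow> u \<in> finite_units"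
  by (auto simp: finite_units_def)

lemma finite_units_1: "1 \<in> finite_units"
  by (rule finite_unitsI[of _ 1]) auto

section \<open>The truncation as multiplication modulo powers of \<epsilon>^2\<close>

locale infinitesimal =
  fixes \<epsilon> :: "'a::linordered_field"
  assumes eps_pos: "0 < \<epsilon>" and eps_small: "of_nat n * \<epsilon> < 1"
begin

lemma eps_less_1: "\<epsilon> < 1"
  using eps_small[of 1] by simp

text \<open>The law of the truncation is multiplication followed by a correction by such a power;
  the translates of [\<epsilon>, 1/\<epsilon>) by these powers are pairwise disjoint.\<close>

definition qpow :: "int \<Rightarrow> 'a" where
  "qpow k = (\<epsilon> ^ 2) powi k"

lemma qpow_pos: "qpow k > 0"
  using eps_pos by (simp add: qpow_def)

lemma qpow_nz: "qpow k \<noteq> 0"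
  using qpow_pos[of k] by simp

lemma qpow_add: "qpow (k + l) = qpow k * qpow l"
  using eps_pos by (simp add: qpow_def power_int_add)

lemma qpow_0: "qpow 0 = 1"
  by (simp add: qpow_def)

lemma qpow_1: "qpow 1 = \<epsilon> ^ 2"
  by (simp add: qpow_def)

lemma qpow_minus: "qpow (- k) = inverse (qpow k)"
  by (simp add: qpow_def power_int_minus)

lemma qpow_le: "k \<ge> 1 \<Longrightarrow> qpow k \<le> \<epsilon> ^ 2"
  using power_int_decreasing[of 1 k "\<epsilon> ^ 2"] eps_pos eps_less_1
  by (simp add: qpow_def power_le_one)

text \<open>Equality up to exactly the ambiguity that a subgroup of the truncation containing
  \<open>finite_units\<close> cannot see. Both group laws and \<open>f_star\<close> are compared in
  this sense.\<close>

definition sim :: "'a \<Rightarrow> 'a \<Rightarrow> bool" (infix "\<approx>\<^sub>\<epsilon>" 50) where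
  "a \<approx>\<^sub>\<epsilon> b \<longleftrightarrow> (\<exists>u\<in>finite_units. \<exists>k. a = b * u * qpow k)"

lemma simI: "u \<in> finite_units \<Longrightarrow> a = b * u * qpow k \<Longrightarrow> a \<approx>\<^sub>\<epsilon> b"
  by (auto simp: sim_def)

lemma sim_refl: "a \<approx>\<^sub>\<epsilon> a"
  by (rule simI[OF finite_units_1, of _ _ 0]) (simp add: qpow_0)

lemma sim_shift: "a * qpow k \<approx>\<^sub>\<epsilon> a"
  by (rule simI[OF finite_units_1, of _ _ k]) simp

lemma sim_mult: "a \<approx>\<^sub>\<epsilon> b \<Longrightarrow> c \<approx>\<^sub>\<epsilon> d \<Longrightarrow> a * c \<approx>\<^sub>\<epsilon> b * d"
proof -
  assume "a \<approx>\<^sub>\<epsilon> b" "c \<approx>\<^sub>\<epsilon> d"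
  then obtain u k v l where *: "u \<in> finite_units" "a = b * u * qpow k" "v \<in> finite_units" "c = d * v * qpow l"
    by (auto simp: sim_def)
  show ?thesis
    by (rule simI[OF finite_units_mult[OF *(1,3)], of _ _ "k + l"]) (simp add: * qpow_add)
qed

lemma sim_trans: "a \<approx>\<^sub>\<epsilon> b \<Longrightarrow> b \<approx>\<^sub>\<epsilon> c \<Longrightarrow> a \<approx>\<^sub>\<epsilon> c"
proof -
  assume "a \<approx>\<^sub>\<epsilon> b" "b \<approx>\<^sub>\<epsilon> c"
  then obtain u k v l where *: "u \<in> finite_units" "a = b * u * qpow k" "v \<in> finite_units" "b = c * v * qpow l"
    by (auto simp: sim_def)
  show ?thesis
    by (rule simI[OF finite_units_mult[OF *(1,3)], of _ _ "k + l"]) (simp add: * qpow_add)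
qed

lemma sim_sym: "a \<approx>\<^sub>\<epsilon> b \<Longrightarrow> b \<approx>\<^sub>\<epsilon> a"
proof -
  assume "a \<approx>\<^sub>\<epsilon> b"
  then obtain u k where *: "u \<in> finite_units" "a = b * u * qpow k" by (auto simp: sim_def)
  moreover have "u \<noteq> 0" using *(1) by (auto simp: finite_units_def)
  ultimately show ?thesis
    using qpow_nz[of k] by (intro simI[OF finite_units_inverse[OF *(1)], of _ _ "- k"]) (simp add: qpow_minus field_simps)
qed

lemma sim_inverse: "a \<approx>\<^sub>\<epsilon> b \<Longrightarrow> inverse a \<approx>\<^sub>\<epsilon> inverse b"
proof -
  assume "a \<approx>\<^sub>\<epsilon> b"
  then obtain u k where *: "u \<in> finite_units" "a = b * u * qpow k" by (auto simp: sim_def)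
  thus ?thesis
    by (intro simI[OF finite_units_inverse[OF *(1)], of _ _ "- k"]) (simp add: qpow_minus)
qed

text \<open>No power of \<epsilon>^2 can be involved: a positive exponent would push
  \<open>a\<close> below \<epsilon>, a negative one would make the finite unit \<open>u\<close>
  smaller than \<epsilon>.\<close>

lemma sim_one_imp_finite_unit:
  assumes "\<epsilon> \<le> a" "a < 1 / \<epsilon>" "a \<approx>\<^sub>\<epsilon> 1"
  shows "a \<in> finite_units"
proof -
  obtain u k where u: "u \<in> finite_units" and a: "a = u * qpow k" using assms(3) by (auto simp: sim_def)
  obtain n where n: "0 < u" "u \<le> of_nat n" "1 \<le> of_nat n * u" using u by (auto simp: finite_units_def)
  have "\<not> k \<ge> 1"
  proof
    assume "k \<ge> 1"
    hence "u * qpow k \<le> of_nat n * \<epsilon> ^ 2"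
      using qpow_le n qpow_pos[of k] by (intro mult_mono) auto
    also have "\<dots> = of_nat n * \<epsilon> * \<epsilon>" by (simp add: power2_eq_square)
    also have "\<dots> < 1 * \<epsilon>" using eps_small[of n] eps_pos by (intro mult_strict_right_mono)
    finally show False using a assms(1) by simp
  qed
  moreover have "\<not> k \<le> - 1"
  proof
    assume "k \<le> - 1"
    hence q: "qpow (- k) \<le> \<epsilon> ^ 2" using qpow_le by simp
    have "u = a * qpow (- k)" using a qpow_nz[of k] by (simp add: qpow_minus)
    also have "\<dots> \<le> a * \<epsilon> ^ 2" using q assms(1) eps_pos by (intro mult_left_mono) auto
    also have "\<dots> < 1 / \<epsilon> * \<epsilon> ^ 2" using assms(2) eps_pos by (intro mult_strict_right_mono) auto
    finally have "u < \<epsilon>" using eps_pos by (simp add: power2_eq_square)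
    hence "of_nat n * u \<le> of_nat n * \<epsilon>" by (intro mult_left_mono) auto
    thus False using n(3) eps_small[of n] by linarith
  qed
  ultimately have "k = 0" by linarith
  thus ?thesis using a u qpow_0 by simp
qed

abbreviation "H \<equiv> trunc_group \<epsilon>"

lemma carrier_H: "a \<in> carrier H \<longleftrightarrow> \<epsilon> \<le> a \<and> a < 1 / \<epsilon>"
  by (auto simp: trunc_group_def)

lemma one_H: "\<one>\<^bsub>H\<^esub> = 1"
  by (simp add: trunc_group_def)

lemma mult_H: "a \<otimes>\<^bsub>H\<^esub> b = trunc_mult \<epsilon> a b"
  by (simp add: trunc_group_def)

lemma carrier_H_pos: "a \<in> carrier H \<Longrightarrow> 0 < a"
  using eps_pos by (auto simp: carrier_H)

lemma mult_H_shift: "\<exists>k. a \<otimes>\<^bsub>H\<^esub> b = a * b * qpow k"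
proof -
  have "qpow (- 1) = 1 / \<epsilon> ^ 2" unfolding qpow_minus qpow_1 by (simp add: field_simps)
  thus ?thesis unfolding mult_H trunc_mult_def
    using qpow_0 qpow_1 by (auto intro: exI[of _ 0] exI[of _ 1] exI[of _ "- 1"])
qed

lemma mult_H_closed:
  assumes "a \<in> carrier H" "b \<in> carrier H"
  shows "a \<otimes>\<^bsub>H\<^esub> b \<in> carrier H"
proof -
  have ab: "\<epsilon> * \<epsilon> \<le> a * b" "a * b < 1 / \<epsilon> * (1 / \<epsilon>)"
    using assms eps_pos carrier_H_pos[OF assms(1)] carrier_H_pos[OF assms(2)]
    by (intro mult_mono mult_strict_mono; simp add: carrier_H)+
  consider "a * b \<ge> 1 / \<epsilon>" | "a * b < 1 / \<epsilon>" "a * b < \<epsilon>" | "a * b < 1 / \<epsilon>" "a * b \<ge> \<epsilon>" by force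
  thus ?thesis
  proof cases
    case 1
    have "a * b * \<epsilon>\<^sup>2 \<ge> 1 / \<epsilon> * \<epsilon>\<^sup>2" using 1 by (intro mult_right_mono) auto
    moreover have "a * b * \<epsilon>\<^sup>2 < 1 / \<epsilon> * (1 / \<epsilon>) * \<epsilon>\<^sup>2" using ab eps_pos by (intro mult_strict_right_mono) auto
    moreover have "1 < 1 / \<epsilon>" using eps_pos eps_less_1 by simp
    moreover have "1 / \<epsilon> * \<epsilon>\<^sup>2 = \<epsilon>" "1 / \<epsilon> * (1 / \<epsilon>) * \<epsilon>\<^sup>2 = 1"
      using eps_pos by (auto simp: power2_eq_square)
    ultimately have "\<epsilon> \<le> a * b * \<epsilon>\<^sup>2" "a * b * \<epsilon>\<^sup>2 < 1 / \<epsilon>" by (metis, metis less_trans)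
    thus ?thesis unfolding carrier_H mult_H trunc_mult_def using 1 by simp
  next
    case 2
    have "a * b / \<epsilon>\<^sup>2 \<ge> (\<epsilon> * \<epsilon>) / \<epsilon>\<^sup>2" using ab by (intro divide_right_mono) auto
    moreover have "a * b / \<epsilon>\<^sup>2 < \<epsilon> / \<epsilon>\<^sup>2" using 2 eps_pos by (intro divide_strict_right_mono) auto
    moreover have "\<epsilon> / \<epsilon>\<^sup>2 = 1 / \<epsilon>" "(\<epsilon> * \<epsilon>) / \<epsilon>\<^sup>2 = 1"
      using eps_pos by (auto simp: power2_eq_square)
    ultimately have "\<epsilon> \<le> a * b / \<epsilon>\<^sup>2" "a * b / \<epsilon>\<^sup>2 < 1 / \<epsilon>"
      using eps_less_1 by simp_all
    thus ?thesis unfolding carrier_H mult_H trunc_mult_def using 2 by simp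
  next
    case 3
    thus ?thesis by (simp add: carrier_H mult_H trunc_mult_def)
  qed
qed

text \<open>Disjointness of the translates of [\<epsilon>, 1/\<epsilon>). Associativity follows:
  both bracketings are \<open>x * y * z\<close> times a power of \<epsilon>^2 and both lie in the
  carrier.\<close>

lemma carrier_H_shift_unique:
  assumes "a \<in> carrier H" "b \<in> carrier H" "a = b * qpow k"
  shows "a = b"
proof -
  have *: "\<not> l \<ge> 1" if "c \<in> carrier H" "d \<in> carrier H" "c = d * qpow l" for c d l
  proof
    assume "l \<ge> 1"
    hence "c \<le> d * \<epsilon>\<^sup>2" using that qpow_le[of l] carrier_H_pos[of d] by (simp add: mult_left_mono)
    also have "\<dots> < 1 / \<epsilon> * \<epsilon>\<^sup>2" using that eps_pos by (intro mult_strict_right_mono) (auto simp: carrier_H)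
    finally show False using that(1) eps_pos by (simp add: carrier_H power2_eq_square)
  qed
  have "b = a * qpow (- k)" using assms(3) qpow_nz[of k] by (simp add: qpow_minus)
  hence "k = 0" using *[OF assms] *[OF assms(2,1), of "- k"] by linarith
  thus ?thesis using assms(3) qpow_0 by simp
qed

text \<open>The interval is half open, so \<open>1 / \<epsilon>\<close> is missing and \<epsilon> is
  its own inverse: \<epsilon>^2 lies below the interval and is lifted to 1.\<close>

lemma inv_exists_H:
  assumes "a \<in> carrier H"
  shows "(if a = \<epsilon> then \<epsilon> else 1 / a) \<in> carrier H" "(if a = \<epsilon> then \<epsilon> else 1 / a) \<otimes>\<^bsub>H\<^esub> a = 1"
proof -
  have 1: "\<epsilon> < 1 / \<epsilon>" "1 < 1 / \<epsilon>" "\<epsilon> * \<epsilon> < \<epsilon> * 1"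
    using eps_pos eps_less_1 by (auto simp: field_simps intro: less_trans mult_strict_left_mono)
  show "(if a = \<epsilon> then \<epsilon> else 1 / a) \<in> carrier H"
    using assms eps_pos 1 carrier_H_pos[OF assms] by (auto simp: carrier_H field_simps)
  show "(if a = \<epsilon> then \<epsilon> else 1 / a) \<otimes>\<^bsub>H\<^esub> a = 1"
  proof (cases "a = \<epsilon>")
    case True
    have "\<epsilon> * \<epsilon> < \<epsilon>" "\<not> 1 / \<epsilon> \<le> \<epsilon> * \<epsilon>" using 1 by auto
    thus ?thesis using True eps_pos by (simp add: mult_H trunc_mult_def power2_eq_square)
  next
    case False
    thus ?thesis using carrier_H_pos[OF assms] 1 eps_less_1 by (simp add: mult_H trunc_mult_def)
  qed
qed

lemma mult_H_comm: "a \<otimes>\<^bsub>H\<^esub> b = b \<otimes>\<^bsub>H\<^esub> a"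
  by (simp add: mult_H trunc_mult_def mult.commute)

lemma comm_group_H: "comm_group H"
proof (rule comm_groupI)
  fix x y z assume x: "x \<in> carrier H" and y: "y \<in> carrier H" and z: "z \<in> carrier H"
  obtain k where k: "x \<otimes>\<^bsub>H\<^esub> y = x * y * qpow k" using mult_H_shift by blast
  obtain l where l: "(x \<otimes>\<^bsub>H\<^esub> y) \<otimes>\<^bsub>H\<^esub> z = (x \<otimes>\<^bsub>H\<^esub> y) * z * qpow l" using mult_H_shift by blast
  obtain m where m: "y \<otimes>\<^bsub>H\<^esub> z = y * z * qpow m" using mult_H_shift by blast
  obtain n where n: "x \<otimes>\<^bsub>H\<^esub> (y \<otimes>\<^bsub>H\<^esub> z) = x * (y \<otimes>\<^bsub>H\<^esub> z) * qpow n" using mult_H_shift by blast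
  have "(x \<otimes>\<^bsub>H\<^esub> y) \<otimes>\<^bsub>H\<^esub> z = x * y * z * (qpow k * qpow l)"
    unfolding l unfolding k by (simp add: mult_ac)
  also have "\<dots> = x * y * z * (qpow m * qpow n) * qpow (k + l - m - n)"
    using qpow_add[of "k + l - m - n" "m + n"] by (simp add: qpow_add[symmetric] mult.assoc)
  also have "x * y * z * (qpow m * qpow n) = x \<otimes>\<^bsub>H\<^esub> (y \<otimes>\<^bsub>H\<^esub> z)"
    unfolding n unfolding m by (simp add: mult_ac)
  finally show "(x \<otimes>\<^bsub>H\<^esub> y) \<otimes>\<^bsub>H\<^esub> z = x \<otimes>\<^bsub>H\<^esub> (y \<otimes>\<^bsub>H\<^esub> z)"
    using carrier_H_shift_unique[OF mult_H_closed[OF mult_H_closed[OF x y] z] mult_H_closed[OF x mult_H_closed[OF y z]]]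
    by blast
next
  show "\<one>\<^bsub>H\<^esub> \<in> carrier H" using eps_pos eps_less_1 by (simp add: one_H carrier_H)
next
  fix x assume "x \<in> carrier H"
  thus "\<one>\<^bsub>H\<^esub> \<otimes>\<^bsub>H\<^esub> x = x" by (auto simp: one_H mult_H trunc_mult_def carrier_H)
  show "\<exists>y\<in>carrier H. y \<otimes>\<^bsub>H\<^esub> x = \<one>\<^bsub>H\<^esub>" using inv_exists_H[OF \<open>x \<in> carrier H\<close>] by (auto simp: one_H)
qed (auto intro: mult_H_closed mult_H_comm)

sublocale H: comm_group "trunc_group \<epsilon>"
  by (rule comm_group_H)

lemma inv_H: "a \<in> carrier H \<Longrightarrow> inv\<^bsub>H\<^esub> a = (if a = \<epsilon> then \<epsilon> else 1 / a)"
  using inv_exists_H[of a] by (intro H.inv_equality) (auto simp: one_H)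

lemma inv_H_sim: "a \<in> carrier H \<Longrightarrow> inv\<^bsub>H\<^esub> a \<approx>\<^sub>\<epsilon> inverse a"
proof (cases "a = \<epsilon>")
  case True
  assume "a \<in> carrier H"
  moreover have "\<epsilon> = inverse \<epsilon> * qpow 1" using eps_pos by (simp add: qpow_1 power2_eq_square)
  ultimately show ?thesis using True inv_H sim_shift[of "inverse \<epsilon>" 1] by simp
qed (auto simp: inv_H inverse_eq_divide sim_refl)

lemma mult_H_sim: "a \<otimes>\<^bsub>H\<^esub> b \<approx>\<^sub>\<epsilon> a * b"
  using mult_H_shift[of a b] sim_shift by auto

lemma mult_inv_H:
  assumes "a \<in> carrier H" "b \<in> carrier H" "b < a" "1 \<le> b"
  shows "a \<otimes>\<^bsub>H\<^esub> inv\<^bsub>H\<^esub> b = a / b"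
proof -
  have "a / b \<le> a" "1 \<le> a / b" using assms carrier_H_pos[OF assms(1)]
    by (auto simp: field_simps)
  moreover from this have "\<not> a / b < \<epsilon>" "\<not> 1 / \<epsilon> \<le> a / b"
    using assms(1) eps_less_1 by (auto simp: carrier_H)
  moreover have "b \<noteq> \<epsilon>" using assms(4) eps_less_1 by auto
  ultimately show ?thesis using assms(2) by (simp add: inv_H mult_H trunc_mult_def)
qed

end

section \<open>Type-definable subgroups of bounded index contain the finite units\<close>

lemma infinitely_large_mono: "infinitely_large y \<Longrightarrow> y \<le> z \<Longrightarrow> infinitely_large z"
  unfolding infinitely_large_def using less_le_trans by blast

lemma infinitely_large_pos: "infinitely_large y \<Longrightarrow> 1 < y"
  unfolding infinitely_large_def by (metis of_nat_1)

lemma infinitely_large_divide: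
  fixes y :: "'a::linordered_field"
  assumes "infinitely_large y" "0 < u" "u \<le> of_nat n"
  shows "infinitely_large (y / u)"
  unfolding infinitely_large_def
proof
  fix m
  have "of_nat m * u \<le> of_nat m * (of_nat n :: 'a)" using assms by (intro mult_left_mono) auto
  also have "\<dots> < y" using assms(1) unfolding infinitely_large_def by (metis of_nat_mult)
  finally show "of_nat m < y / u" using assms(2) by (simp add: pos_less_divide_eq)
qed

lemma infinitesimal_imp_large_inverse:
  assumes "infinitesimal \<epsilon>"
  shows "infinitely_large (1 / \<epsilon>)"
  unfolding infinitely_large_def
  using infinitesimal.eps_small[OF assms] infinitesimal.eps_pos[OF assms] by (simp add: pos_less_divide_eq)

lemma bounded_subgroup_contains_finite:
  fixes \<epsilon> :: "'a::real_closed_field"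
  assumes sat: "saturated_field TYPE('a)" and inf: "infinitesimal \<epsilon>"
    and S: "tdef_bounded_subgroup definable_line (trunc_group \<epsilon>) S"
    and u: "1 \<le> u" "u \<le> of_nat n"
  shows "u \<in> S"
proof -
  interpret infinitesimal \<epsilon> by (rule inf)
  have sub: "subgroup S H" and idx: "(rcosets\<^bsub>H\<^esub> S) \<prec> (UNIV :: 'a set)"
    using S by (auto simp: tdef_bounded_subgroup_def)
  obtain A \<F> where A: "A \<prec> (UNIV :: 'a set)" "\<And>Y. Y \<in> \<F> \<Longrightarrow> definable_line A Y" "S = \<Inter>\<F>"
    using S unfolding tdef_bounded_subgroup_def type_definable_def by metis
  obtain y where y: "infinitely_large y" "y < 1 / \<epsilon>"
    and hom: "\<And>D z w. definable_line A D \<Longrightarrow> infinitely_large z \<Longrightarrow> z \<le> y \<Longrightarrow>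
      infinitely_large w \<Longrightarrow> w \<le> y \<Longrightarrow> z \<in> D \<longleftrightarrow> w \<in> D"
    using exists_homogeneous_initial_segment[OF sat A(1) infinitesimal_imp_large_inverse[OF inf]] by metis
  define I where "I = {z. infinitely_large z \<and> z \<le> y}"
  have yI: "y \<in> I" using y by (simp add: I_def)
  have I_H: "z \<in> carrier H" if "z \<in> I" for z
    using that y(2) infinitely_large_pos[of z] eps_less_1 by (auto simp: I_def carrier_H)
  have same: "z \<in> S \<longleftrightarrow> w \<in> S" if "z \<in> I" "w \<in> I" for z w
    unfolding A(3) using hom[OF A(2)] that by (auto simp: I_def)
  show ?thesis
  proof (cases "S \<inter> I = {}")
    case False
    show ?thesis
    proof (cases "u = 1")
      case True
      thus ?thesis using subgroup.one_closed[OF sub] by (simp add: one_H)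
    next
      case u1: False
      define z where "z = y / u"
      have "y > 0" using infinitely_large_pos[OF y(1)] by simp
      have zy: "z < y" using u u1 \<open>y > 0\<close> by (simp add: z_def field_simps)
      hence z: "z \<in> I" using infinitely_large_divide[OF y(1), of u n] u by (simp add: I_def z_def)
      hence "y \<in> S" "z \<in> S" using False same yI by blast+
      hence "y \<otimes>\<^bsub>H\<^esub> inv\<^bsub>H\<^esub> z \<in> S"
        using sub by (simp add: subgroup.m_closed subgroup.m_inv_closed)
      moreover have "1 \<le> z" using z infinitely_large_pos[of z] by (simp add: I_def)
      hence "y \<otimes>\<^bsub>H\<^esub> inv\<^bsub>H\<^esub> z = y / z" using zy I_H[OF yI] I_H[OF z] by (intro mult_inv_H)
      moreover have "y / z = u" using \<open>y > 0\<close> u(1) unfolding z_def by auto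
      ultimately show ?thesis by (simp only:)
    qed
  next
    case disj: True
    define \<C> where "\<C> = {C \<in> rcosets\<^bsub>H\<^esub> S. C \<inter> I \<noteq> {}}"
    define r where "r = (\<lambda>C. SOME w. w \<in> C \<inter> I)"
    have r: "r C \<in> C \<inter> I" if "C \<in> \<C>" for C
      unfolding r_def by (rule someI_ex) (use that in \<open>auto simp: \<C>_def\<close>)
    \<comment> \<open>Bounded index enters here: the representatives become parameters of a
      saturation argument, so there must be fewer of them than elements of the field.\<close>
    have "r ` \<C> \<lesssim> \<C>" by (rule image_lepoll)
    also have "\<C> \<lesssim> rcosets\<^bsub>H\<^esub> S" by (rule subset_imp_lepoll) (auto simp: \<C>_def)
    finally have small: "r ` \<C> \<prec> (UNIV :: 'a set)" using idx lesspoll_trans1 by blast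
    have coset: "S #>\<^bsub>H\<^esub> z \<in> \<C>" if "z \<in> I" for z
      using that I_H[OF that] H.rcosetsI[OF subgroup.subset[OF sub]] H.rcos_self[OF _ sub]
      by (auto simp: \<C>_def)
    \<comment> \<open>Each representative \<open>w\<close> is infinite, so \<open>z * z < w\<close>
      holds at all natural numbers. Squaring leaves an infinite quotient
      \<open>w / z\<close>.\<close>
    have "\<exists>z. infinitely_large z \<and> (\<forall>Q\<in>(\<lambda>w z. z * z < w) ` (r ` \<C>). Q z)"
    proof (rule saturated_realize_above_nat[OF sat small])
      fix Q assume "Q \<in> (\<lambda>w z. z * z < w) ` (r ` \<C>)"
      then obtain w where w: "w \<in> r ` \<C>" "Q = (\<lambda>z. z * z < w)" by blast
      show "dform (r ` \<C>) (\<lambda>e. Q (e 0))" unfolding w(2) using w(1) by (intro dform_intros)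
      have "infinitely_large w" using w(1) r by (auto simp: I_def)
      thus "\<exists>m. \<forall>n\<ge>m. Q (of_nat n)" unfolding w(2) infinitely_large_def by (metis of_nat_mult)
    qed
    then obtain z where z: "infinitely_large z" "\<And>C. C \<in> \<C> \<Longrightarrow> z * z < r C"
      unfolding ball_simps by auto
    have z1: "1 < z" using infinitely_large_pos[OF z(1)] .
    hence zz: "z < z * z" using mult_strict_right_mono[of 1 z z] by simp
    have "z \<le> y" using z(2)[OF coset[OF yI]] r[OF coset[OF yI]] zz by (auto simp: I_def)
    hence zI: "z \<in> I" using z(1) by (simp add: I_def)
    define w where "w = r (S #>\<^bsub>H\<^esub> z)"
    have w: "w \<in> S #>\<^bsub>H\<^esub> z" "w \<in> I" "z * z < w"
      using r[OF coset[OF zI]] z(2)[OF coset[OF zI]] by (auto simp: w_def)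
    then obtain s where s: "s \<in> S" "w = s \<otimes>\<^bsub>H\<^esub> z" by (auto simp: r_coset_def)
    have sH: "s \<in> carrier H" using s(1) subgroup.mem_carrier[OF sub] by blast
    have "s = w \<otimes>\<^bsub>H\<^esub> inv\<^bsub>H\<^esub> z"
      using H.inv_solve_right'[of w s z] H.inv_solve_right[of s w z] s(2) sH I_H[OF w(2)] I_H[OF zI] by blast
    also have "\<dots> = w / z" using less_trans[OF zz w(3)] z1 I_H[OF w(2)] I_H[OF zI] by (intro mult_inv_H) auto
    finally have s_eq: "s = w / z" .
    \<comment> \<open>The quotient is squeezed between the infinite \<open>z\<close> and
      \<open>w\<close>, hence is a member of \<open>I\<close>, although it belongs to
      \<open>S\<close>.\<close>
    have "z < s" using w(3) z1 by (simp add: s_eq pos_less_divide_eq)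
    moreover have "s \<le> w" using z1 less_trans[OF zz w(3)] by (simp add: s_eq pos_divide_le_eq)
    ultimately have "s \<in> I" using z(1) w(2) infinitely_large_mono[of z s] by (auto simp: I_def)
    thus ?thesis using disj s(1) by blast
  qed
qed

lemma finite_units_subset_bounded_subgroup:
  fixes \<epsilon> :: "'a::real_closed_field"
  assumes sat: "saturated_field TYPE('a)" and inf: "infinitesimal \<epsilon>"
    and S: "tdef_bounded_subgroup definable_line (trunc_group \<epsilon>) S"
  shows "finite_units \<subseteq> S"
proof
  interpret infinitesimal \<epsilon> by (rule inf)
  fix u :: 'a assume "u \<in> finite_units"
  then obtain n where u: "0 < u" "u \<le> of_nat n" "1 \<le> of_nat n * u" by (auto simp: finite_units_def)
  have sub: "subgroup S H" using S by (simp add: tdef_bounded_subgroup_def)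
  note S_mem = bounded_subgroup_contains_finite[OF sat inf S]
  show "u \<in> S"
  proof (cases "1 \<le> u")
    case True
    thus ?thesis using S_mem u(2) by blast
  next
    case False
    have "1 / u \<le> of_nat n" "1 \<le> 1 / u" using u False by (auto simp: field_simps)
    hence v: "1 / u \<in> S" by (intro S_mem)
    have "inv\<^bsub>H\<^esub> (1 / u) = u"
    proof -
      have "1 / u \<noteq> \<epsilon>" using \<open>1 \<le> 1 / u\<close> eps_less_1 by auto
      thus ?thesis using inv_H[of "1 / u"] subgroup.mem_carrier[OF sub v] u(1) by simp
    qed
    thus ?thesis using subgroup.m_inv_closed[OF sub v] by simp
  qed
qed

section \<open>Collinear points on the curve\<close>

context infinitesimal
begin

definition on_curve :: "'a \<Rightarrow> 'a \<Rightarrow> bool" where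
  "on_curve x y \<longleftrightarrow> y\<^sup>2 = x * (x + 1) * (x + \<epsilon>)"

text \<open>
  The line $y = mx + b$ meets the curve in three points with these abscissae; the last three
  equations are Vieta's formulas for $x(x+1)(x+\varepsilon) - (mx+b)^2$.
\<close>

definition line_meets :: "'a \<Rightarrow> 'a \<Rightarrow> 'a \<Rightarrow> 'a \<Rightarrow> 'a \<Rightarrow> 'a \<Rightarrow> 'a \<Rightarrow> 'a \<Rightarrow> bool" where
  "line_meets m b x1 y1 x2 y2 x3 y3 \<longleftrightarrow> y1 = m * x1 + b \<and> y2 = m * x2 + b \<and> y3 = m * x3 + b \<and>
     x1 + x2 + x3 = m\<^sup>2 - 1 - \<epsilon> \<and> x1 * x2 + x1 * x3 + x2 * x3 = \<epsilon> - 2 * m * b \<and>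
     x1 * x2 * x3 = b\<^sup>2"

text \<open>Vieta's formulas count intersections with multiplicity, so tangents are included and the
  relation is symmetric in the three points.\<close>

definition collinear :: "'a \<Rightarrow> 'a \<Rightarrow> 'a \<Rightarrow> 'a \<Rightarrow> 'a \<Rightarrow> 'a \<Rightarrow> bool" where
  "collinear x1 y1 x2 y2 x3 y3 \<longleftrightarrow> (\<exists>m b. line_meets m b x1 y1 x2 y2 x3 y3)"

lemma collinear_swap12: "collinear x1 y1 x2 y2 x3 y3 \<Longrightarrow> collinear x2 y2 x1 y1 x3 y3"
  unfolding collinear_def line_meets_def by (simp add: ac_simps)

lemma collinear_swap23: "collinear x1 y1 x2 y2 x3 y3 \<Longrightarrow> collinear x1 y1 x3 y3 x2 y2"
  unfolding collinear_def line_meets_def by (simp add: ac_simps)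

lemma collinear_neg: "collinear x1 y1 x2 y2 x3 y3 \<Longrightarrow> collinear x1 (- y1) x2 (- y2) x3 (- y3)"
  unfolding collinear_def
proof (elim exE)
  fix m b assume "line_meets m b x1 y1 x2 y2 x3 y3"
  hence "line_meets (- m) (- b) x1 (- y1) x2 (- y2) x3 (- y3)" by (simp add: line_meets_def)
  thus "\<exists>m b. line_meets m b x1 (- y1) x2 (- y2) x3 (- y3)" by blast
qed

lemma line_meetsD:
  assumes "line_meets m b x1 y1 x2 y2 x3 y3"
  shows "y1 = m * x1 + b" "y2 = m * x2 + b" "y3 = m * x3 + b"
    "m\<^sup>2 = x1 + x2 + x3 + 1 + \<epsilon>" "2 * m * b = \<epsilon> - (x1 * x2 + x1 * x3 + x2 * x3)" "b\<^sup>2 = x1 * x2 * x3"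
  using assms by (auto simp: line_meets_def)

lemma line_meets_on_curve:
  assumes "line_meets m b x1 y1 x2 y2 x3 y3"
  shows "on_curve x1 y1"
proof -
  note e = line_meetsD[OF assms]
  have "y1\<^sup>2 = m\<^sup>2 * x1\<^sup>2 + (2 * m * b) * x1 + b\<^sup>2"
    unfolding e(1) by (simp add: power2_eq_square algebra_simps)
  thus ?thesis unfolding on_curve_def e(4-6) by (simp add: power2_eq_square algebra_simps)
qed

lemma collinear_on_curve:
  assumes "collinear x1 y1 x2 y2 x3 y3"
  shows "on_curve x1 y1" "on_curve x2 y2" "on_curve x3 y3"
  using assms line_meets_on_curve collinear_swap12 collinear_swap23 unfolding collinear_def by meson+

lemma on_curve_zero_iff: "on_curve x y \<Longrightarrow> 0 \<le> x \<Longrightarrow> y = 0 \<longleftrightarrow> x = 0"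
  using eps_pos unfolding on_curve_def
  by (metis add_nonneg_pos mult_eq_0_iff order_less_irrefl power2_eq_iff zero_eq_power2 zero_less_one)

text \<open>The product of the abscissae is the square \<open>b^2\<close>, which settles the case of
  positive \<open>x1 * x2\<close>. Otherwise \<open>b = 0\<close> and the second formula reads
  \<open>(x1 + x2) * x3 = \<epsilon>\<close>.\<close>

lemma collinear_nonneg:
  assumes "collinear x1 y1 x2 y2 x3 y3" "0 \<le> x1" "0 \<le> x2"
  shows "0 \<le> x3"
proof -
  obtain m b where l: "line_meets m b x1 y1 x2 y2 x3 y3" using assms(1) by (auto simp: collinear_def)
  have p: "x1 * x2 * x3 = b\<^sup>2" and s: "x1 * x2 + x1 * x3 + x2 * x3 = \<epsilon> - 2 * m * b"
    using l by (auto simp: line_meets_def)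
  show ?thesis
  proof (cases "x1 * x2 = 0")
    case True
    hence "b\<^sup>2 = 0" using p by auto
    hence "b = 0" by simp
    hence "(x1 + x2) * x3 = \<epsilon>" using s True by (simp add: algebra_simps)
    thus ?thesis using eps_pos assms(2,3) by (metis add_nonneg_nonneg linorder_not_le mult_nonneg_nonpos order_less_imp_le)
  next
    case False
    hence "x1 * x2 > 0" using assms(2,3) by (simp add: order_less_le)
    thus ?thesis using p by (metis zero_le_mult_iff zero_le_power2 order_less_le linorder_not_less)
  qed
qed

lemma ell_add_collinear:
  assumes "on_curve x1 y1" "on_curve x2 y2" "\<not> (x1 = x2 \<and> y1 = - y2)"
    and add: "ell_add \<epsilon> (Some (x1, y1)) (Some (x2, y2)) = Some (x3, y3)"
  shows "collinear x1 y1 x2 y2 x3 (- y3)"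
proof -
  define m where "m = (if x1 = x2 then (3 * x1\<^sup>2 + 2 * (1 + \<epsilon>) * x1 + \<epsilon>) / (2 * y1) else (y2 - y1) / (x2 - x1))"
  define b where "b = y1 - m * x1"
  have x3: "x3 = m\<^sup>2 - (1 + \<epsilon>) - x1 - x2" and y3: "y3 = m * (x1 - x3) - y1"
    using add assms(3) unfolding m_def by (auto simp: Let_def)
  \<comment> \<open>A formula for the slope that is common to chord and tangent and symmetric in the
    two points; the second Vieta formula is read off from it.\<close>
  have key: "m * (y1 + y2) = x1\<^sup>2 + x1 * x2 + x2\<^sup>2 + (1 + \<epsilon>) * (x1 + x2) + \<epsilon>" and y2: "y2 = m * x2 + b"
  proof -
    have "m * (y1 + y2) = x1\<^sup>2 + x1 * x2 + x2\<^sup>2 + (1 + \<epsilon>) * (x1 + x2) + \<epsilon> \<and> y2 = m * x2 + b"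
    proof (cases "x1 = x2")
      case True
      have "y1\<^sup>2 = y2\<^sup>2" using assms(1,2) True by (simp add: on_curve_def)
      hence y: "y2 = y1" "y1 \<noteq> 0" using assms(3) True by (auto simp: power2_eq_iff)
      have "m * (2 * y1) = 3 * x1\<^sup>2 + 2 * (1 + \<epsilon>) * x1 + \<epsilon>" using True y by (simp add: m_def)
      thus ?thesis using True y by (simp add: b_def algebra_simps power2_eq_square)
    next
      case False
      have m: "m * (x2 - x1) = y2 - y1" using False by (simp add: m_def)
      have "(x2 - x1) * (m * (y1 + y2)) = (x2 - x1) * (x1\<^sup>2 + x1 * x2 + x2\<^sup>2 + (1 + \<epsilon>) * (x1 + x2) + \<epsilon>)"
      proof -
        have "(x2 - x1) * (m * (y1 + y2)) = (m * (x2 - x1)) * (y1 + y2)" by (simp add: mult_ac)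
        also have "\<dots> = y2\<^sup>2 - y1\<^sup>2" unfolding m by (simp add: power2_eq_square algebra_simps)
        finally show ?thesis
          using assms(1,2) unfolding on_curve_def by (simp add: power2_eq_square algebra_simps)
      qed
      hence "m * (y1 + y2) = x1\<^sup>2 + x1 * x2 + x2\<^sup>2 + (1 + \<epsilon>) * (x1 + x2) + \<epsilon>"
        using False by (simp only: mult_cancel_left right_minus_eq) auto
      moreover have "y2 = m * x2 + b" using m by (simp add: b_def algebra_simps)
      ultimately show ?thesis ..
    qed
    thus "m * (y1 + y2) = x1\<^sup>2 + x1 * x2 + x2\<^sup>2 + (1 + \<epsilon>) * (x1 + x2) + \<epsilon>" "y2 = m * x2 + b" by auto
  qed
  have y1: "y1 = m * x1 + b" by (simp add: b_def)
  have e2: "x1 * x2 + x1 * x3 + x2 * x3 = \<epsilon> - 2 * m * b"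
  proof -
    have "m * (y1 + y2) = m\<^sup>2 * (x1 + x2) + 2 * m * b"
      unfolding y2 b_def by (simp add: power2_eq_square algebra_simps)
    thus ?thesis using key unfolding x3 by (simp add: power2_eq_square algebra_simps)
  qed
  have "x1 * x2 * x3 = b\<^sup>2"
  proof -
    have m2: "m\<^sup>2 = x1 + x2 + x3 + 1 + \<epsilon>" using x3 by simp
    have mb: "2 * m * b = \<epsilon> - (x1 * x2 + x1 * x3 + x2 * x3)" using e2 by simp
    have "y1\<^sup>2 = (m * x1 + b)\<^sup>2" by (simp add: b_def)
    also have "\<dots> = m\<^sup>2 * x1\<^sup>2 + (2 * m * b) * x1 + b\<^sup>2"
      by (simp add: power2_eq_square algebra_simps)
    finally have "y1\<^sup>2 = (x1 + x2 + x3 + 1 + \<epsilon>) * x1\<^sup>2 + (\<epsilon> - (x1 * x2 + x1 * x3 + x2 * x3)) * x1 + b\<^sup>2"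
      unfolding m2 mb .
    thus ?thesis using assms(1) unfolding on_curve_def by (simp add: power2_eq_square algebra_simps)
  qed
  moreover have "- y3 = m * x3 + b" unfolding y3 b_def by (simp add: algebra_simps)
  moreover have "x1 + x2 + x3 = m\<^sup>2 - 1 - \<epsilon>" using x3 by simp
  ultimately have "line_meets m b x1 y1 x2 y2 x3 (- y3)"
    unfolding line_meets_def using y1 y2 e2 by blast
  thus ?thesis unfolding collinear_def by blast
qed

lemma collinear_ell_add:
  assumes "collinear x1 y1 x2 y2 x3 y3" "0 \<le> x1" "0 \<le> x2"
  shows "ell_add \<epsilon> (Some (x1, y1)) (Some (x2, y2)) = Some (x3, - y3)"
proof -
  obtain m b where l: "line_meets m b x1 y1 x2 y2 x3 y3" using assms(1) by (auto simp: collinear_def)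
  note e = l[unfolded line_meets_def]
  \<comment> \<open>Opposite points on a line that is not vertical would both be (0, 0), and then
    the second Vieta formula would give \<open>\<epsilon> = 0\<close>.\<close>
  have nd: "\<not> (x1 = x2 \<and> y1 = - y2)"
  proof
    assume *: "x1 = x2 \<and> y1 = - y2"
    hence y: "y1 = 0" using e by auto
    hence "x1 = 0" using on_curve_zero_iff[OF collinear_on_curve(1)[OF assms(1)] assms(2)] by simp
    hence "\<epsilon> = 0" using e y * by auto
    thus False using eps_pos by simp
  qed
  have m: "(if x1 = x2 then (3 * x1\<^sup>2 + 2 * (1 + \<epsilon>) * x1 + \<epsilon>) / (2 * y1) else (y2 - y1) / (x2 - x1)) = m"
  proof (cases "x1 = x2")
    case True
    hence "y1 = y2" using e by simp
    hence "y1 \<noteq> 0" using nd True by auto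
    moreover have "3 * x1\<^sup>2 + 2 * (1 + \<epsilon>) * x1 + \<epsilon> = m * (2 * y1)"
    proof -
      have "m * (2 * y1) = 2 * m\<^sup>2 * x1 + 2 * m * b"
        unfolding line_meetsD(1)[OF l] by (simp add: power2_eq_square algebra_simps)
      thus ?thesis unfolding line_meetsD(4,5)[OF l] using True by (simp add: power2_eq_square algebra_simps)
    qed
    ultimately show ?thesis using True by simp
  next
    case False
    have "y2 - y1 = m * (x2 - x1)" using e by (simp add: algebra_simps)
    thus ?thesis using False by simp
  qed
  have x3: "x3 = m\<^sup>2 - (1 + \<epsilon>) - x1 - x2" using e by (simp add: algebra_simps)
  have y3: "m * (x1 - x3) - y1 = - y3" using e by (simp add: algebra_simps)
  show ?thesis using nd m x3 y3 by (simp add: Let_def)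
qed

section \<open>Size estimates\<close>

definition clamp :: "'a \<Rightarrow> 'a" where
  "clamp x = max \<epsilon> (min 1 x)"

text \<open>The map \<open>f_star\<close> before reduction into the carrier: they differ only for
  \<open>x \<le> \<epsilon>\<close> and \<open>0 \<le> y\<close>, where
  \<open>1 / \<epsilon>\<close> takes the place of \<epsilon>. Without reduction, size estimates
  read as ordinary products.\<close>

definition gval :: "'a \<Rightarrow> 'a \<Rightarrow> 'a" where
  "gval x y = (if 0 \<le> y then inverse (clamp x) else clamp x)"

lemma clamp_pos: "0 < clamp x"
  using eps_pos by (simp add: clamp_def less_max_iff_disj)

lemma clamp_mono: "x \<le> y \<Longrightarrow> clamp x \<le> clamp y"
  unfolding clamp_def by (intro max.mono min.mono) auto

lemma clamp_ge: "\<epsilon> \<le> clamp x"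
  by (simp add: clamp_def)

text \<open>The substitution of \<epsilon>/x for x is translation by the 2-torsion point (0, 0) on
  abscissae; it reverses the scale from \<epsilon> to 1.\<close>

lemma clamp_reflect:
  assumes "0 < x"
  shows "clamp (\<epsilon> / x) = \<epsilon> / clamp x"
proof -
  consider "x \<le> \<epsilon>" | "\<epsilon> < x" "x < 1" | "1 \<le> x" by force
  thus ?thesis
  proof cases
    case 1
    have "1 \<le> \<epsilon> / x" using 1 assms by simp
    moreover have "clamp x = \<epsilon>" using 1 eps_less_1 by (simp add: clamp_def)
    ultimately show ?thesis using eps_pos eps_less_1 by (simp add: clamp_def)
  next
    case 2
    have "\<epsilon> / x \<le> 1" "\<epsilon> \<le> \<epsilon> / x" using 2 eps_pos by (auto simp: field_simps)
    moreover have "clamp x = x" using 2 by (simp add: clamp_def)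
    ultimately show ?thesis by (simp add: clamp_def)
  next
    case 3
    have "\<epsilon> / x \<le> \<epsilon>" using 3 eps_pos by (simp add: field_simps)
    moreover have "clamp x = 1" using 3 eps_less_1 by (simp add: clamp_def)
    ultimately show ?thesis using eps_less_1 by (simp add: clamp_def)
  qed
qed

lemma clamp_le_times:
  assumes "x2 \<le> 2 * \<epsilon> \<or> x2 \<le> 64 * x3"
  shows "clamp x2 \<le> 64 * clamp x3"
proof -
  have "\<epsilon> \<le> clamp x3" using clamp_ge .
  moreover have "x3 \<le> clamp x3 \<or> 1 \<le> clamp x3" by (auto simp: clamp_def le_max_iff_disj min_def)
  moreover have "clamp x2 = \<epsilon> \<or> clamp x2 \<le> x2" "clamp x2 \<le> 1"
    using eps_less_1 by (auto simp: clamp_def)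
  ultimately show ?thesis using assms eps_pos by linarith
qed

text \<open>For two points with positive ordinates, \<open>(z - \<epsilon>)^2 / W\<close> is the
  third abscissa, with \<open>W\<close> known up to a factor 2. The constant is 64 = 4 * 16:
  \<open>z^2 \<le> 4 * (z - \<epsilon>)^2\<close> once \<open>2 * \<epsilon> \<le> z\<close>, and
  \<open>W \<le> 2 * D\<close> is at most 16 times the monomial comparable to \<open>D\<close>. For
  \<open>z\<close> near \<epsilon> the numerator may be tiny, which clamping at \<epsilon>
  absorbs.\<close>

lemma clamp_estimate:
  assumes x: "0 < x1" "0 < x2" and z: "z = x1 * x2" "\<epsilon> < z"
    and D: "D = z * (x1 + x2) + 2 * (1 + \<epsilon>) * z + \<epsilon> * (x1 + x2)"
    and W: "D \<le> W" "W \<le> 2 * D" and x3: "0 \<le> x3" "x3 * W = (z - \<epsilon>)\<^sup>2"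
  shows "clamp x3 \<le> clamp x1 * clamp x2 \<and> clamp x1 * clamp x2 \<le> 64 * clamp x3"
  using assms
proof (induction x2 x1 rule: linorder_wlog)
  case (sym a b)
  thus ?case by (simp add: mult.commute add.commute)
next
  case (le x2 x1)
  note x = le.prems(1,2) and z = le.prems(3,4) and D = le.prems(5) and W = le.prems(6,7)
    and x3 = le.prems(8,9)
  have z0: "0 < z" using z(2) eps_pos by simp
  have up: "(z - \<epsilon>)\<^sup>2 \<le> z\<^sup>2" using z(2) eps_pos by (intro power_mono) auto
  have lo: "z\<^sup>2 \<le> 4 * (z - \<epsilon>)\<^sup>2" if "2 * \<epsilon> \<le> z"
  proof -
    have "z\<^sup>2 \<le> (2 * (z - \<epsilon>))\<^sup>2" using that z0 by (intro power_mono) auto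
    thus ?thesis unfolding power_mult_distrib by simp
  qed
  have ez: "2 * (1 + \<epsilon>) * z \<le> 4 * z" using eps_less_1 z0 by (intro mult_right_mono) auto
  \<comment> \<open>If the larger abscissa \<open>x1\<close> is at most 1, then \<open>D\<close> is
    comparable to \<open>z\<close> and \<open>x3\<close> to \<open>z\<close>. Otherwise
    \<open>z * x1\<close> dominates and \<open>x3\<close> is comparable to the smaller abscissa
    \<open>x2\<close>, apart from values near \<epsilon>.\<close>
  show ?case
  proof (cases "x1 \<le> 1")
    case True
    have x2: "x2 \<le> 1" using True le.hyps by simp
    have zx: "z \<le> x1" "z \<le> x2"
      using mult_left_mono[OF x2, of x1] mult_right_mono[OF True, of x2] x z(1) by auto
    have c: "clamp x1 * clamp x2 = z" using True x2 zx z by (simp add: clamp_def)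
    have "z \<le> 1" using zx True by simp
    have "0 \<le> z * (x1 + x2)" "0 \<le> \<epsilon> * (x1 + x2)" "2 * z \<le> 2 * (1 + \<epsilon>) * z"
      using x z0 eps_pos by (auto simp: algebra_simps)
    hence D1: "2 * z \<le> D" using D by linarith
    have "z * (x1 + x2) \<le> z * 2" "\<epsilon> * (x1 + x2) \<le> \<epsilon> * 2"
      using True x2 z0 eps_pos by (auto intro!: mult_left_mono)
    hence D2: "D \<le> 8 * z" using D ez z(2) by linarith
    have "x3 * (2 * z) \<le> x3 * W" using D1 W x3 by (intro mult_left_mono) auto
    hence "x3 * (2 * z) \<le> z * z" using x3(2) up by (simp add: power2_eq_square)
    hence "(2 * x3) * z \<le> z * z" by (simp add: algebra_simps)
    hence "2 * x3 \<le> z" using z0 by (simp add: mult_le_cancel_right)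
    hence "clamp x3 \<le> z" using z x3 by (auto simp: clamp_def)
    moreover have "clamp z \<le> 64 * clamp x3"
    proof (cases "z \<le> 2 * \<epsilon>")
      case False
      have "x3 * W \<le> x3 * (16 * z)" using D2 W x3 by (intro mult_left_mono) auto
      hence "z * z \<le> 64 * x3 * z" using lo False x3(2) by (simp add: power2_eq_square)
      hence "z \<le> 64 * x3" using z0 by (simp add: mult_le_cancel_right)
      thus ?thesis by (intro clamp_le_times) auto
    qed (auto intro: clamp_le_times)
    moreover have "clamp z = z" using z(2) \<open>z \<le> 1\<close> by (simp add: clamp_def)
    ultimately show ?thesis using c by simp
  next
    case False
    hence c: "clamp x1 * clamp x2 = clamp x2" using eps_less_1 by (simp add: clamp_def)
    have zx: "z * x1 > 0" using z0 x by simp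
    have "0 \<le> z * x2" "0 \<le> \<epsilon> * (x1 + x2)" "0 \<le> 2 * (1 + \<epsilon>) * z"
      using x z0 eps_pos by auto
    hence "z * x1 \<le> D" using D by (simp add: distrib_left)
    hence "x3 * (z * x1) \<le> x3 * W" using W x3 by (intro mult_left_mono) auto
    hence "x3 * (z * x1) \<le> x2 * (z * x1)" using x3(2) up z(1) by (simp add: power2_eq_square algebra_simps)
    hence "x3 \<le> x2" using zx by (simp add: mult_le_cancel_right)
    hence "clamp x3 \<le> clamp x2" by (rule clamp_mono)
    moreover have "clamp x2 \<le> 64 * clamp x3"
    proof (cases "x2 \<le> 2 * \<epsilon>")
      case True
      thus ?thesis by (intro clamp_le_times) auto
    next
      case x2: False
      have x2z: "x2 \<le> z" using mult_right_mono[of 1 x1 x2] False x z(1) by simp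
      have zz: "z \<le> z * x1" using mult_left_mono[of 1 x1 z] False z0 by simp
      have "z * (x1 + x2) \<le> z * (2 * x1)" using le.hyps z0 by (intro mult_left_mono) auto
      moreover have "\<epsilon> * (x1 + x2) \<le> x2 * (2 * x1)" using le.hyps x2 x eps_pos by (intro mult_mono) auto
      hence "\<epsilon> * (x1 + x2) \<le> 2 * z" using z(1) by (simp add: mult_ac)
      ultimately have "D \<le> 8 * (z * x1)" using D ez zz by linarith
      hence "x3 * W \<le> x3 * (16 * (z * x1))" using W x3 by (intro mult_left_mono) auto
      moreover have "z\<^sup>2 \<le> 4 * (x3 * W)" using lo x2 x2z x3(2) by simp
      ultimately have "z * z \<le> 64 * x3 * (z * x1)" by (simp add: power2_eq_square algebra_simps)
      hence "x2 * (z * x1) \<le> 64 * x3 * (z * x1)" using z(1) by (simp add: algebra_simps)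
      hence "x2 \<le> 64 * x3" using zx by (simp add: mult_le_cancel_right)
      thus ?thesis by (intro clamp_le_times) auto
    qed
    ultimately show ?thesis unfolding c by blast
  qed
qed

section \<open>The product formula for collinear points\<close>

lemma finite_units_ratio:
  assumes "0 < a" "0 < b" "a \<le> b" "b \<le> 64 * a"
  shows "a * inverse b \<in> finite_units"
  by (rule finite_unitsI[of _ 64]) (use assms in \<open>auto simp: field_simps\<close>)

lemma finite_units_ratio':
  assumes "0 < a" "0 < b" "a \<le> b" "b \<le> 64 * a"
  shows "b * inverse a \<in> finite_units"
  by (rule finite_unitsI[of _ 64]) (use assms in \<open>auto simp: field_simps\<close>)

text \<open>Collinear points add up to O, so this is the homomorphism property of
  \<open>gval\<close>. The identity \<open>b * Y = z * (\<epsilon> - z)\<close> ties the sign of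
  \<open>b\<close>, and through it that of \<open>y3\<close>, to the position of
  \<open>z = x1 * x2\<close> relative to \<epsilon>; at \<open>z = \<epsilon>\<close> the third
  point is (0, 0).\<close>

lemma gval_prod_line:
  assumes l: "line_meets m b x1 y1 x2 y2 x3 y3" and x: "0 \<le> x1" "0 \<le> x2" and y: "0 \<le> y1" "0 \<le> y2"
  shows "gval x1 y1 * gval x2 y2 * gval x3 y3 \<approx>\<^sub>\<epsilon> 1"
proof -
  have col: "collinear x1 y1 x2 y2 x3 y3" using l by (auto simp: collinear_def)
  note oc = collinear_on_curve[OF col]
  have x3: "0 \<le> x3" using collinear_nonneg[OF col x] .
  note e = l[unfolded line_meets_def]
  have c0: "clamp 0 = \<epsilon>" using eps_pos by (simp add: clamp_def)
  have q1: "inverse \<epsilon> * inverse \<epsilon> = qpow (- 1)"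
    using eps_pos unfolding qpow_minus qpow_1 by (simp add: power2_eq_square)
  have g12: "gval x1 y1 = inverse (clamp x1)" "gval x2 y2 = inverse (clamp x2)"
    using y by (auto simp: gval_def)
  have refl: "gval u v * gval w t = inverse \<epsilon>" if "u * w = \<epsilon>" "0 \<le> v" "0 \<le> t" "0 \<le> u" for u v w t
  proof -
    have "u > 0" using that eps_pos by (cases "u = 0") auto
    hence "w = \<epsilon> / u" using that by (simp add: field_simps)
    hence "clamp w = \<epsilon> / clamp u" using clamp_reflect \<open>u > 0\<close> by simp
    thus ?thesis using that clamp_pos[of u] by (simp add: gval_def field_simps)
  qed
  have zero: "gval u v * gval w t * gval r s \<approx>\<^sub>\<epsilon> 1"
    if "u * w = \<epsilon>" "0 \<le> v" "0 \<le> t" "0 \<le> u" "r = 0" "0 \<le> s" for u v w t r s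
  proof -
    have "gval u v * gval w t * gval r s = 1 * 1 * qpow (- 1)"
      using refl[OF that(1-4)] q1 that(5,6) c0 by (simp add: gval_def)
    thus ?thesis using simI[OF finite_units_1] by metis
  qed
  show ?thesis
  proof (cases "x1 = 0 \<or> x2 = 0")
    \<comment> \<open>The line passes through the 2-torsion point (0, 0), so the other two abscissae
      have product \<epsilon>.\<close>
    case True
    hence b: "b = 0" using e by auto
    have m: "0 \<le> m"
    proof (rule ccontr)
      assume "\<not> 0 \<le> m"
      hence "x1 = 0" "x2 = 0" using e y x b by (auto simp: zero_le_mult_iff)
      thus False using e b eps_pos by simp
    qed
    hence y3: "0 \<le> y3" using e b x3 by simp
    from True show ?thesis
    proof
      assume x1: "x1 = 0"
      hence "x2 * x3 = \<epsilon>" using e b by simp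
      hence "gval x2 y2 * gval x3 y3 * gval x1 y1 \<approx>\<^sub>\<epsilon> 1" using zero x y y3 x1 by blast
      thus ?thesis by (simp add: mult_ac)
    next
      assume x2: "x2 = 0"
      hence "x1 * x3 = \<epsilon>" using e b by simp
      hence "gval x1 y1 * gval x3 y3 * gval x2 y2 \<approx>\<^sub>\<epsilon> 1" using zero x y y3 x2 by blast
      thus ?thesis by (simp add: mult_ac)
    qed
  next
    case False
    hence xp: "0 < x1" "0 < x2" using x by auto
    have yp: "0 < y1" "0 < y2" using on_curve_zero_iff[OF oc(1) x(1)] on_curve_zero_iff[OF oc(2) x(2)] y xp by auto
    define z where "z = x1 * x2"
    define Y where "Y = y1 * x2 + y2 * x1"
    define D where "D = z * (x1 + x2) + 2 * (1 + \<epsilon>) * z + \<epsilon> * (x1 + x2)"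
    have z0: "0 < z" using xp by (simp add: z_def)
    have Y0: "0 < Y" using xp yp by (simp add: Y_def add_pos_pos)
    have bY: "b * Y = z * (\<epsilon> - z)"
    proof -
      have "b * Y = (2 * m * b) * z + b\<^sup>2 * (x1 + x2)"
        unfolding Y_def z_def line_meetsD(1,2)[OF l] by (simp add: power2_eq_square algebra_simps)
      thus ?thesis unfolding line_meetsD(5,6)[OF l] z_def by (simp add: algebra_simps)
    qed
    \<comment> \<open>The quantity \<open>D\<close> is made so that \<open>z * D\<close> is the sum
      of the squares of the two summands of \<open>Y\<close>. Both summands are positive, so
      \<open>Y^2\<close> lies between this sum and its double.\<close>
    have N: "(y1 * x2)\<^sup>2 + (y2 * x1)\<^sup>2 = z * D"
      unfolding power_mult_distrib oc(1,2)[unfolded on_curve_def] z_def D_def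
      by (simp add: power2_eq_square algebra_simps)
    have "Y\<^sup>2 = z * D + 2 * ((y1 * x2) * (y2 * x1))"
      unfolding N[symmetric] Y_def by (simp add: power2_eq_square algebra_simps)
    moreover have "0 \<le> (y1 * x2) * (y2 * x1)" using xp yp by simp
    moreover have "2 * ((y1 * x2) * (y2 * x1)) \<le> z * D"
      unfolding N[symmetric] using sum_squares_bound[of "y1 * x2" "y2 * x1"] by (simp add: mult.assoc)
    ultimately have Y2: "z * D \<le> Y\<^sup>2" "Y\<^sup>2 \<le> z * (2 * D)" by (simp_all add: algebra_simps)
    define W where "W = Y\<^sup>2 / z"
    have W: "D \<le> W" "W \<le> 2 * D" using Y2 z0 by (auto simp: W_def field_simps)
    have b2: "b\<^sup>2 = z * x3" using e by (simp add: z_def)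
    have "z * (x3 * Y\<^sup>2) = z * (z * (z - \<epsilon>)\<^sup>2)"
    proof -
      have "z * (x3 * Y\<^sup>2) = (b * Y)\<^sup>2" unfolding power_mult_distrib b2 by (simp add: mult_ac)
      thus ?thesis unfolding bY by (simp add: power2_eq_square algebra_simps)
    qed
    hence "x3 * Y\<^sup>2 = z * (z - \<epsilon>)\<^sup>2" using z0 by simp
    hence xW: "x3 * W = (z - \<epsilon>)\<^sup>2" using z0 by (simp add: W_def field_simps)
    \<comment> \<open>The product of the ordinates, up to the factor \<open>- m^3\<close>, is the
      value of the cubic at the zero \<open>- b / m\<close> of the line.\<close>
    have ysign: "y1 * y2 * y3 = b * (b - m) * (b - \<epsilon> * m)"
    proof -
      have "y1 * y2 * y3 = m * m * m * (x1 * x2 * x3) + m * m * b * (x1 * x2 + x1 * x3 + x2 * x3)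
          + m * b * b * (x1 + x2 + x3) + b * b * b"
        unfolding line_meetsD(1-3)[OF l] by (simp add: algebra_simps)
      also have "x1 * x2 + x1 * x3 + x2 * x3 = \<epsilon> - 2 * m * b" using e by simp
      also have "x1 + x2 + x3 = m\<^sup>2 - 1 - \<epsilon>" using e by simp
      also have "x1 * x2 * x3 = b\<^sup>2" using e by simp
      finally show ?thesis by (simp add: power2_eq_square algebra_simps)
    qed
    consider "z = \<epsilon>" | "\<epsilon> < z" | "z < \<epsilon>" by force
    thus ?thesis
    proof cases
      case 1
      hence "b = 0" using bY Y0 by simp
      hence "x3 = 0" using b2 z0 by simp
      moreover from this have "y3 = 0" using e \<open>b = 0\<close> by simp
      ultimately show ?thesis using zero[of x1 x2 y1 y2 x3 y3] 1 x y by (simp add: z_def)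
    next
      case 2
      have "b * Y < 0" unfolding bY using 2 z0 by (simp add: mult_less_0_iff)
      hence b: "b < 0" using Y0 by (simp add: mult_less_0_iff)
      have "m * x1 > 0" using e yp b by linarith
      hence m: "m > 0" using xp by (simp add: zero_less_mult_iff)
      have "(b - m) * (b - \<epsilon> * m) > 0" using b m eps_pos
        by (intro mult_neg_neg) (auto intro: less_trans[of b 0] simp: algebra_simps)
      hence "y1 * y2 * y3 < 0" using b mult_neg_pos unfolding ysign mult.assoc[of b] by blast
      hence y3: "y3 < 0" using yp by (simp add: mult_less_0_iff zero_less_mult_iff)
      have "clamp x3 \<le> clamp x1 * clamp x2 \<and> clamp x1 * clamp x2 \<le> 64 * clamp x3"
        by (rule clamp_estimate[OF xp z_def 2 D_def W x3 xW])
      hence "clamp x3 * inverse (clamp x1 * clamp x2) \<in> finite_units"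
        using clamp_pos by (intro finite_units_ratio) (auto simp: zero_less_mult_iff)
      moreover have "gval x1 y1 * gval x2 y2 * gval x3 y3 = 1 * (clamp x3 * inverse (clamp x1 * clamp x2)) * qpow 0"
        using y3 by (simp add: g12 qpow_0) (simp add: gval_def)
      ultimately show ?thesis by (rule simI)
    next
      case 3
      have "b * Y > 0" unfolding bY using 3 z0 by simp
      hence b: "b > 0" using Y0 by (simp add: zero_less_mult_iff)
      have y3: "0 \<le> y3"
      proof (cases "0 \<le> m")
        case True
        thus ?thesis using e b x3 by simp
      next
        case False
        hence "b - m > 0" "b - \<epsilon> * m > 0" using b eps_pos
          by (auto simp: not_le intro: add_pos_pos) (metis diff_gt_0_iff_gt less_trans mult_pos_neg)
        hence "y1 * y2 * y3 > 0" unfolding ysign using b by simp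
        moreover have "y1 * y2 > 0" using yp by simp
        ultimately show ?thesis by (metis mult_pos_neg not_le order_less_asym)
      qed
      \<comment> \<open>Adding the 2-torsion point (0, 0) to both points replaces their abscissae by
        \<epsilon>/x1 and \<epsilon>/x2, leaves the third point as it is, and moves the product
        above \<epsilon>. The factor \<open>r\<close> below is how \<open>D\<close> and
        \<open>W\<close> scale.\<close>
      define z' where "z' = \<epsilon>\<^sup>2 / z"
      define r where "r = (\<epsilon> / z)\<^sup>2"
      have r0: "r > 0" using z0 eps_pos by (simp add: r_def)
      have xp': "0 < \<epsilon> / x1" "0 < \<epsilon> / x2" using xp eps_pos by auto
      have z'1: "z' = (\<epsilon> / x1) * (\<epsilon> / x2)" by (simp add: z'_def z_def power2_eq_square)
      have z'2: "\<epsilon> < z'" using 3 z0 eps_pos by (simp add: z'_def field_simps power2_eq_square)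
      have D': "r * D = z' * (\<epsilon> / x1 + \<epsilon> / x2) + 2 * (1 + \<epsilon>) * z' + \<epsilon> * (\<epsilon> / x1 + \<epsilon> / x2)"
        unfolding D_def r_def z'_def z_def using xp by (simp add: field_simps power2_eq_square)
      have W': "r * D \<le> r * W" "r * W \<le> 2 * (r * D)" using W r0 by (auto simp: mult_left_mono)
      have "x3 * (r * W) = r * (z - \<epsilon>)\<^sup>2" using xW by (simp add: mult_ac)
      also have "\<dots> = (z' - \<epsilon>)\<^sup>2"
        unfolding r_def z'_def using z0 by (simp add: field_simps power2_eq_square)
      finally have xW': "x3 * (r * W) = (z' - \<epsilon>)\<^sup>2" .
      have "clamp x3 \<le> clamp (\<epsilon> / x1) * clamp (\<epsilon> / x2) \<and> clamp (\<epsilon> / x1) * clamp (\<epsilon> / x2) \<le> 64 * clamp x3"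
        by (rule clamp_estimate[OF xp' z'1 z'2 D' W' x3 xW'])
      hence "clamp (\<epsilon> / x1) * clamp (\<epsilon> / x2) * inverse (clamp x3) \<in> finite_units"
        using clamp_pos by (intro finite_units_ratio') (auto simp: zero_less_mult_iff)
      moreover have "gval x1 y1 * gval x2 y2 * gval x3 y3
          = 1 * (clamp (\<epsilon> / x1) * clamp (\<epsilon> / x2) * inverse (clamp x3)) * qpow (- 1)"
        unfolding clamp_reflect[OF xp(1)] clamp_reflect[OF xp(2)] q1[symmetric] g12
        using y3 eps_pos clamp_pos by (simp add: gval_def field_simps)
      ultimately show ?thesis by (rule simI)
    qed
  qed
qed

text \<open>Exact except at (0, 0), which is its own negative; there \<open>1 / \<epsilon>\<close>
  and \<epsilon> agree modulo \<epsilon>^2.\<close>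

lemma gval_uminus:
  assumes "on_curve x y" "0 \<le> x"
  shows "gval x (- y) \<approx>\<^sub>\<epsilon> inverse (gval x y)"
proof (cases "y = 0")
  case True
  hence "x = 0" using on_curve_zero_iff[OF assms] by simp
  hence "clamp x = \<epsilon>" using eps_pos by (simp add: clamp_def)
  moreover have "inverse \<epsilon> = \<epsilon> * qpow (- 1)"
    using eps_pos unfolding qpow_minus qpow_1 by (simp add: power2_eq_square)
  hence "inverse \<epsilon> \<approx>\<^sub>\<epsilon> \<epsilon>" using sim_shift[of \<epsilon> "- 1"] by simp
  ultimately show ?thesis using True by (simp add: gval_def)
next
  case False
  hence "gval x (- y) = inverse (gval x y)" by (auto simp: gval_def)
  thus ?thesis using sim_refl by simp
qed

lemma gval_pos: "0 < gval x y"
  using clamp_pos by (simp add: gval_def)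

text \<open>Two of three ordinates are on the same side of 0. A permutation brings them to the
  front, and negating all points makes them nonnegative if necessary.\<close>

lemma gval_prod_collinear:
  assumes col: "collinear x1 y1 x2 y2 x3 y3" and x: "0 \<le> x1" "0 \<le> x2"
  shows "gval x1 y1 * gval x2 y2 * gval x3 y3 \<approx>\<^sub>\<epsilon> 1"
proof -
  have x3: "0 \<le> x3" using collinear_nonneg[OF col x] .
  have two: "gval u1 v1 * gval u2 v2 * gval u3 v3 \<approx>\<^sub>\<epsilon> 1"
    if "collinear u1 v1 u2 v2 u3 v3" "0 \<le> u1" "0 \<le> u2" "0 \<le> v1" "0 \<le> v2" for u1 v1 u2 v2 u3 v3
    using that gval_prod_line unfolding collinear_def by blast
  have pos: "gval u1 v1 * gval u2 v2 * gval u3 v3 \<approx>\<^sub>\<epsilon> 1"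
    if c: "collinear u1 v1 u2 v2 u3 v3" and u: "0 \<le> u1" "0 \<le> u2" "0 \<le> u3"
      and v: "0 \<le> v1 \<and> 0 \<le> v2 \<or> 0 \<le> v1 \<and> 0 \<le> v3 \<or> 0 \<le> v2 \<and> 0 \<le> v3" for u1 v1 u2 v2 u3 v3
    using v
  proof (elim disjE conjE)
    assume "0 \<le> v1" "0 \<le> v3"
    thus ?thesis using two[OF collinear_swap23[OF c]] u by (simp add: mult_ac)
  next
    assume "0 \<le> v2" "0 \<le> v3"
    thus ?thesis using two[OF collinear_swap23[OF collinear_swap12[OF c]]] u by (simp add: mult_ac)
  qed (use two[OF c] u in blast)
  show ?thesis
  proof (cases "0 \<le> y1 \<and> 0 \<le> y2 \<or> 0 \<le> y1 \<and> 0 \<le> y3 \<or> 0 \<le> y2 \<and> 0 \<le> y3")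
    case True
    thus ?thesis using pos[OF col x x3] by blast
  next
    case False
    note oc = collinear_on_curve[OF col]
    have "gval x1 (- y1) * gval x2 (- y2) * gval x3 (- y3) \<approx>\<^sub>\<epsilon> 1"
      using pos[OF collinear_neg[OF col] x x3] False by auto
    moreover have "inverse (gval x1 y1) * inverse (gval x2 y2) * inverse (gval x3 y3)
        \<approx>\<^sub>\<epsilon> gval x1 (- y1) * gval x2 (- y2) * gval x3 (- y3)"
      by (intro sim_mult sim_sym[OF gval_uminus] oc x x3)
    ultimately have "inverse (gval x1 y1) * inverse (gval x2 y2) * inverse (gval x3 y3) \<approx>\<^sub>\<epsilon> 1"
      using sim_trans by blast
    thus ?thesis using sim_inverse by fastforce
  qed
qed

end

section \<open>The induced map\<close>

context infinitesimal
begin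

abbreviation "G \<equiv> ell_group0 \<epsilon>"

abbreviation ell_neg :: "'a point \<Rightarrow> 'a point" where
  "ell_neg \<equiv> map_option (\<lambda>(x, y). (x, - y))"

lemma carrier_G: "carrier G = {None} \<union> {Some (x, y) |x y. on_curve x y \<and> 0 \<le> x}"
  by (auto simp: ell_group0_def ell_group_def on_curve_def)

lemma mult_G: "P \<otimes>\<^bsub>G\<^esub> Q = ell_add \<epsilon> P Q"
  by (simp add: ell_group0_def ell_group_def)

lemma one_G: "\<one>\<^bsub>G\<^esub> = None"
  by (simp add: ell_group0_def ell_group_def)

lemma carrier_G_cases:
  assumes "P \<in> carrier G"
  obtains "P = None" | x y where "P = Some (x, y)" "on_curve x y" "0 \<le> x"
  using assms unfolding carrier_G by auto

lemma SomeG: "Some (x, y) \<in> carrier G \<longleftrightarrow> on_curve x y \<and> 0 \<le> x"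
  by (auto simp: carrier_G)

lemma NoneG: "None \<in> carrier G"
  by (simp add: carrier_G)

lemma on_curve_neg: "on_curve x (- y) \<longleftrightarrow> on_curve x y"
  by (simp add: on_curve_def)

lemma ell_neg_closed: "P \<in> carrier G \<Longrightarrow> ell_neg P \<in> carrier G"
  by (auto simp: carrier_G on_curve_neg)

lemma ell_add_None_right: "ell_add \<epsilon> P None = P"
  by (cases P) auto

lemma ell_add_eq_None_iff: "ell_add \<epsilon> P Q = None \<longleftrightarrow> Q = ell_neg P"
  by (cases P; cases Q) (auto simp: Let_def split: if_splits)

lemma ell_add_Some_cases:
  assumes "on_curve x1 y1" "0 \<le> x1" "on_curve x2 y2" "0 \<le> x2"
  obtains "x2 = x1" "y2 = - y1" "ell_add \<epsilon> (Some (x1, y1)) (Some (x2, y2)) = None"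
  | x3 y3 where "ell_add \<epsilon> (Some (x1, y1)) (Some (x2, y2)) = Some (x3, y3)"
      "collinear x1 y1 x2 y2 x3 (- y3)" "0 \<le> x3" "on_curve x3 y3"
proof (cases "x1 = x2 \<and> y1 = - y2")
  case True
  thus ?thesis using that(1) by simp
next
  case False
  then obtain x3 y3 where *: "ell_add \<epsilon> (Some (x1, y1)) (Some (x2, y2)) = Some (x3, y3)"
    by (auto simp: Let_def)
  have c: "collinear x1 y1 x2 y2 x3 (- y3)"
    by (rule ell_add_collinear[OF assms(1,3) False *])
  have "on_curve x3 y3" using collinear_on_curve(3)[OF c] by (simp add: on_curve_neg)
  thus ?thesis using that(2)[OF * c] collinear_nonneg[OF c assms(2,4)] by blast
qed

lemma ell_add_closed:
  assumes "P \<in> carrier G" "Q \<in> carrier G"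
  shows "ell_add \<epsilon> P Q \<in> carrier G"
proof (cases P)
  case (Some p)
  obtain x1 y1 where P: "P = Some (x1, y1)" using Some by (cases p) auto
  show ?thesis
  proof (cases Q)
    case None
    thus ?thesis using assms(1) ell_add_None_right by simp
  next
    case (Some q)
    obtain x2 y2 where Q: "Q = Some (x2, y2)" using Some by (cases q) auto
    have oc: "on_curve x1 y1" "0 \<le> x1" "on_curve x2 y2" "0 \<le> x2" using assms by (auto simp: P Q SomeG)
    show ?thesis unfolding P Q
      by (rule ell_add_Some_cases[OF oc]) (auto simp: NoneG SomeG simp del: ell_add.simps)
  qed
qed (use assms in simp)

text \<open>The inverse is a definite description; it is evaluated by the fact that a sum is
  \<open>None\<close> only for opposite points.\<close>

lemma inv_G:
  assumes "P \<in> carrier G"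
  shows "inv\<^bsub>G\<^esub> P = ell_neg P"
proof -
  have n: "P = ell_neg (ell_neg P)" by (cases P) auto
  show ?thesis unfolding m_inv_def mult_G one_G ell_add_eq_None_iff
  proof (rule the_equality)
    show "ell_neg P \<in> carrier G \<and> ell_neg P = ell_neg P \<and> P = ell_neg (ell_neg P)"
      using ell_neg_closed[OF assms] n by blast
  qed blast
qed

text \<open>P, -Q and the negative of P - Q are collinear. Negating and reordering the three points
  expresses P as the sum of P - Q and Q.\<close>

lemma ell_add_neg_cancel:
  assumes "P \<in> carrier G" "Q \<in> carrier G"
  shows "ell_add \<epsilon> (ell_add \<epsilon> P (ell_neg Q)) Q = P"
proof (cases "P = None \<or> Q = None")
  case True
  moreover have "ell_add \<epsilon> (ell_neg Q) Q = None"
    unfolding ell_add_eq_None_iff by (cases Q) auto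
  ultimately show ?thesis by (auto simp: ell_add_None_right)
next
  case False
  then obtain x1 y1 x2 y2 where P: "P = Some (x1, y1)" and Q: "Q = Some (x2, y2)" by auto
  have oc: "on_curve x1 y1" "0 \<le> x1" "on_curve x2 (- y2)" "0 \<le> x2"
    using assms by (auto simp: P Q SomeG on_curve_neg)
  show ?thesis
  proof (rule ell_add_Some_cases[OF oc])
    assume "x2 = x1" "- y2 = - y1" "ell_add \<epsilon> (Some (x1, y1)) (Some (x2, - y2)) = None"
    thus ?thesis by (simp add: P Q)
  next
    fix x3 y3 assume *: "ell_add \<epsilon> (Some (x1, y1)) (Some (x2, - y2)) = Some (x3, y3)"
      "collinear x1 y1 x2 (- y2) x3 (- y3)" "0 \<le> x3" "on_curve x3 y3"
    have "collinear x1 (- y1) x2 y2 x3 y3" using collinear_neg[OF *(2)] by simp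
    hence "collinear x3 y3 x2 y2 x1 (- y1)"
      by (rule collinear_swap12[OF collinear_swap23[OF collinear_swap12]])
    hence "ell_add \<epsilon> (Some (x3, y3)) (Some (x2, y2)) = Some (x1, y1)"
      using collinear_ell_add[of x3 y3 x2 y2 x1 "- y1"] *(3) oc by simp
    thus ?thesis using *(1) by (simp add: P Q del: ell_add.simps)
  qed
qed

section \<open>The map \<open>f_star\<close> as a homomorphism up to finite factors\<close>

lemma f_star_closed:
  assumes "P \<in> carrier G"
  shows "f_star \<epsilon> P \<in> carrier H"
proof -
  have 1: "1 < 1 / \<epsilon>" using eps_pos eps_less_1 by simp
  show ?thesis
  proof (cases rule: carrier_G_cases[OF assms])
    case 1
    thus ?thesis using \<open>1 < 1 / \<epsilon>\<close> eps_less_1 by (simp add: carrier_H)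
  next
    case (2 x y)
    have "\<epsilon> \<le> 1 / x" "1 / x < 1 / \<epsilon>" if "\<epsilon> < x" "x < 1"
    proof -
      have "1 \<le> 1 / x" using that eps_pos by simp
      thus "\<epsilon> \<le> 1 / x" using eps_less_1 by simp
      show "1 / x < 1 / \<epsilon>" using that eps_pos by (simp add: frac_less2)
    qed
    moreover have "x < 1 / \<epsilon>" if "x < 1" using that 1 by simp
    moreover have "\<epsilon> < 1 / \<epsilon>" using eps_less_1 1 by simp
    ultimately show ?thesis unfolding 2(1) using 1 eps_less_1 by (simp add: carrier_H)
  qed
qed

lemma f_star_gval:
  assumes "0 \<le> x"
  shows "f_star \<epsilon> (Some (x, y)) \<approx>\<^sub>\<epsilon> gval x y"
proof -
  have e: "\<epsilon> = inverse \<epsilon> * qpow 1" using eps_pos by (simp add: qpow_1 power2_eq_square)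
  consider "1 \<le> x" | "\<epsilon> < x" "x < 1" | "x \<le> \<epsilon>" by force
  thus ?thesis
  proof cases
    case 1
    hence "clamp x = 1" using eps_less_1 by (simp add: clamp_def)
    thus ?thesis using 1 sim_refl by (simp add: gval_def)
  next
    case 2
    hence "clamp x = x" by (simp add: clamp_def)
    thus ?thesis using 2 sim_refl by (simp add: gval_def inverse_eq_divide)
  next
    case 3
    hence c: "clamp x = \<epsilon>" and x: "\<not> 1 \<le> x" "\<not> \<epsilon> < x" using eps_less_1 by (auto simp: clamp_def)
    have "\<epsilon> \<approx>\<^sub>\<epsilon> inverse \<epsilon>" using sim_shift[of "inverse \<epsilon>" 1] unfolding e[symmetric] .
    thus ?thesis using x sim_refl by (simp add: gval_def c)
  qed
qed

lemma f_star_hom: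
  assumes "P \<in> carrier G" "Q \<in> carrier G"
  shows "f_star \<epsilon> (ell_add \<epsilon> P Q) \<approx>\<^sub>\<epsilon> f_star \<epsilon> P * f_star \<epsilon> Q"
proof (cases "P = None \<or> Q = None")
  case True
  thus ?thesis by (auto simp: ell_add_None_right sim_refl)
next
  case False
  then obtain x1 y1 x2 y2 where P: "P = Some (x1, y1)" and Q: "Q = Some (x2, y2)" by auto
  have oc: "on_curve x1 y1" "0 \<le> x1" "on_curve x2 y2" "0 \<le> x2" using assms by (auto simp: P Q SomeG)
  have PQ: "gval x1 y1 * gval x2 y2 \<approx>\<^sub>\<epsilon> f_star \<epsilon> P * f_star \<epsilon> Q"
    unfolding P Q by (intro sim_mult sim_sym[OF f_star_gval] oc)
  show ?thesis
  proof (rule ell_add_Some_cases[OF oc])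
    assume *: "x2 = x1" "y2 = - y1" "ell_add \<epsilon> (Some (x1, y1)) (Some (x2, y2)) = None"
    have "gval x1 y1 * gval x2 y2 \<approx>\<^sub>\<epsilon> gval x1 y1 * inverse (gval x1 y1)"
      unfolding *(1,2) by (intro sim_mult sim_refl gval_uminus oc)
    also have "gval x1 y1 * inverse (gval x1 y1) = 1" using gval_pos[of x1 y1] by simp
    finally have "1 \<approx>\<^sub>\<epsilon> f_star \<epsilon> P * f_star \<epsilon> Q" using PQ sim_trans sim_sym by blast
    thus ?thesis using *(3) by (simp add: P Q del: ell_add.simps)
  next
    fix x3 y3 assume *: "ell_add \<epsilon> (Some (x1, y1)) (Some (x2, y2)) = Some (x3, y3)"
      "collinear x1 y1 x2 y2 x3 (- y3)" "0 \<le> x3" "on_curve x3 y3"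
    have 1: "gval x1 y1 * gval x2 y2 * gval x3 (- y3) \<approx>\<^sub>\<epsilon> 1"
      by (rule gval_prod_collinear[OF *(2) oc(2,4)])
    have "gval x1 y1 * gval x2 y2 * gval x3 (- y3) \<approx>\<^sub>\<epsilon> gval x1 y1 * gval x2 y2 * inverse (gval x3 y3)"
      by (intro sim_mult sim_refl gval_uminus *(3,4))
    hence "gval x1 y1 * gval x2 y2 * inverse (gval x3 y3) \<approx>\<^sub>\<epsilon> 1"
      using 1 sim_trans sim_sym by blast
    hence "gval x1 y1 * gval x2 y2 * inverse (gval x3 y3) * gval x3 y3 \<approx>\<^sub>\<epsilon> 1 * gval x3 y3"
      by (intro sim_mult sim_refl)
    moreover have "gval x1 y1 * gval x2 y2 * inverse (gval x3 y3) * gval x3 y3 = gval x1 y1 * gval x2 y2"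
      using gval_pos[of x3 y3] by simp
    ultimately have "gval x1 y1 * gval x2 y2 \<approx>\<^sub>\<epsilon> gval x3 y3" by simp
    hence "f_star \<epsilon> (Some (x3, y3)) \<approx>\<^sub>\<epsilon> gval x1 y1 * gval x2 y2"
      using f_star_gval[OF *(3)] sim_trans sim_sym by blast
    hence "f_star \<epsilon> (Some (x3, y3)) \<approx>\<^sub>\<epsilon> f_star \<epsilon> P * f_star \<epsilon> Q"
      using PQ sim_trans by blast
    thus ?thesis using *(1) by (simp add: P Q del: ell_add.simps f_star.simps)
  qed
qed

lemma f_star_neg:
  assumes "P \<in> carrier G"
  shows "f_star \<epsilon> (ell_neg P) \<approx>\<^sub>\<epsilon> inverse (f_star \<epsilon> P)"
proof (cases P)
  case None
  thus ?thesis by (simp add: sim_refl)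
next
  case (Some p)
  then obtain x y where P: "P = Some (x, y)" by (cases p) auto
  have oc: "on_curve x y" "0 \<le> x" using assms by (auto simp: P SomeG)
  have "inverse (gval x y) \<approx>\<^sub>\<epsilon> inverse (f_star \<epsilon> P)"
    unfolding P by (intro sim_inverse sim_sym[OF f_star_gval] oc)
  hence "gval x (- y) \<approx>\<^sub>\<epsilon> inverse (f_star \<epsilon> P)" using gval_uminus[OF oc] sim_trans by blast
  hence "f_star \<epsilon> (Some (x, - y)) \<approx>\<^sub>\<epsilon> inverse (f_star \<epsilon> P)" using f_star_gval[OF oc(2)] sim_trans by blast
  thus ?thesis by (simp add: P del: f_star.simps)
qed

lemma f_star_mult_inv:
  assumes "P \<in> carrier G" "Q \<in> carrier G"
  shows "f_star \<epsilon> P \<otimes>\<^bsub>H\<^esub> inv\<^bsub>H\<^esub> (f_star \<epsilon> Q) \<approx>\<^sub>\<epsilon> f_star \<epsilon> P * inverse (f_star \<epsilon> Q)"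
  using mult_H_sim sim_mult[OF sim_refl inv_H_sim[OF f_star_closed[OF assms(2)]]] sim_trans by blast

lemma f_star_diff:
  assumes "P \<in> carrier G" "Q \<in> carrier G"
  shows "f_star \<epsilon> (ell_add \<epsilon> P (ell_neg Q)) \<approx>\<^sub>\<epsilon> f_star \<epsilon> P \<otimes>\<^bsub>H\<^esub> inv\<^bsub>H\<^esub> (f_star \<epsilon> Q)"
proof -
  have "f_star \<epsilon> (ell_add \<epsilon> P (ell_neg Q)) \<approx>\<^sub>\<epsilon> f_star \<epsilon> P * f_star \<epsilon> (ell_neg Q)"
    by (intro f_star_hom assms ell_neg_closed)
  moreover have "f_star \<epsilon> P * f_star \<epsilon> (ell_neg Q) \<approx>\<^sub>\<epsilon> f_star \<epsilon> P * inverse (f_star \<epsilon> Q)"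
    by (intro sim_mult sim_refl f_star_neg assms)
  ultimately show ?thesis using f_star_mult_inv[OF assms] sim_trans sim_sym by blast
qed

text \<open>The companion of \<open>f_star_diff\<close> for members of a coset, which are given as
  sums T + Q and not as points whose difference is known.\<close>

lemma f_star_sum_diff:
  assumes "T \<in> carrier G" "Q \<in> carrier G" "P = ell_add \<epsilon> T Q"
  shows "f_star \<epsilon> T \<approx>\<^sub>\<epsilon> f_star \<epsilon> P \<otimes>\<^bsub>H\<^esub> inv\<^bsub>H\<^esub> (f_star \<epsilon> Q)"
proof -
  have fQ: "f_star \<epsilon> Q \<noteq> 0" using carrier_H_pos[OF f_star_closed[OF assms(2)]] by simp
  have P: "P \<in> carrier G" using ell_add_closed assms by simp
  have "f_star \<epsilon> P * inverse (f_star \<epsilon> Q) \<approx>\<^sub>\<epsilon> f_star \<epsilon> T * f_star \<epsilon> Q * inverse (f_star \<epsilon> Q)"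
    unfolding assms(3) by (intro sim_mult sim_refl f_star_hom assms)
  moreover have "f_star \<epsilon> T * f_star \<epsilon> Q * inverse (f_star \<epsilon> Q) = f_star \<epsilon> T" using fQ by simp
  ultimately have "f_star \<epsilon> P * inverse (f_star \<epsilon> Q) \<approx>\<^sub>\<epsilon> f_star \<epsilon> T" by (simp only:)
  thus ?thesis using f_star_mult_inv[OF P assms(2)] sim_trans sim_sym by blast
qed

section \<open>Preimages of subgroups under \<open>f_star\<close>\<close>

text \<open>The quotient of \<open>b\<close> by \<open>a\<close> lies in the carrier and is similar
  to 1, hence is a finite unit and belongs to \<open>S\<close>.\<close>

lemma subgroup_sim_closed:
  assumes S: "subgroup S H" "finite_units \<subseteq> S" and a: "a \<in> S" and b: "b \<in> carrier H" "b \<approx>\<^sub>\<epsilon> a"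
  shows "b \<in> S"
proof -
  have aH: "a \<in> carrier H" using subgroup.mem_carrier[OF S(1) a] .
  have "b \<otimes>\<^bsub>H\<^esub> inv\<^bsub>H\<^esub> a \<approx>\<^sub>\<epsilon> b * inv\<^bsub>H\<^esub> a" by (rule mult_H_sim)
  moreover have "b * inv\<^bsub>H\<^esub> a \<approx>\<^sub>\<epsilon> a * inverse a" by (intro sim_mult b inv_H_sim aH)
  moreover have "a * inverse a = 1" using carrier_H_pos[OF aH] by simp
  ultimately have "b \<otimes>\<^bsub>H\<^esub> inv\<^bsub>H\<^esub> a \<approx>\<^sub>\<epsilon> 1" using sim_trans by metis
  moreover have "b \<otimes>\<^bsub>H\<^esub> inv\<^bsub>H\<^esub> a \<in> carrier H" using aH b(1) by simp
  ultimately have "b \<otimes>\<^bsub>H\<^esub> inv\<^bsub>H\<^esub> a \<in> S"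
    using sim_one_imp_finite_unit S(2) by (auto simp: carrier_H)
  hence "(b \<otimes>\<^bsub>H\<^esub> inv\<^bsub>H\<^esub> a) \<otimes>\<^bsub>H\<^esub> a \<in> S" using a subgroup.m_closed[OF S(1)] by blast
  thus ?thesis using aH b(1) by (simp add: H.m_assoc)
qed

text \<open>Makes the family intersected in \<open>trunc00\<close> nonempty, so that the
  intersection is a subgroup inside the carrier.\<close>

lemma tdef_bounded_subgroup_carrier_H: "tdef_bounded_subgroup definable_line H (carrier H)"
  unfolding tdef_bounded_subgroup_def
proof (intro conjI)
  show "subgroup (carrier H) H" by (rule H.subgroup_self)
  have "definable_line {\<epsilon>} {x. \<epsilon> \<le> x \<and> x * \<epsilon> < 1}"
    by (intro definable_lineI dform_intros) auto
  moreover have "{x. \<epsilon> \<le> x \<and> x * \<epsilon> < 1} = carrier H"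
    using eps_pos by (auto simp: carrier_H field_simps)
  moreover have "{\<epsilon>} \<prec> (UNIV :: 'a set)"
    by (intro finite_lesspoll_infinite infinite_UNIV_char_0) simp
  ultimately show "type_definable definable_line (carrier H)"
    unfolding type_definable_def by (intro exI[of _ "{\<epsilon>}"] exI[of _ "{carrier H}"]) auto
  have "rcosets\<^bsub>H\<^esub> (carrier H) \<subseteq> {carrier H}"
    using H.coset_join2[OF _ H.subgroup_self] by (auto simp: RCOSETS_def)
  hence "finite (rcosets\<^bsub>H\<^esub> (carrier H))" using finite_subset by blast
  thus "(rcosets\<^bsub>H\<^esub> (carrier H)) \<prec> (UNIV :: 'a set)"
    by (intro finite_lesspoll_infinite infinite_UNIV_char_0)
qed

lemma f_star_vimage_definable:
  assumes "definable_line A Y"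
  shows "definable_points (A \<union> {\<epsilon>}) {P \<in> carrier G. f_star \<epsilon> P \<in> Y}"
proof -
  obtain P where P: "dform A P" "Y = {x. P (tuple_env [x])}"
    using assms unfolding definable_line_iff by blast
  have "dterm (A \<union> {\<epsilon>}) (\<lambda>e. tuple_env [e 0] i)" for i
    by (cases "i = 0") (auto simp: tuple_env_def intro: dterm_var dterm_0)
  hence D: "dform (A \<union> {\<epsilon>}) (\<lambda>e. P (tuple_env [e 0]))"
    using dform_subst[of "A \<union> {\<epsilon>}" "\<lambda>e. tuple_env [e 0]" A P] P(1) by auto
  \<comment> \<open>Division is not in the language: the value of \<open>f_star\<close> is
    introduced by a quantifier, and \<open>1 / x\<close> by the equation
    \<open>z * x = 1\<close>.\<close>
  define Q where "Q = (\<lambda>x y. y * y = x * (x + 1) * (x + \<epsilon>) \<and> 0 \<le> x \<and>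
    (\<exists>z. ((1 \<le> x \<and> z = 1) \<or> (\<not> 1 \<le> x \<and> \<epsilon> < x \<and> 0 \<le> y \<and> z * x = 1) \<or>
      (\<not> 1 \<le> x \<and> \<epsilon> < x \<and> y < 0 \<and> z = x) \<or> (\<not> 1 \<le> x \<and> \<not> \<epsilon> < x \<and> z = \<epsilon>)) \<and> P (tuple_env [z])))"
  have "dform (A \<union> {\<epsilon>}) (\<lambda>e. Q (e 0) (e 1))"
    unfolding Q_def by (intro dform_intros D) auto
  moreover have "Some (x, y) \<in> {P \<in> carrier G. f_star \<epsilon> P \<in> Y} \<longleftrightarrow> Q x y" for x y
  proof -
    have "z * x = 1 \<longleftrightarrow> z = 1 / x" if "\<epsilon> < x" for z
      using that eps_pos by (auto simp: field_simps)
    hence "(\<exists>z. ((1 \<le> x \<and> z = 1) \<or> (\<not> 1 \<le> x \<and> \<epsilon> < x \<and> 0 \<le> y \<and> z * x = 1) \<or>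
      (\<not> 1 \<le> x \<and> \<epsilon> < x \<and> y < 0 \<and> z = x) \<or> (\<not> 1 \<le> x \<and> \<not> \<epsilon> < x \<and> z = \<epsilon>)) \<and> P (tuple_env [z]))
      \<longleftrightarrow> f_star \<epsilon> (Some (x, y)) \<in> Y"
      unfolding P(2) by auto
    thus ?thesis unfolding Q_def by (auto simp: SomeG on_curve_def power2_eq_square simp del: f_star.simps)
  qed
  ultimately show ?thesis by (rule definable_pointsI)
qed

lemma tdef_bounded_subgroup_vimage:
  assumes S: "tdef_bounded_subgroup definable_line H S" and U: "finite_units \<subseteq> S"
  shows "tdef_bounded_subgroup definable_points G {P \<in> carrier G. f_star \<epsilon> P \<in> S}"
proof -
  have sub: "subgroup S H" and idx: "(rcosets\<^bsub>H\<^esub> S) \<prec> (UNIV :: 'a set)"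
    using S by (auto simp: tdef_bounded_subgroup_def)
  note sim_closed = subgroup_sim_closed[OF sub U]
  define T where "T = {P \<in> carrier G. f_star \<epsilon> P \<in> S}"
  have "subgroup T G"
  proof
    show "T \<subseteq> carrier G" by (auto simp: T_def)
    show "\<one>\<^bsub>G\<^esub> \<in> T" using subgroup.one_closed[OF sub] by (simp add: T_def one_G NoneG one_H)
  next
    fix P Q assume PQ: "P \<in> T" "Q \<in> T"
    have "f_star \<epsilon> P \<otimes>\<^bsub>H\<^esub> f_star \<epsilon> Q \<in> S" using PQ subgroup.m_closed[OF sub] by (auto simp: T_def)
    moreover have "f_star \<epsilon> (ell_add \<epsilon> P Q) \<approx>\<^sub>\<epsilon> f_star \<epsilon> P \<otimes>\<^bsub>H\<^esub> f_star \<epsilon> Q"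
      using f_star_hom[of P Q] PQ mult_H_sim sim_trans sim_sym unfolding T_def by blast
    moreover have "ell_add \<epsilon> P Q \<in> carrier G" using PQ ell_add_closed by (simp add: T_def)
    ultimately show "P \<otimes>\<^bsub>G\<^esub> Q \<in> T" using sim_closed f_star_closed by (simp add: T_def mult_G)
  next
    fix P assume P: "P \<in> T"
    hence PG: "P \<in> carrier G" by (simp add: T_def)
    have "inv\<^bsub>H\<^esub> (f_star \<epsilon> P) \<in> S" using P subgroup.m_inv_closed[OF sub] by (auto simp: T_def)
    moreover have "f_star \<epsilon> (ell_neg P) \<approx>\<^sub>\<epsilon> inv\<^bsub>H\<^esub> (f_star \<epsilon> P)"
      using f_star_neg[OF PG] inv_H_sim[OF f_star_closed[OF PG]] sim_trans sim_sym by blast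
    ultimately show "inv\<^bsub>G\<^esub> P \<in> T"
      using sim_closed f_star_closed ell_neg_closed[OF PG] by (simp add: T_def inv_G[OF PG])
  qed
  moreover have "type_definable definable_points T"
  proof -
    obtain A \<F> where A: "A \<prec> (UNIV :: 'a set)" "\<And>Y. Y \<in> \<F> \<Longrightarrow> definable_line A Y" "S = \<Inter>\<F>"
      using S unfolding tdef_bounded_subgroup_def type_definable_def by metis
    let ?pre = "\<lambda>Y. {P \<in> carrier G. f_star \<epsilon> P \<in> Y}"
    \<comment> \<open>Adding the whole line keeps the family nonempty, so the intersection of the
      preimages stays inside \<open>carrier G\<close>.\<close>
    have "definable_line A {x. x = x}" by (intro definable_lineI dform_intros)
    hence "definable_points (A \<union> {\<epsilon>}) (?pre Y)" if "Y \<in> insert {x. x = x} \<F>" for Y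
      using that A(2) f_star_vimage_definable by blast
    moreover have "T = \<Inter>(?pre ` insert {x. x = x} \<F>)"
      unfolding T_def A(3) by auto
    ultimately show ?thesis
      unfolding type_definable_def using lesspoll_Un_finite[OF A(1), of "{\<epsilon>}"]
      by (intro exI[of _ "A \<union> {\<epsilon>}"] exI[of _ "?pre ` insert {x. x = x} \<F>"]) blast
  qed
  moreover have "(rcosets\<^bsub>G\<^esub> T) \<prec> (UNIV :: 'a set)"
  proof -
    \<comment> \<open>Every coset of \<open>T\<close> is the full preimage of a coset of
      \<open>S\<close>, so there are at most as many of them.\<close>
    define \<psi> where "\<psi> = (\<lambda>C. {R \<in> carrier G. f_star \<epsilon> R \<in> C})"
    have "T #>\<^bsub>G\<^esub> P = \<psi> (S #>\<^bsub>H\<^esub> f_star \<epsilon> P)" if P: "P \<in> carrier G" for P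
    proof -
      have fP: "f_star \<epsilon> P \<in> carrier H" using f_star_closed[OF P] .
      have co: "f_star \<epsilon> R \<in> S #>\<^bsub>H\<^esub> f_star \<epsilon> P \<longleftrightarrow> f_star \<epsilon> R \<otimes>\<^bsub>H\<^esub> inv\<^bsub>H\<^esub> (f_star \<epsilon> P) \<in> S"
        if "R \<in> carrier G" for R
        using subgroup.rcos_module[OF sub H.group_axioms fP f_star_closed[OF that]] .
      have "R \<in> T #>\<^bsub>G\<^esub> P \<longleftrightarrow> R \<in> \<psi> (S #>\<^bsub>H\<^esub> f_star \<epsilon> P)" for R
      proof
        assume "R \<in> T #>\<^bsub>G\<^esub> P"
        then obtain t where t: "t \<in> T" "R = ell_add \<epsilon> t P" by (auto simp: r_coset_def mult_G)
        have R: "R \<in> carrier G" using t P ell_add_closed by (simp add: T_def)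
        have "f_star \<epsilon> R \<otimes>\<^bsub>H\<^esub> inv\<^bsub>H\<^esub> (f_star \<epsilon> P) \<approx>\<^sub>\<epsilon> f_star \<epsilon> t"
          using f_star_sum_diff[OF _ P t(2)] t(1) sim_sym by (simp add: T_def)
        moreover have "f_star \<epsilon> R \<otimes>\<^bsub>H\<^esub> inv\<^bsub>H\<^esub> (f_star \<epsilon> P) \<in> carrier H"
          using f_star_closed[OF R] fP by simp
        ultimately have "f_star \<epsilon> R \<otimes>\<^bsub>H\<^esub> inv\<^bsub>H\<^esub> (f_star \<epsilon> P) \<in> S"
          using sim_closed[of "f_star \<epsilon> t"] t(1) unfolding T_def by blast
        thus "R \<in> \<psi> (S #>\<^bsub>H\<^esub> f_star \<epsilon> P)" using co R by (simp add: \<psi>_def)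
      next
        assume R: "R \<in> \<psi> (S #>\<^bsub>H\<^esub> f_star \<epsilon> P)"
        hence RG: "R \<in> carrier G" by (simp add: \<psi>_def)
        have "f_star \<epsilon> R \<otimes>\<^bsub>H\<^esub> inv\<^bsub>H\<^esub> (f_star \<epsilon> P) \<in> S" using R co unfolding \<psi>_def by blast
        moreover have c: "ell_add \<epsilon> R (ell_neg P) \<in> carrier G"
          by (intro ell_add_closed RG ell_neg_closed P)
        ultimately have "ell_add \<epsilon> R (ell_neg P) \<in> T"
          using sim_closed[OF _ f_star_closed[OF c] f_star_diff[OF RG P]] unfolding T_def by blast
        thus "R \<in> T #>\<^bsub>G\<^esub> P"
          using ell_add_neg_cancel[OF RG P] unfolding r_coset_def mult_G by force
      qed
      thus ?thesis by blast
    qed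
    hence "rcosets\<^bsub>G\<^esub> T \<subseteq> \<psi> ` (rcosets\<^bsub>H\<^esub> S)"
      using f_star_closed unfolding RCOSETS_def by blast
    hence "(rcosets\<^bsub>G\<^esub> T) \<lesssim> (rcosets\<^bsub>H\<^esub> S)"
      by (rule lepoll_trans[OF subset_imp_lepoll image_lepoll])
    thus ?thesis using idx lesspoll_trans1 by blast
  qed
  ultimately show ?thesis unfolding tdef_bounded_subgroup_def T_def by blast
qed

end

text \<open>If \<open>of_nat n * \<epsilon>\<close> reached 1, then \<open>1 / \<epsilon>\<close>
  would lie in the valuation ring and \<epsilon> would have value at most that of 1.\<close>

lemma infinitesimal_of_val:
  fixes \<epsilon> :: "'a::linordered_field"
  assumes "0 < \<epsilon>" "val_less (std_val 1) (std_val \<epsilon>)"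
  shows "infinitesimal \<epsilon>"
proof
  show "0 < \<epsilon>" by fact
  fix n :: nat
  have r: "x \<in> std_val_ring" if "0 \<le> x" "x \<le> of_nat m" for x :: 'a and m
    unfolding std_val_ring_def mem_Collect_eq using that
    by (intro exI[of _ "0 :: rat"] exI[of _ "of_nat m :: rat"]) (simp add: of_rat_of_nat_eq)
  have "1 \<in> (std_val_units :: 'a set)"
    unfolding std_val_units_def using r[of 1 1] by auto
  hence u: "\<epsilon> \<in> std_val \<epsilon>" "(1 :: 'a) \<in> std_val 1" unfolding std_val_def by force+
  show "of_nat n * \<epsilon> < 1"
  proof (rule ccontr)
    assume "\<not> of_nat n * \<epsilon> < 1"
    hence "1 / \<epsilon> \<in> std_val_ring" using assms(1) by (intro r[of _ n]) (auto simp: field_simps)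
    hence "val_le (std_val \<epsilon>) (std_val 1)"
      unfolding val_le_def using u assms(1)
      by (intro bexI[of _ \<epsilon>] bexI[of _ 1] bexI[of _ "1 / \<epsilon>"]) auto
    thus False using assms(2) by (simp add: val_less_def)
  qed
qed

theorem theorem3p7:
  fixes \<epsilon> :: "'a::real_closed_field"
  assumes "saturated_field TYPE('a)"
    and "0 < \<epsilon>" and "\<epsilon> < 1"
    and "val_less (std_val 1) (std_val \<epsilon>)"
  shows "(\<forall>P\<in>carrier (ell_group0 \<epsilon>). \<forall>Q\<in>carrier (ell_group0 \<epsilon>).
            P \<otimes>\<^bsub>ell_group0 \<epsilon>\<^esub> inv\<^bsub>ell_group0 \<epsilon>\<^esub> Q \<in> ell00 \<epsilon> \<longrightarrow>
            f_star \<epsilon> P \<otimes>\<^bsub>trunc_group \<epsilon>\<^esub> inv\<^bsub>trunc_group \<epsilon>\<^esub> (f_star \<epsilon> Q) \<in> trunc00 \<epsilon>)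
       \<and> (\<exists>f \<in> carrier (ell_group0 \<epsilon> Mod ell00 \<epsilon>) \<rightarrow> carrier (trunc_group \<epsilon> Mod trunc00 \<epsilon>).
            \<forall>P\<in>carrier (ell_group0 \<epsilon>).
              f (ell00 \<epsilon> #>\<^bsub>ell_group0 \<epsilon>\<^esub> P) = trunc00 \<epsilon> #>\<^bsub>trunc_group \<epsilon>\<^esub> f_star \<epsilon> P)"
proof -
  have inf: "infinitesimal \<epsilon>" by (rule infinitesimal_of_val[OF assms(2,4)])
  interpret infinitesimal \<epsilon> by (rule inf)
  have U: "finite_units \<subseteq> S" if "tdef_bounded_subgroup definable_line H S" for S
    by (rule finite_units_subset_bounded_subgroup[OF assms(1) inf that])
  \<comment> \<open>The preimage of \<open>S\<close> is one of the sets whose intersection is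
    \<open>ell00\<close>.\<close>
  have E: "P \<in> carrier G \<and> f_star \<epsilon> P \<in> S"
    if "P \<in> ell00 \<epsilon>" "tdef_bounded_subgroup definable_line H S" for P S
    using that tdef_bounded_subgroup_vimage[OF that(2) U[OF that(2)]] unfolding conn00_def by blast
  have E_carrier: "P \<in> carrier G" if "P \<in> ell00 \<epsilon>" for P
    using E[OF that tdef_bounded_subgroup_carrier_H] by blast
  have E_None: "None \<in> ell00 \<epsilon>"
    unfolding conn00_def tdef_bounded_subgroup_def using subgroup.one_closed one_G by fastforce
  have "subgroup S H" if "tdef_bounded_subgroup definable_line H S" for S
    using that by (simp add: tdef_bounded_subgroup_def)
  hence sub00: "subgroup (trunc00 \<epsilon>) H"
    unfolding conn00_def using tdef_bounded_subgroup_carrier_H by (intro H.subgroups_Inter) auto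
  have mem00: "f_star \<epsilon> P \<otimes>\<^bsub>H\<^esub> inv\<^bsub>H\<^esub> (f_star \<epsilon> Q) \<in> trunc00 \<epsilon>"
    if PQ: "P \<in> carrier G" "Q \<in> carrier G" and t: "t \<in> ell00 \<epsilon>"
      and sim: "f_star \<epsilon> t \<approx>\<^sub>\<epsilon> f_star \<epsilon> P \<otimes>\<^bsub>H\<^esub> inv\<^bsub>H\<^esub> (f_star \<epsilon> Q)" for P Q t
    unfolding conn00_def
  proof (intro InterI, unfold mem_Collect_eq)
    fix S assume S: "tdef_bounded_subgroup definable_line H S"
    hence "subgroup S H" by (simp add: tdef_bounded_subgroup_def)
    moreover have "f_star \<epsilon> P \<otimes>\<^bsub>H\<^esub> inv\<^bsub>H\<^esub> (f_star \<epsilon> Q) \<in> carrier H"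
      using f_star_closed PQ by simp
    ultimately show "f_star \<epsilon> P \<otimes>\<^bsub>H\<^esub> inv\<^bsub>H\<^esub> (f_star \<epsilon> Q) \<in> S"
      using subgroup_sim_closed[OF _ U[OF S] _ _ sim_sym[OF sim]] E[OF t S] by blast
  qed
  have part1: "f_star \<epsilon> P \<otimes>\<^bsub>H\<^esub> inv\<^bsub>H\<^esub> (f_star \<epsilon> Q) \<in> trunc00 \<epsilon>"
    if "P \<in> carrier G" "Q \<in> carrier G" "P \<otimes>\<^bsub>G\<^esub> inv\<^bsub>G\<^esub> Q \<in> ell00 \<epsilon>" for P Q
    using mem00[OF that] f_star_diff[OF that(1,2)] inv_G[OF that(2)] by (simp add: mult_G)
  have coset_eq: "trunc00 \<epsilon> #>\<^bsub>H\<^esub> f_star \<epsilon> P = trunc00 \<epsilon> #>\<^bsub>H\<^esub> f_star \<epsilon> Q"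
    if PQ: "P \<in> carrier G" "Q \<in> carrier G" and eq: "ell00 \<epsilon> #>\<^bsub>G\<^esub> P = ell00 \<epsilon> #>\<^bsub>G\<^esub> Q" for P Q
  proof -
    \<comment> \<open>Since \<open>None\<close> lies in \<open>ell00\<close>, P lies in its own
      coset and so in that of Q, which presents P as a sum t + Q with t in
      \<open>ell00\<close>.\<close>
    have "ell_add \<epsilon> None P \<in> ell00 \<epsilon> #>\<^bsub>G\<^esub> P"
      using E_None unfolding r_coset_def mult_G by blast
    hence "P \<in> ell00 \<epsilon> #>\<^bsub>G\<^esub> Q" using eq by simp
    then obtain t where t: "t \<in> ell00 \<epsilon>" "P = ell_add \<epsilon> t Q" by (auto simp: r_coset_def mult_G)
    have "f_star \<epsilon> P \<otimes>\<^bsub>H\<^esub> inv\<^bsub>H\<^esub> (f_star \<epsilon> Q) \<in> trunc00 \<epsilon>"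
      by (rule mem00[OF PQ t(1) f_star_sum_diff[OF E_carrier[OF t(1)] PQ(2) t(2)]])
    hence "f_star \<epsilon> P \<in> trunc00 \<epsilon> #>\<^bsub>H\<^esub> f_star \<epsilon> Q"
      using subgroup.rcos_module[OF sub00 H.group_axioms] f_star_closed PQ by blast
    thus ?thesis using H.repr_independence[OF _ f_star_closed[OF PQ(2)] sub00] by simp
  qed
  \<comment> \<open>The map on cosets is defined through a chosen representative;
    \<open>coset_eq\<close> shows that its value does not depend on the choice.\<close>
  define rep where "rep = (\<lambda>C. SOME P. P \<in> carrier G \<and> C = ell00 \<epsilon> #>\<^bsub>G\<^esub> P)"
  have rep: "rep (ell00 \<epsilon> #>\<^bsub>G\<^esub> P) \<in> carrier G \<and> ell00 \<epsilon> #>\<^bsub>G\<^esub> P = ell00 \<epsilon> #>\<^bsub>G\<^esub> rep (ell00 \<epsilon> #>\<^bsub>G\<^esub> P)"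
    if "P \<in> carrier G" for P
    unfolding rep_def by (rule someI[of _ P]) (use that in simp)
  define f where "f = (\<lambda>C. trunc00 \<epsilon> #>\<^bsub>H\<^esub> f_star \<epsilon> (rep C))"
  have f: "f (ell00 \<epsilon> #>\<^bsub>G\<^esub> P) = trunc00 \<epsilon> #>\<^bsub>H\<^esub> f_star \<epsilon> P" if "P \<in> carrier G" for P
    unfolding f_def using coset_eq[of P "rep (ell00 \<epsilon> #>\<^bsub>G\<^esub> P)"] rep[OF that] that by simp
  have "f \<in> carrier (G Mod ell00 \<epsilon>) \<rightarrow> carrier (H Mod trunc00 \<epsilon>)"
  proof
    fix C assume "C \<in> carrier (G Mod ell00 \<epsilon>)"
    then obtain P where P: "P \<in> carrier G" "C = ell00 \<epsilon> #>\<^bsub>G\<^esub> P"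
      by (auto simp: FactGroup_def RCOSETS_def)
    show "f C \<in> carrier (H Mod trunc00 \<epsilon>)"
      unfolding P(2) f[OF P(1)] FactGroup_def RCOSETS_def using f_star_closed[OF P(1)] by auto
  qed
  thus ?thesis using part1 f by blast
qed

end
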